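(* Let $N\ge1$ be an integer, let $\Phi=\mathcal{F}(L^2(\mathbb{R}_+;\mathbb{C}^N))$ be the free Fock space of multiplicity $N$, and let $(\mathcal{S}_n)_{n\ge1}$, $\mathcal{S}_n=\{0=t_0^{(n)}<t_1^{(n)}<\cdots\}$, be a sequence of refining partitions of $\mathbb{R}_+$ (each $\mathcal{S}_{n+1}$ refines $\mathcal{S}_n$) such that $\delta(\mathcal{S}_n)\to0$. Let $P_n$ be the orthogonal projection of $\Phi$ onto $T\Phi(\mathcal{S}_n)$. Then: (1) For every $f\in\Phi$, $P_nf\to f$ in $\Phi$ as $n\to\infty$. (2) For $i,j\in\{0,1,\dots,N\}$ put $\varepsilon_{ij}=\frac12(\delta_{0i}+\delta_{0j})$, where $\delta_{0i}$ is the Kronecker symbol. Then, for all $t\in\mathbb{R}_+$ and all $i,j\in\{0,\dots,N\}$, the operators $$\sum_{k:\,t_k^{(n)}\le t}\left(t_{k+1}^{(n)}-t_k^{(n)}\right)^{\varepsilon_{ij}}a^i_j(k)$$ converge strongly on $\Phi$, as $n\to\infty$, to $a^i_j(t)$, where $a^i_j(k)$ denotes the discrete operator associated with the partition $\mathcal{S}_n$.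
   Context: Free Fock space: for a complex Hilbert space $\mathcal{H}$, $\mathcal{F}(\mathcal{H})=\mathbb{C}\Omega\oplus\bigoplus_{n\ge1}\mathcal{H}^{\otimes n}$ (orthogonal Hilbert sum, $\|\Omega\|=1$). For $f\in\mathcal{H}$ and $T\in\mathcal{B}(\mathcal{H})$: $l(f)\Omega=f$, $l(f)e_1\otimes\cdots\otimes e_n=f\otimes e_1\otimes\cdots\otimes e_n$; $l^*(f)\Omega=0$, $l^*(f)e_1\otimes\cdots\otimes e_n=\langle f,e_1\rangle e_2\otimes\cdots\otimes e_n$ (inner products linear in the second variable; for $n=1$ the result is $\langle f,e_1\rangle\Omega$); $\Lambda(T)\Omega=0$, $\Lambda(T)e_1\otimes\cdots\otimes e_n=T(e_1)\otimes e_2\otimes\cdots\otimes e_n$. Continuous-time operators on $\Phi=\mathcal{F}(L^2(\mathbb{R}_+;\mathbb{C}^N))$: let $\mathbf{1}^j_A\in L^2(\mathbb{R}_+;\mathbb{C}^N)$ be the function equal to the $j$-th canonical basis vector of $\mathbb{C}^N$ on $A$ and $0$ elsewhere, and $\mathbf{1}^j_t=\mathbf{1}^j_{[0,t)}$. For $i,j\in\{1,\dots,N\}$ and $t\ge0$: $a^0_j(t)=l(\mathbf{1}^j_t)$; $a^i_0(t)=l^*(\mathbf{1}^i_t)$; $a^i_j(t)=\Lambda(T)$, where $T$ is the operator on $L^2(\mathbb{R}_+;\mathbb{C}^N)$ sending $g=(g_1,\dots,g_N)$ to the function whose $j$-th component is $\mathbf{1}_{[0,t)}g_i$ and whose other components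 are $0$; and $a^0_0(t)=t\,\mathrm{Id}$. Partitions: a partition $\mathcal{S}=\{0=t_0<t_1<\cdots<t_k<\cdots\}$ of $\mathbb{R}_+$ is a strictly increasing sequence such that the intervals $[t_i,t_{i+1})$ cover $\mathbb{R}_+$; its diameter is $\delta(\mathcal{S})=\sup_i|t_{i+1}-t_i|$. Toy Fock space of $\mathcal{S}$: put $X^j(k)=\mathbf{1}^j_{[t_k,t_{k+1})}/\sqrt{t_{k+1}-t_k}$ for $k\in\mathbb{N}=\{0,1,2,\dots\}$, $1\le j\le N$. A generalized adapted word is a finite (possibly empty) word $\sigma=[(i_1,j_1),\dots,(i_n,j_n)]$ with $i_m\in\mathbb{N}$, $j_m\in\{1,\dots,N\}$ and $i_m\ne i_{m+1}$ for all $1\le m<n$. Put $X_\sigma(\mathcal{S})=X^{j_1}(i_1)\otimes\cdots\otimes X^{j_n}(i_n)$ and $X_\emptyset(\mathcal{S})=\Omega$. The space $T\Phi(\mathcal{S})$ is the closed subspace of $\Phi$ with orthonormal basis $\{X_\sigma(\mathcal{S})\}$, $\sigma$ running over generalized adapted words. Discrete operators: on $\mathbb{C}^{N+1}$ with basis $X^0=\Omega,X^1,\dots,X^N$, let $a^i_jX^k=\delta_{ik}X^j$. Via the identification of $T\Phi(\mathcal{S})$ with the free product of copies of $\mathbb{C}^{N+1}$ indexed by $k\in\mathbb{N}$, the operator $a^i_j$ on the $k$-th copy yields $a^i_j(k)$ on $T\Phi(\mathcal{S})$, extended by $0$ on $T\Phi(\mathcal{S})^\perp$. Explicitly, for $i,j\in\{1,\dots,N\}$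 and a generalized adapted word $\sigma$, call "$\sigma$ does not start at $k$" the condition that $\sigma$ is empty or its first letter $(i_1,j_1)$ has $i_1\ne k$. Then: if $\sigma$ does not start at $k$, $a^0_j(k)X_\sigma=X^j(k)\otimes X_\sigma$ (meaning $X^j(k)$ if $\sigma=\emptyset$), $a^0_0(k)X_\sigma=X_\sigma$, $a^i_0(k)X_\sigma=0$, $a^i_j(k)X_\sigma=0$; and for $X^l(k)\otimes X_\sigma$ with $l\in\{1,\dots,N\}$ and $\sigma$ not starting at $k$, $a^0_j(k)$ and $a^0_0(k)$ give $0$, $a^i_0(k)(X^l(k)\otimes X_\sigma)=\delta_{il}X_\sigma$, and $a^i_j(k)(X^l(k)\otimes X_\sigma)=\delta_{il}X^j(k)\otimes X_\sigma$. Strong convergence means convergence in the strong operator topology of bounded operators on $\Phi$. *)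

theory Defs
  imports "HOL-Analysis.Analysis"
begin

section \<open>Complex inner product spaces\<close>

text \<open>
  The distribution only has real inner product spaces.  A complex inner product space is a real one
  (with inner product the real part of the complex one) carrying in addition a complex scalar
  multiplication and a sesquilinear form, linear in the second variable.  Positivity and
  definiteness of the complex form are those of its real part.
\<close>

class complex_inner = real_inner +
  fixes scaleC :: "complex \<Rightarrow> 'a \<Rightarrow> 'a"  (infixr "*\<^sub>C" 75)
    and cinner :: "'a \<Rightarrow> 'a \<Rightarrow> complex"
  assumes scaleC_add_right: "scaleC a (x + y) = scaleC a x + scaleC a y"
    and scaleC_add_left: "scaleC (a + b) x = scaleC a x + scaleC b x"
    and scaleC_scaleC: "scaleC a (scaleC b x) = scaleC (a * b) x"
    and scaleR_scaleC: "scaleR r x = scaleC (complex_of_real r) x"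
    and cinner_commute: "cinner x y = cnj (cinner y x)"
    and cinner_add_right: "cinner x (y + z) = cinner x y + cinner x z"
    and cinner_scaleC_right: "cinner x (scaleC a y) = a * cinner x y"
    and inner_cinner: "inner x y = Re (cinner x y)"
begin

lemma cinner_add_left: "cinner (x + y) z = cinner x z + cinner y z"
  by (subst (1 2 3) cinner_commute) (simp add: cinner_add_right)

lemma cinner_scaleC_left: "cinner (scaleC a x) y = cnj a * cinner x y"
  by (subst (1 2) cinner_commute) (simp add: cinner_scaleC_right)

lemma cinner_self: "cinner x x = complex_of_real (inner x x)"
proof -
  have "Im (cinner x x) = 0"
    using arg_cong[OF cinner_commute[of x x], of Im] by simp
  thus ?thesis by (simp add: inner_cinner complex_eq_iff)
qed

end

lemma scaleC_one: "1 *\<^sub>C x = (x :: 'a::complex_inner)"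
  using scaleR_scaleC[of 1 x] by simp

global_interpretation complex_vector: vector_space "scaleC :: complex \<Rightarrow> 'a::complex_inner \<Rightarrow> 'a"
  defines cspan = complex_vector.span
  by unfold_locales (auto simp: scaleC_add_right scaleC_add_left scaleC_scaleC scaleC_one)

lemma cinner_zero_right [simp]: "cinner x (0::'a::complex_inner) = 0"
  using cinner_add_right[of x 0 0] by simp

lemma cinner_zero_left [simp]: "cinner (0::'a::complex_inner) x = 0"
  using cinner_add_left[of 0 0 x] by simp

lemma cinner_minus_right [simp]: "cinner x (- y::'a::complex_inner) = - cinner x y"
  using cinner_add_right[of x y "- y"] by (simp add: eq_neg_iff_add_eq_0 add.commute)

lemma cinner_minus_left [simp]: "cinner (- y::'a::complex_inner) x = - cinner y x"
  using cinner_add_left[of y "- y" x] by (simp add: eq_neg_iff_add_eq_0 add.commute)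

lemma cinner_diff_right: "cinner x (y - z::'a::complex_inner) = cinner x y - cinner x z"
  using cinner_add_right[of x y "- z"] by simp

lemma cinner_diff_left: "cinner (y - z::'a::complex_inner) x = cinner y x - cinner z x"
  using cinner_add_left[of y "- z" x] by simp

lemma cinner_sum_right: "cinner x (\<Sum>i\<in>I. f i :: 'a::complex_inner) = (\<Sum>i\<in>I. cinner x (f i))"
  by (induction I rule: infinite_finite_induct) (auto simp: cinner_add_right)

lemma cinner_sum_left: "cinner (\<Sum>i\<in>I. f i :: 'a::complex_inner) x = (\<Sum>i\<in>I. cinner (f i) x)"
  by (induction I rule: infinite_finite_induct) (auto simp: cinner_add_left)

lemma cinner_eq_zero_iff [simp]: "cinner x x = 0 \<longleftrightarrow> x = (0::'a::complex_inner)"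
  by (simp add: cinner_self)

lemma norm_scaleC: "norm (a *\<^sub>C (x::'a::complex_inner)) = cmod a * norm x"
proof -
  have "(norm (a *\<^sub>C x))\<^sup>2 = Re (a * cnj a * cinner x x)"
    by (simp add: power2_norm_eq_inner inner_cinner cinner_scaleC_left cinner_scaleC_right
        mult_ac del: complex_mult_cnj)
  also have "a * cnj a * cinner x x = complex_of_real ((cmod a)\<^sup>2 * (norm x)\<^sup>2)"
    unfolding complex_norm_square[symmetric] cinner_self power2_norm_eq_inner of_real_mult
    by simp
  finally have "(norm (a *\<^sub>C x))\<^sup>2 = (cmod a * norm x)\<^sup>2"
    by (simp add: power_mult_distrib)
  thus ?thesis by (simp add: power2_eq_iff_nonneg)
qed

lemma cinner_Cauchy_Schwarz: "cmod (cinner x y) \<le> norm x * norm (y::'a::complex_inner)"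
proof (cases "cinner x y = 0")
  case False
  define u where "u = cnj (sgn (cinner x y))"
  have u: "cmod u = 1" using False by (simp add: u_def norm_sgn)
  have "u * cinner x y = complex_of_real (cmod (cinner x y))"
    using False complex_norm_square[of "cinner x y"]
    by (simp add: u_def sgn_eq field_simps power2_eq_square)
  hence "cmod (cinner x y) = Re (u * cinner x y)" by simp
  also have "\<dots> = inner x (u *\<^sub>C y)" by (simp add: inner_cinner cinner_scaleC_right)
  also have "\<dots> \<le> norm x * norm (u *\<^sub>C y)" by (rule norm_cauchy_schwarz)
  finally show ?thesis by (simp add: norm_scaleC u)
qed simp

definition bounded_clinear :: "('a::complex_inner \<Rightarrow> 'b::complex_inner) \<Rightarrow> bool" where
  "bounded_clinear A \<longleftrightarrow> bounded_linear A \<and> (\<forall>c x. A (c *\<^sub>C x) = c *\<^sub>C A x)"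

definition orth_proj :: "'a::complex_inner set \<Rightarrow> 'a \<Rightarrow> 'a" where
  "orth_proj M x = (THE y. y \<in> M \<and> (\<forall>z\<in>M. cinner z (x - y) = 0))"

definition strongly_converges :: "(nat \<Rightarrow> 'a::complex_inner \<Rightarrow> 'a) \<Rightarrow> ('a \<Rightarrow> 'a) \<Rightarrow> bool" where
  "strongly_converges A B \<longleftrightarrow>
     (\<forall>n. bounded_clinear (A n)) \<and> bounded_clinear B \<and> (\<forall>x. (\<lambda>n. A n x) \<longlonglongrightarrow> B x)"


section \<open>Completion of a complex inner product space\<close>

lemma Cauchy_add':
  fixes X Y :: "nat \<Rightarrow> 'a::real_normed_vector"
  assumes "Cauchy X" "Cauchy Y" shows "Cauchy (\<lambda>n. X n + Y n)"
proof (rule CauchyI)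
  fix e :: real assume e: "e > 0"
  obtain M where M: "\<And>m n. m \<ge> M \<Longrightarrow> n \<ge> M \<Longrightarrow> norm (X m - X n) < e/2"
    using CauchyD[OF assms(1), of "e/2"] e by auto
  obtain N where N: "\<And>m n. m \<ge> N \<Longrightarrow> n \<ge> N \<Longrightarrow> norm (Y m - Y n) < e/2"
    using CauchyD[OF assms(2), of "e/2"] e by auto
  show "\<exists>K. \<forall>m\<ge>K. \<forall>n\<ge>K. norm (X m + Y m - (X n + Y n)) < e"
  proof (intro exI allI impI)
    fix m n assume "m \<ge> max M N" "n \<ge> max M N"
    hence "norm (X m - X n) < e/2" "norm (Y m - Y n) < e/2" using M N by auto
    moreover have "norm (X m + Y m - (X n + Y n)) \<le> norm (X m - X n) + norm (Y m - Y n)"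
      by (metis add_diff_add norm_triangle_ineq)
    ultimately show "norm (X m + Y m - (X n + Y n)) < e" by linarith
  qed
qed

lemma Cauchy_scaleC:
  fixes X :: "nat \<Rightarrow> 'a::complex_inner"
  assumes "Cauchy X" shows "Cauchy (\<lambda>n. c *\<^sub>C X n)"
proof (cases "c = 0")
  case False
  show ?thesis
  proof (rule CauchyI)
    fix e :: real assume e: "e > 0"
    obtain M where M: "\<And>m n. m \<ge> M \<Longrightarrow> n \<ge> M \<Longrightarrow> norm (X m - X n) < e / cmod c"
      using CauchyD[OF assms(1), of "e / cmod c"] e False by auto
    show "\<exists>K. \<forall>m\<ge>K. \<forall>n\<ge>K. norm (c *\<^sub>C X m - c *\<^sub>C X n) < e"
    proof (intro exI allI impI)
      fix m n assume "m \<ge> M" "n \<ge> M"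
      from M[OF this] have "cmod c * norm (X m - X n) < e"
        using False by (simp add: pos_less_divide_eq mult.commute)
      thus "norm (c *\<^sub>C X m - c *\<^sub>C X n) < e"
        by (metis complex_vector.scale_right_diff_distrib norm_scaleC)
    qed
  qed
qed (simp add: Cauchy_def)

lemma Cauchy_cinner:
  fixes X Y :: "nat \<Rightarrow> 'a::complex_inner"
  assumes X: "Cauchy X" and Y: "Cauchy Y" shows "Cauchy (\<lambda>n. cinner (X n) (Y n))"
proof -
  obtain A where A: "A > 0" "\<And>n. norm (X n) \<le> A" using Cauchy_Bseq[OF X] BseqE by blast
  obtain B where B: "B > 0" "\<And>n. norm (Y n) \<le> B" using Cauchy_Bseq[OF Y] BseqE by blast
  show ?thesis
  proof (rule CauchyI)
    fix e :: real assume e: "e > 0"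
    obtain M where M: "\<And>m n. m \<ge> M \<Longrightarrow> n \<ge> M \<Longrightarrow> norm (X m - X n) < e / (2 * B)"
      using CauchyD[OF X, of "e / (2 * B)"] e B by auto
    obtain N where N: "\<And>m n. m \<ge> N \<Longrightarrow> n \<ge> N \<Longrightarrow> norm (Y m - Y n) < e / (2 * A)"
      using CauchyD[OF Y, of "e / (2 * A)"] e A by auto
    show "\<exists>K. \<forall>m\<ge>K. \<forall>n\<ge>K. norm (cinner (X m) (Y m) - cinner (X n) (Y n)) < e"
    proof (intro exI allI impI)
      fix m n assume mn: "m \<ge> max M N" "n \<ge> max M N"
      have "cinner (X m) (Y m) - cinner (X n) (Y n)
            = cinner (X m - X n) (Y m) + cinner (X n) (Y m - Y n)"
        by (simp add: cinner_diff_left cinner_diff_right)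
      also have "cmod \<dots> \<le> norm (X m - X n) * norm (Y m) + norm (X n) * norm (Y m - Y n)"
        by (rule order.trans[OF norm_triangle_ineq add_mono]) (rule cinner_Cauchy_Schwarz)+
      also have "\<dots> \<le> norm (X m - X n) * B + A * norm (Y m - Y n)"
        using A B by (intro add_mono mult_mono) auto
      also have "\<dots> < e / (2 * B) * B + A * (e / (2 * A))"
        using A B mn M[of m n] N[of m n]
        by (intro add_strict_mono mult_strict_right_mono mult_strict_left_mono) auto
      also have "\<dots> = e" using A B by (simp add: field_simps)
      finally show "cmod (cinner (X m) (Y m) - cinner (X n) (Y n)) < e" .
    qed
  qed
qed

definition completion_rel :: "(nat \<Rightarrow> 'a::complex_inner) \<Rightarrow> (nat \<Rightarrow> 'a) \<Rightarrow> bool" where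
  "completion_rel X Y \<longleftrightarrow> Cauchy X \<and> Cauchy Y \<and> (\<lambda>n. X n - Y n) \<longlonglongrightarrow> 0"

lemma part_equivp_completion_rel: "part_equivp completion_rel"
proof (rule part_equivpI)
  show "\<exists>x::nat \<Rightarrow> 'a. completion_rel x x"
    by (rule exI[of _ "\<lambda>_. 0"]) (auto simp: completion_rel_def Cauchy_def)
  show "symp (completion_rel :: (nat \<Rightarrow> 'a) \<Rightarrow> _)"
  proof (rule sympI)
    fix X Y :: "nat \<Rightarrow> 'a" assume "completion_rel X Y"
    thus "completion_rel Y X"
      using tendsto_minus[of "\<lambda>n. X n - Y n" 0 sequentially] by (auto simp: completion_rel_def)
  qed
  show "transp (completion_rel :: (nat \<Rightarrow> 'a) \<Rightarrow> _)"
  proof (rule transpI)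
    fix X Y Z :: "nat \<Rightarrow> 'a" assume "completion_rel X Y" "completion_rel Y Z"
    thus "completion_rel X Z"
      using tendsto_add[of "\<lambda>n. X n - Y n" 0 sequentially "\<lambda>n. Y n - Z n" 0]
      by (auto simp: completion_rel_def)
  qed
qed

quotient_type (overloaded) 'a completion = "nat \<Rightarrow> 'a::complex_inner" / partial: completion_rel
  by (rule part_equivp_completion_rel)

lemma cinner_lim_eq:
  fixes X Y X' Y' :: "nat \<Rightarrow> 'a::complex_inner"
  assumes "completion_rel X X'" "completion_rel Y Y'"
  shows "lim (\<lambda>n. cinner (X n) (Y n)) = lim (\<lambda>n. cinner (X' n) (Y' n))"
proof -
  have C: "Cauchy X" "Cauchy X'" "Cauchy Y" "Cauchy Y'"
    and d: "(\<lambda>n. X n - X' n) \<longlonglongrightarrow> 0" "(\<lambda>n. Y n - Y' n) \<longlonglongrightarrow> 0"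
    using assms by (auto simp: completion_rel_def)
  obtain A where A: "\<And>n. norm (X' n) \<le> A" using Cauchy_Bseq[OF C(2)] BseqE by blast
  obtain B where B: "\<And>n. norm (Y n) \<le> B" using Cauchy_Bseq[OF C(3)] BseqE by blast
  have "(\<lambda>n. cinner (X n) (Y n) - cinner (X' n) (Y' n)) \<longlonglongrightarrow> 0"
  proof (rule Lim_null_comparison)
    show "\<forall>\<^sub>F n in sequentially. cmod (cinner (X n) (Y n) - cinner (X' n) (Y' n))
            \<le> norm (X n - X' n) * B + A * norm (Y n - Y' n)"
    proof (rule always_eventually, rule allI)
      fix n
      have "cinner (X n) (Y n) - cinner (X' n) (Y' n)
            = cinner (X n - X' n) (Y n) + cinner (X' n) (Y n - Y' n)"
        by (simp add: cinner_diff_left cinner_diff_right)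
      also have "cmod \<dots> \<le> norm (X n - X' n) * norm (Y n) + norm (X' n) * norm (Y n - Y' n)"
        by (rule order.trans[OF norm_triangle_ineq add_mono]) (rule cinner_Cauchy_Schwarz)+
      also have "\<dots> \<le> norm (X n - X' n) * B + A * norm (Y n - Y' n)"
        using A B by (intro add_mono mult_mono) (auto intro: order.trans[OF norm_ge_zero])
      finally show "cmod (cinner (X n) (Y n) - cinner (X' n) (Y' n))
            \<le> norm (X n - X' n) * B + A * norm (Y n - Y' n)" .
    qed
    have "(\<lambda>n. norm (X n - X' n) * B + A * norm (Y n - Y' n)) \<longlonglongrightarrow> 0 * B + A * 0"
      by (intro tendsto_intros tendsto_norm_zero d)
    thus "(\<lambda>n. norm (X n - X' n) * B + A * norm (Y n - Y' n)) \<longlonglongrightarrow> 0" by simp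
  qed
  moreover have "(\<lambda>n. cinner (X' n) (Y' n)) \<longlonglongrightarrow> lim (\<lambda>n. cinner (X' n) (Y' n))"
    using Cauchy_cinner[OF C(2,4)] by (simp add: Cauchy_convergent_iff convergent_LIMSEQ_iff)
  ultimately have "(\<lambda>n. cinner (X n) (Y n)) \<longlonglongrightarrow> lim (\<lambda>n. cinner (X' n) (Y' n))"
    by (blast intro: Lim_transform)
  thus ?thesis by (rule limI)
qed

lemma cinner_LIMSEQ:
  fixes X Y :: "nat \<Rightarrow> 'a::complex_inner"
  assumes "completion_rel X X" "completion_rel Y Y"
  shows "(\<lambda>n. cinner (X n) (Y n)) \<longlonglongrightarrow> lim (\<lambda>n. cinner (X n) (Y n))"
  using Cauchy_cinner[of X Y] assms
  by (simp add: completion_rel_def Cauchy_convergent_iff convergent_LIMSEQ_iff)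

lemma completion_rel_refl: "completion_rel X X \<longleftrightarrow> Cauchy X"
  by (simp add: completion_rel_def)

lemma completion_relI:
  assumes "Cauchy X" "\<And>n. X n = Y n" shows "completion_rel X Y"
proof -
  have "X = Y" using assms(2) by (rule ext)
  with assms(1) show ?thesis by (simp add: completion_rel_def)
qed

instantiation completion :: (complex_inner) complex_inner
begin

lift_definition zero_completion :: "'a completion" is "\<lambda>_. 0"
  by (simp add: completion_rel_def Cauchy_def)

lift_definition plus_completion :: "'a completion \<Rightarrow> 'a completion \<Rightarrow> 'a completion"
  is "\<lambda>X Y n. X n + Y n"
proof -
  fix X X' Y Y' :: "nat \<Rightarrow> 'a"
  assume "completion_rel X X'" "completion_rel Y Y'"
  thus "completion_rel (\<lambda>n. X n + Y n) (\<lambda>n. X' n + Y' n)"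
    using tendsto_add[of "\<lambda>n. X n - X' n" 0 sequentially "\<lambda>n. Y n - Y' n" 0]
    by (auto simp: completion_rel_def Cauchy_add' add_diff_add)
qed

lift_definition scaleC_completion :: "complex \<Rightarrow> 'a completion \<Rightarrow> 'a completion"
  is "\<lambda>c X n. c *\<^sub>C X n"
proof -
  fix c and X X' :: "nat \<Rightarrow> 'a"
  assume *: "completion_rel X X'"
  hence "(\<lambda>n. cmod c * norm (X n - X' n)) \<longlonglongrightarrow> cmod c * 0"
    by (intro tendsto_intros tendsto_norm_zero) (auto simp: completion_rel_def)
  hence "(\<lambda>n. norm (c *\<^sub>C X n - c *\<^sub>C X' n)) \<longlonglongrightarrow> 0"
    by (simp flip: norm_scaleC complex_vector.scale_right_diff_distrib)
  hence "(\<lambda>n. c *\<^sub>C X n - c *\<^sub>C X' n) \<longlonglongrightarrow> 0"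
    by (rule tendsto_norm_zero_cancel)
  with * show "completion_rel (\<lambda>n. c *\<^sub>C X n) (\<lambda>n. c *\<^sub>C X' n)"
    unfolding completion_rel_def by (blast intro: Cauchy_scaleC)
qed

lift_definition cinner_completion :: "'a completion \<Rightarrow> 'a completion \<Rightarrow> complex"
  is "\<lambda>X Y. lim (\<lambda>n. cinner (X n) (Y n))"
  by (rule cinner_lim_eq)

definition uminus_completion :: "'a completion \<Rightarrow> 'a completion" where
  "uminus_completion x = (- 1) *\<^sub>C x"
definition minus_completion :: "'a completion \<Rightarrow> 'a completion \<Rightarrow> 'a completion" where
  "minus_completion x y = x + (- 1) *\<^sub>C y"
definition scaleR_completion :: "real \<Rightarrow> 'a completion \<Rightarrow> 'a completion" where
  "scaleR_completion r x = complex_of_real r *\<^sub>C x"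
definition inner_completion :: "'a completion \<Rightarrow> 'a completion \<Rightarrow> real" where
  "inner_completion x y = Re (cinner x y)"
definition norm_completion :: "'a completion \<Rightarrow> real" where
  "norm_completion x = sqrt (inner x x)"
definition dist_completion :: "'a completion \<Rightarrow> 'a completion \<Rightarrow> real" where
  "dist_completion x y = norm (x - y)"
definition sgn_completion :: "'a completion \<Rightarrow> 'a completion" where
  "sgn_completion x = inverse (norm x) *\<^sub>R x"
definition [code del]: "(uniformity :: ('a completion \<times> 'a completion) filter)
   = (INF e\<in>{0 <..}. principal {(x, y). dist x y < e})"
definition [code del]: "open (U :: 'a completion set)
   \<longleftrightarrow> (\<forall>x\<in>U. eventually (\<lambda>(x', y). x' = x \<longrightarrow> y \<in> U) uniformity)"

instance
proof
  fix x y z :: "'a completion" and a b :: complex and r s :: real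
  show assoc: "x + y + z = x + (y + z)"
    by (transfer, rule completion_relI)
      (auto simp: completion_rel_refl add.assoc intro: Cauchy_add' Cauchy_scaleC convergent_Cauchy convergent_const)
  show comm: "x + y = y + x"
    by (transfer, rule completion_relI)
      (auto simp: completion_rel_refl add.commute intro: Cauchy_add' Cauchy_scaleC convergent_Cauchy convergent_const)
  show zero: "0 + x = x"
    by (transfer, rule completion_relI)
      (auto simp: completion_rel_refl intro: Cauchy_add' Cauchy_scaleC convergent_Cauchy convergent_const)
  have one: "1 *\<^sub>C x = x" for x :: "'a completion"
    by (transfer, rule completion_relI)
      (auto simp: completion_rel_refl scaleC_one intro: Cauchy_add' Cauchy_scaleC convergent_Cauchy convergent_const)
  show cadd: "(a + b) *\<^sub>C x = a *\<^sub>C x + b *\<^sub>C x" for a b and x :: "'a completion"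
    by (transfer, rule completion_relI)
      (auto simp: completion_rel_refl scaleC_add_left intro: Cauchy_add' Cauchy_scaleC convergent_Cauchy convergent_const)
  have c0: "0 *\<^sub>C x = 0" for x :: "'a completion"
    by (transfer, rule completion_relI)
      (auto simp: completion_rel_refl intro: Cauchy_add' Cauchy_scaleC convergent_Cauchy convergent_const)
  show "- x + x = 0"
    using cadd[of "- 1" 1 x] by (simp add: one c0 uminus_completion_def)
  show "x - y = x + - y"
    by (simp add: minus_completion_def uminus_completion_def)
  show caddr: "a *\<^sub>C (x + y) = a *\<^sub>C x + a *\<^sub>C y" for a and x y :: "'a completion"
    by (transfer, rule completion_relI)
      (auto simp: completion_rel_refl scaleC_add_right intro: Cauchy_add' Cauchy_scaleC convergent_Cauchy convergent_const)
  show cc: "a *\<^sub>C b *\<^sub>C x = (a * b) *\<^sub>C x" for a b and x :: "'a completion"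
    by (transfer, rule completion_relI)
      (auto simp: completion_rel_refl scaleC_scaleC intro: Cauchy_add' Cauchy_scaleC convergent_Cauchy convergent_const)
  show "r *\<^sub>R x = complex_of_real r *\<^sub>C x" by (simp add: scaleR_completion_def)
  show "r *\<^sub>R (x + y) = r *\<^sub>R x + r *\<^sub>R y" by (simp add: scaleR_completion_def caddr)
  show "(r + s) *\<^sub>R x = r *\<^sub>R x + s *\<^sub>R x" by (simp add: scaleR_completion_def cadd)
  show "r *\<^sub>R s *\<^sub>R x = (r * s) *\<^sub>R x" by (simp add: scaleR_completion_def cc)
  show "1 *\<^sub>R x = x" by (simp add: scaleR_completion_def one)
  show icomm: "cinner x y = cnj (cinner y x)" for x y :: "'a completion"
  proof transfer
    fix X Y :: "nat \<Rightarrow> 'a" assume *: "completion_rel X X" "completion_rel Y Y"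
    have "(\<lambda>n. cnj (cinner (Y n) (X n))) \<longlonglongrightarrow> cnj (lim (\<lambda>n. cinner (Y n) (X n)))"
      by (intro tendsto_cnj cinner_LIMSEQ *)
    moreover have "(\<lambda>n. cnj (cinner (Y n) (X n))) = (\<lambda>n. cinner (X n) (Y n))"
      by (rule ext, rule cinner_commute[symmetric])
    ultimately have "(\<lambda>n. cinner (X n) (Y n)) \<longlonglongrightarrow> cnj (lim (\<lambda>n. cinner (Y n) (X n)))"
      by simp
    thus "lim (\<lambda>n. cinner (X n) (Y n)) = cnj (lim (\<lambda>n. cinner (Y n) (X n)))" by (rule limI)
  qed
  show iadd: "cinner x (y + z) = cinner x y + cinner x z" for x y z :: "'a completion"
  proof transfer
    fix X Y Z :: "nat \<Rightarrow> 'a"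
    assume *: "completion_rel X X" "completion_rel Y Y" "completion_rel Z Z"
    have "(\<lambda>n. cinner (X n) (Y n) + cinner (X n) (Z n))
            \<longlonglongrightarrow> lim (\<lambda>n. cinner (X n) (Y n)) + lim (\<lambda>n. cinner (X n) (Z n))"
      by (intro tendsto_add cinner_LIMSEQ *)
    thus "lim (\<lambda>n. cinner (X n) (Y n + Z n))
            = lim (\<lambda>n. cinner (X n) (Y n)) + lim (\<lambda>n. cinner (X n) (Z n))"
      unfolding cinner_add_right by (rule limI)
  qed
  show iscale: "cinner x (a *\<^sub>C y) = a * cinner x y" for a and x y :: "'a completion"
  proof transfer
    fix a and X Y :: "nat \<Rightarrow> 'a"
    assume *: "completion_rel X X" "completion_rel Y Y"
    have "(\<lambda>n. a * cinner (X n) (Y n)) \<longlonglongrightarrow> a * lim (\<lambda>n. cinner (X n) (Y n))"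
      by (intro tendsto_intros cinner_LIMSEQ *)
    thus "lim (\<lambda>n. cinner (X n) (a *\<^sub>C Y n)) = a * lim (\<lambda>n. cinner (X n) (Y n))"
      unfolding cinner_scaleC_right by (rule limI)
  qed
  show "inner x y = Re (cinner x y)" by (simp add: inner_completion_def)
  show "inner x y = inner y x"
    unfolding inner_completion_def by (subst icomm) simp
  show "inner (x + y) z = inner x z + inner y z"
    unfolding inner_completion_def by (subst (1 2 3) icomm) (simp add: iadd)
  show "inner (r *\<^sub>R x) y = r * inner x y"
    unfolding inner_completion_def scaleR_completion_def
    by (subst (1 2) icomm) (simp add: iscale)
  show "0 \<le> inner x x"
    unfolding inner_completion_def
  proof transfer
    fix X :: "nat \<Rightarrow> 'a" assume *: "completion_rel X X"
    have "(\<lambda>n. Re (cinner (X n) (X n))) \<longlonglongrightarrow> Re (lim (\<lambda>n. cinner (X n) (X n)))"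
      by (intro tendsto_Re cinner_LIMSEQ *)
    thus "0 \<le> Re (lim (\<lambda>n. cinner (X n) (X n)))"
      by (rule LIMSEQ_le_const) (simp add: inner_cinner[symmetric])
  qed
  show "inner x x = 0 \<longleftrightarrow> x = 0"
    unfolding inner_completion_def
  proof transfer
    fix X :: "nat \<Rightarrow> 'a" assume *: "completion_rel X X"
    have lim: "(\<lambda>n. (norm (X n))\<^sup>2) \<longlonglongrightarrow> Re (lim (\<lambda>n. cinner (X n) (X n)))"
      using tendsto_Re[OF cinner_LIMSEQ[OF * *]] unfolding power2_norm_eq_inner inner_cinner .
    show "Re (lim (\<lambda>n. cinner (X n) (X n))) = 0 \<longleftrightarrow> completion_rel X (\<lambda>_. 0)"
    proof
      assume "Re (lim (\<lambda>n. cinner (X n) (X n))) = 0"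
      with lim have "(\<lambda>n. (norm (X n))\<^sup>2) \<longlonglongrightarrow> 0" by metis
      from tendsto_real_sqrt[OF this] have "(\<lambda>n. norm (X n)) \<longlonglongrightarrow> 0" by simp
      hence "X \<longlonglongrightarrow> 0" by (rule tendsto_norm_zero_cancel)
      thus "completion_rel X (\<lambda>_. 0)" 
        using * by (simp add: completion_rel_def convergent_Cauchy convergent_const)
    next
      assume "completion_rel X (\<lambda>_. 0)"
      hence "(\<lambda>n. (norm (X n))\<^sup>2) \<longlonglongrightarrow> 0\<^sup>2"
        by (intro tendsto_power tendsto_norm_zero) (simp add: completion_rel_def)
      from LIMSEQ_unique[OF lim this] show "Re (lim (\<lambda>n. cinner (X n) (X n))) = 0" by simp
    qed
  qed
qed (rule norm_completion_def dist_completion_def sgn_completion_def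
    uniformity_completion_def open_completion_def)+

end

lift_definition to_completion :: "'a::complex_inner \<Rightarrow> 'a completion" is "\<lambda>x n. x"
  by (simp add: completion_rel_def Cauchy_def)

lemma to_completion_add: "to_completion (x + y) = to_completion x + to_completion y"
  by (transfer, rule completion_relI) (auto intro: convergent_Cauchy convergent_const)

lemma to_completion_scaleC: "to_completion (c *\<^sub>C x) = c *\<^sub>C to_completion x"
  by (transfer, rule completion_relI) (auto intro: convergent_Cauchy convergent_const)

lemma cinner_to_completion: "cinner (to_completion x) (to_completion y) = cinner x y"
  by transfer simp

lemma to_completion_diff: "to_completion (x - y) = to_completion x - to_completion y"
  using to_completion_add[of "x - y" y] by (simp add: algebra_simps)

lemma norm_to_completion: "norm (to_completion x) = norm x"
  by (simp add: norm_eq_sqrt_inner inner_cinner cinner_to_completion)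

lemma dist_to_completion: "dist (to_completion x) (to_completion y) = dist x y"
  by (simp add: dist_norm norm_to_completion flip: to_completion_diff)

lemma to_completion_LIMSEQ:
  fixes X :: "nat \<Rightarrow> 'a::complex_inner"
  assumes "Cauchy X"
  shows "(\<lambda>n. to_completion (X n)) \<longlonglongrightarrow> abs_completion X"
proof (rule LIMSEQ_I)
  fix e :: real assume e: "e > 0"
  obtain M where M: "\<And>m n. m \<ge> M \<Longrightarrow> n \<ge> M \<Longrightarrow> norm (X m - X n) < e / 2"
    using CauchyD[OF assms, of "e / 2"] e by auto
  have "norm (to_completion (X m) - abs_completion X) < e" if "m \<ge> M" for m
  proof -
    have C: "Cauchy (\<lambda>n. X m + (- 1) *\<^sub>C X n)"
      by (intro Cauchy_add' Cauchy_scaleC assms convergent_Cauchy convergent_const)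
    have rel: "completion_rel X X" "completion_rel (\<lambda>_. X m) (\<lambda>_. X m)"
      using assms by (auto simp: completion_rel_refl intro: convergent_Cauchy convergent_const)
    have eq: "to_completion (X m) - abs_completion X = abs_completion (\<lambda>n. X m + (- 1) *\<^sub>C X n)"
    proof -
      have relS: "completion_rel (\<lambda>n. (- 1) *\<^sub>C X n) (\<lambda>n. (- 1) *\<^sub>C X n)"
        unfolding completion_rel_refl by (intro Cauchy_scaleC assms)
      show ?thesis
        unfolding minus_completion_def to_completion.abs_eq scaleC_completion.abs_eq[OF rel(1)]
        by (rule plus_completion.abs_eq[OF rel(2) relS])
    qed
    have relD: "completion_rel (\<lambda>n. X m + (- 1) *\<^sub>C X n) (\<lambda>n. X m + (- 1) *\<^sub>C X n)"
      using C by (simp only: completion_rel_refl)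
    have D: "X m + (- 1) *\<^sub>C X n = X m - X n" for n
      by (simp add: scaleC_one)
    have "(\<lambda>n. (norm (X m + (- 1) *\<^sub>C X n))\<^sup>2) \<longlonglongrightarrow>
        (norm (abs_completion (\<lambda>n. X m + (- 1) *\<^sub>C X n)))\<^sup>2"
      unfolding power2_norm_eq_inner inner_cinner cinner_completion.abs_eq[OF relD relD]
      by (intro tendsto_Re cinner_LIMSEQ relD)
    hence "(\<lambda>n. (norm (X m - X n))\<^sup>2) \<longlonglongrightarrow>
        (norm (abs_completion (\<lambda>n. X m + (- 1) *\<^sub>C X n)))\<^sup>2"
      by (simp only: D)
    moreover have "\<exists>N. \<forall>n\<ge>N. (norm (X m - X n))\<^sup>2 \<le> (e / 2)\<^sup>2"
      by (intro exI[of _ M] allI impI power_mono less_imp_le[OF M] that norm_ge_zero)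
    ultimately have "(norm (abs_completion (\<lambda>n. X m + (- 1) *\<^sub>C X n)))\<^sup>2 \<le> (e / 2)\<^sup>2"
      by (rule LIMSEQ_le_const2)
    hence "norm (abs_completion (\<lambda>n. X m + (- 1) *\<^sub>C X n)) \<le> e / 2"
      using e by (simp add: power2_le_iff_abs_le)
    thus ?thesis using e by (simp add: eq)
  qed
  thus "\<exists>M. \<forall>m\<ge>M. norm (to_completion (X m) - abs_completion X) < e" by blast
qed

lemma closure_range_to_completion:
  "closure (range to_completion) = (UNIV :: 'a::complex_inner completion set)"
proof -
  have "y \<in> closure (range (to_completion :: 'a \<Rightarrow> _))" for y
  proof (induct y rule: completion.abs_induct)
    case (1 X)
    hence "Cauchy X" by (simp add: completion_rel_def)
    hence lim: "(\<lambda>n. to_completion (X n)) \<longlonglongrightarrow> abs_completion X"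
      by (rule to_completion_LIMSEQ)
    show ?case
      unfolding closure_sequential
      by (rule exI[of _ "\<lambda>n. to_completion (X n)"]) (simp add: lim)
  qed
  thus ?thesis by blast
qed

instance completion :: (complex_inner) complete_space
proof
  fix Y :: "nat \<Rightarrow> 'a completion" assume Y: "Cauchy Y"
  have "\<exists>x. dist (to_completion x) (Y n) < 1 / Suc n" for n
    using closure_approachable[of "Y n" "range to_completion"] closure_range_to_completion
    by (metis UNIV_I divide_pos_pos of_nat_0_less_iff rangeE zero_less_Suc zero_less_one)
  then obtain X where X: "\<And>n. dist (to_completion (X n)) (Y n) < 1 / Suc n" by metis
  have lim: "(\<lambda>n. to_completion (X n) - Y n) \<longlonglongrightarrow> 0"
  proof (rule Lim_null_comparison)
    show "\<forall>\<^sub>F n in sequentially. norm (to_completion (X n) - Y n) \<le> 1 / Suc n"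
      using X by (intro always_eventually allI less_imp_le) (simp add: dist_norm)
    show "(\<lambda>n. 1 / real (Suc n)) \<longlonglongrightarrow> 0" by (rule LIMSEQ_inverse_real_of_nat[unfolded inverse_eq_divide])
  qed
  have "Cauchy (\<lambda>n. (to_completion (X n) - Y n) + Y n)"
    by (intro Cauchy_add' Y LIMSEQ_imp_Cauchy[OF lim])
  hence "Cauchy X" by (simp add: Cauchy_def dist_to_completion)
  hence "(\<lambda>n. to_completion (X n)) \<longlonglongrightarrow> abs_completion X" by (rule to_completion_LIMSEQ)
  from tendsto_diff[OF this lim] have "Y \<longlonglongrightarrow> abs_completion X" by simp
  thus "convergent Y" by (auto simp: convergent_def)
qed


section \<open>The Hilbert space of square integrable functions on the half-line\<close>

abbreviation half_line :: "real measure" where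
  "half_line \<equiv> restrict_space lborel {0..}"

definition cdot :: "complex ^ 'n::finite \<Rightarrow> complex ^ 'n \<Rightarrow> complex" where
  "cdot u v = (\<Sum>j\<in>UNIV. cnj (u $ j) * v $ j)"

lemma Re_cdot_self: "Re (cdot u u) = (norm u)\<^sup>2"
  by (simp add: cdot_def norm_vec_def L2_set_def sum_nonneg)
     (simp add: cmod_def power2_eq_square[symmetric] sum.distrib)

lemma norm_cdot_le:
  fixes u v :: "complex ^ 'n::finite"
  shows "cmod (cdot u v) \<le> real CARD('n) * ((norm u)\<^sup>2 + (norm v)\<^sup>2)"
proof -
  have *: "cmod (cnj (u $ j) * v $ j) \<le> (norm u)\<^sup>2 + (norm v)\<^sup>2" for j
  proof -
    have "cmod (cnj (u $ j) * v $ j) \<le> norm u * norm v"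
      unfolding norm_mult complex_mod_cnj by (intro mult_mono Finite_Cartesian_Product.norm_nth_le) auto
    also have "norm u * norm v \<le> (norm u)\<^sup>2 + (norm v)\<^sup>2"
      using sum_squares_bound[of "norm u" "norm v"] mult_nonneg_nonneg[of "norm u" "norm v"]
      by (simp add: mult.assoc del: mult_nonneg_nonneg)
    finally show ?thesis .
  qed
  have "cmod (cdot u v) \<le> (\<Sum>j\<in>(UNIV::'n set). (norm u)\<^sup>2 + (norm v)\<^sup>2)"
    unfolding cdot_def by (rule sum_norm_le) (rule *)
  thus ?thesis by simp
qed

lemma norm_vector_scalar_mult: "norm (c *s u :: complex ^ 'n::finite) = cmod c * norm u"
  by (simp add: norm_vec_def L2_set_right_distrib norm_mult)

lemma norm_axis': "norm (axis j z :: complex ^ 'n::finite) = cmod z"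
proof -
  have "axis j z = z *s (axis j 1 :: complex ^ 'n)" by (simp add: vec_eq_iff axis_def)
  thus ?thesis by (simp add: norm_vector_scalar_mult)
qed

definition square_integrable :: "(real \<Rightarrow> complex ^ 'n::finite) \<Rightarrow> bool" where
  "square_integrable f \<longleftrightarrow>
     f \<in> borel_measurable half_line \<and> integrable half_line (\<lambda>x. (norm (f x))\<^sup>2)"

definition L2_rel :: "(real \<Rightarrow> complex ^ 'n::finite) \<Rightarrow> (real \<Rightarrow> complex ^ 'n) \<Rightarrow> bool" where
  "L2_rel f g \<longleftrightarrow> square_integrable f \<and> square_integrable g \<and> (AE x in half_line. f x = g x)"

lemma square_integrable_zero: "square_integrable (\<lambda>_. 0)"
  by (simp add: square_integrable_def)

lemma square_integrable_bound:
  assumes "square_integrable g" "f \<in> borel_measurable half_line"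
    and "\<And>x. norm (f x) \<le> C * norm (g x)"
  shows "square_integrable f"
  unfolding square_integrable_def
proof
  show "integrable half_line (\<lambda>x. (norm (f x))\<^sup>2)"
  proof (rule Bochner_Integration.integrable_bound)
    show "integrable half_line (\<lambda>x. C\<^sup>2 * (norm (g x))\<^sup>2)"
      using assms(1) by (simp add: square_integrable_def)
    show "(\<lambda>x. (norm (f x))\<^sup>2) \<in> borel_measurable half_line" using assms(2) by measurable
    have "(norm (f x))\<^sup>2 \<le> C\<^sup>2 * (norm (g x))\<^sup>2" for x
      using power_mono[OF assms(3), of x 2] by (simp add: power_mult_distrib)
    thus "AE x in half_line. norm ((norm (f x))\<^sup>2) \<le> norm (C\<^sup>2 * (norm (g x))\<^sup>2)"
      by (intro AE_I2) simp
  qed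
qed (rule assms(2))

lemma square_integrable_add:
  assumes "square_integrable f" "square_integrable g"
  shows "square_integrable (\<lambda>x. f x + g x)"
  unfolding square_integrable_def
proof
  have [measurable]: "f \<in> borel_measurable half_line" "g \<in> borel_measurable half_line"
    using assms by (auto simp: square_integrable_def)
  show "(\<lambda>x. f x + g x) \<in> borel_measurable half_line" by measurable
  show "integrable half_line (\<lambda>x. (norm (f x + g x))\<^sup>2)"
  proof (rule Bochner_Integration.integrable_bound)
    show "integrable half_line (\<lambda>x. 2 * (norm (f x))\<^sup>2 + 2 * (norm (g x))\<^sup>2)"
      using assms by (auto simp: square_integrable_def)
    show "(\<lambda>x. (norm (f x + g x))\<^sup>2) \<in> borel_measurable half_line" by measurable
    have "(norm (u + v))\<^sup>2 \<le> 2 * (norm u)\<^sup>2 + 2 * (norm v)\<^sup>2" for u v :: "complex ^ 'a"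
    proof -
      have "(norm (u + v))\<^sup>2 \<le> (norm u + norm v)\<^sup>2"
        by (rule power_mono[OF norm_triangle_ineq]) simp
      thus ?thesis using sum_squares_bound[of "norm u" "norm v"] by (simp add: power2_sum)
    qed
    thus "AE x in half_line. norm ((norm (f x + g x))\<^sup>2)
        \<le> norm (2 * (norm (f x))\<^sup>2 + 2 * (norm (g x))\<^sup>2)"
      by (intro AE_I2) simp
  qed
qed

lemma borel_measurable_vector_scalar_mult [measurable (raw)]:
  fixes f :: "'b \<Rightarrow> complex ^ 'n::finite"
  assumes "f \<in> borel_measurable M" shows "(\<lambda>x. c *s f x) \<in> borel_measurable M"
proof -
  have "continuous_on UNIV (\<lambda>u :: complex ^ 'n. c *s u)"
    unfolding vector_scalar_mult_def by (intro continuous_intros)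
  from borel_measurable_continuous_on[OF this assms] show ?thesis .
qed

lemma borel_measurable_vec_nth' [measurable (raw)]:
  fixes f :: "'b \<Rightarrow> complex ^ 'n::finite"
  assumes "f \<in> borel_measurable M" shows "(\<lambda>x. f x $ i) \<in> borel_measurable M"
proof -
  have "continuous_on UNIV (\<lambda>u :: complex ^ 'n. u $ i)" by (intro continuous_intros)
  from borel_measurable_continuous_on[OF this assms] show ?thesis .
qed

lemma borel_measurable_axis [measurable (raw)]:
  fixes f :: "'b \<Rightarrow> complex"
  assumes "f \<in> borel_measurable M"
  shows "(\<lambda>x. axis i (f x) :: complex ^ 'n::finite) \<in> borel_measurable M"
proof -
  have "continuous_on UNIV (\<lambda>z. axis i z :: complex ^ 'n)"
    unfolding axis_def
  proof (intro continuous_on_vec_lambda)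
    show "continuous_on UNIV (\<lambda>z::complex. if j = i then z else 0)" for j
      by (cases "j = i") (auto intro: continuous_intros)
  qed
  from borel_measurable_continuous_on[OF this assms] show ?thesis .
qed

lemma borel_measurable_cdot:
  assumes [measurable]: "f \<in> borel_measurable M" "g \<in> borel_measurable M"
  shows "(\<lambda>x. cdot (f x) (g x)) \<in> borel_measurable M"
  unfolding cdot_def
  by (intro borel_measurable_sum borel_measurable_times borel_measurable_vec_nth' assms
      borel_measurable_continuous_on[where f = cnj] continuous_intros)

lemma square_integrable_scaleC: "square_integrable f \<Longrightarrow> square_integrable (\<lambda>x. c *s f x)"
  by (rule square_integrable_bound[where C = "cmod c"])
     (auto simp: norm_vector_scalar_mult square_integrable_def)

lemma integrable_cdot:
  fixes f g :: "real \<Rightarrow> complex ^ 'n::finite"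
  assumes "square_integrable f" "square_integrable g"
  shows "integrable half_line (\<lambda>x. cdot (f x) (g x))"
proof (rule Bochner_Integration.integrable_bound)
  have [measurable]: "f \<in> borel_measurable half_line" "g \<in> borel_measurable half_line"
    using assms by (auto simp: square_integrable_def)
  show "integrable half_line (\<lambda>x. real CARD('n) * ((norm (f x))\<^sup>2 + (norm (g x))\<^sup>2))"
    using assms by (auto simp: square_integrable_def)
  show "(\<lambda>x. cdot (f x) (g x)) \<in> borel_measurable half_line"
    by (rule borel_measurable_cdot) fact+
  show "AE x in half_line. norm (cdot (f x) (g x))
          \<le> norm (real CARD('n) * ((norm (f x))\<^sup>2 + (norm (g x))\<^sup>2))"
    using norm_cdot_le by (intro AE_I2) (simp add: abs_of_nonneg)
qed

quotient_type (overloaded) 'n L2 = "real \<Rightarrow> complex ^ 'n::finite" / partial: L2_rel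
proof (rule part_equivpI)
  show "\<exists>f :: real \<Rightarrow> complex ^ 'n. L2_rel f f"
    using square_integrable_zero by (auto simp: L2_rel_def)
  show "symp (L2_rel :: (real \<Rightarrow> complex ^ 'n) \<Rightarrow> _)"
    by (rule sympI) (auto simp: L2_rel_def eq_commute)
  show "transp (L2_rel :: (real \<Rightarrow> complex ^ 'n) \<Rightarrow> _)"
    by (rule transpI) (auto simp: L2_rel_def elim: AE_mp)
qed

lemma L2_relI: "square_integrable f \<Longrightarrow> (\<And>x. f x = g x) \<Longrightarrow> L2_rel f g"
  by (subgoal_tac "f = g") (auto simp: L2_rel_def)

lemma L2_rel_refl: "L2_rel f f \<longleftrightarrow> square_integrable f"
  by (simp add: L2_rel_def)

instantiation L2 :: (finite) complex_inner
begin

lift_definition zero_L2 :: "'a L2" is "\<lambda>_. 0"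
  by (simp add: L2_rel_refl square_integrable_zero)

lift_definition plus_L2 :: "'a L2 \<Rightarrow> 'a L2 \<Rightarrow> 'a L2" is "\<lambda>f g x. f x + g x"
  by (auto simp: L2_rel_def square_integrable_add)

lift_definition scaleC_L2 :: "complex \<Rightarrow> 'a L2 \<Rightarrow> 'a L2" is "\<lambda>c f x. c *s f x"
  by (auto simp: L2_rel_def square_integrable_scaleC)

lift_definition cinner_L2 :: "'a L2 \<Rightarrow> 'a L2 \<Rightarrow> complex"
  is "\<lambda>f g. \<integral>x. cdot (f x) (g x) \<partial>half_line"
proof -
  fix f f' g g' :: "real \<Rightarrow> complex ^ 'a"
  assume *: "L2_rel f f'" "L2_rel g g'"
  show "(\<integral>x. cdot (f x) (g x) \<partial>half_line) = (\<integral>x. cdot (f' x) (g' x) \<partial>half_line)"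
  proof (rule integral_cong_AE)
    show "AE x in half_line. cdot (f x) (g x) = cdot (f' x) (g' x)"
      using * by (auto simp: L2_rel_def)
  qed (use * in \<open>auto simp: L2_rel_def intro!: borel_measurable_integrable integrable_cdot\<close>)
qed

definition uminus_L2 :: "'a L2 \<Rightarrow> 'a L2" where "uminus_L2 x = (- 1) *\<^sub>C x"
definition minus_L2 :: "'a L2 \<Rightarrow> 'a L2 \<Rightarrow> 'a L2" where "minus_L2 x y = x + (- 1) *\<^sub>C y"
definition scaleR_L2 :: "real \<Rightarrow> 'a L2 \<Rightarrow> 'a L2" where
  "scaleR_L2 r x = complex_of_real r *\<^sub>C x"
definition inner_L2 :: "'a L2 \<Rightarrow> 'a L2 \<Rightarrow> real" where "inner_L2 x y = Re (cinner x y)"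
definition norm_L2 :: "'a L2 \<Rightarrow> real" where "norm_L2 x = sqrt (inner x x)"
definition dist_L2 :: "'a L2 \<Rightarrow> 'a L2 \<Rightarrow> real" where "dist_L2 x y = norm (x - y)"
definition sgn_L2 :: "'a L2 \<Rightarrow> 'a L2" where "sgn_L2 x = inverse (norm x) *\<^sub>R x"
definition [code del]: "(uniformity :: ('a L2 \<times> 'a L2) filter)
   = (INF e\<in>{0 <..}. principal {(x, y). dist x y < e})"
definition [code del]: "open (U :: 'a L2 set)
   \<longleftrightarrow> (\<forall>x\<in>U. eventually (\<lambda>(x', y). x' = x \<longrightarrow> y \<in> U) uniformity)"

instance
proof
  fix x y z :: "'a L2" and a b :: complex and r s :: real
  show "x + y + z = x + (y + z)"
    by (transfer, rule L2_relI)
      (auto simp: L2_rel_refl add.assoc intro: square_integrable_add)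
  show "x + y = y + x"
    by (transfer, rule L2_relI)
      (auto simp: L2_rel_refl add.commute intro: square_integrable_add)
  show "0 + x = x"
    by (transfer, rule L2_relI) (auto simp: L2_rel_refl)
  have one: "1 *\<^sub>C x = x" for x :: "'a L2"
    by (transfer, rule L2_relI) (auto simp: L2_rel_refl)
  show cadd: "(a + b) *\<^sub>C x = a *\<^sub>C x + b *\<^sub>C x" for a b and x :: "'a L2"
    by (transfer, rule L2_relI)
      (auto simp: L2_rel_refl vec_eq_iff ring_distribs
        intro: square_integrable_scaleC square_integrable_add)
  have c0: "0 *\<^sub>C x = 0" for x :: "'a L2"
    by (transfer, rule L2_relI) (auto simp: L2_rel_refl square_integrable_zero)
  show "- x + x = 0"
    using cadd[of "- 1" 1 x] by (simp add: one c0 uminus_L2_def)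
  show "x - y = x + - y"
    by (simp add: minus_L2_def uminus_L2_def)
  show caddr: "a *\<^sub>C (x + y) = a *\<^sub>C x + a *\<^sub>C y" for a and x y :: "'a L2"
    by (transfer, rule L2_relI)
      (auto simp: L2_rel_refl vec_eq_iff ring_distribs
        intro: square_integrable_scaleC square_integrable_add)
  show cc: "a *\<^sub>C b *\<^sub>C x = (a * b) *\<^sub>C x" for a b and x :: "'a L2"
    by (transfer, rule L2_relI)
      (auto simp: L2_rel_refl vec_eq_iff intro: square_integrable_scaleC)
  show "r *\<^sub>R x = complex_of_real r *\<^sub>C x" by (simp add: scaleR_L2_def)
  show "r *\<^sub>R (x + y) = r *\<^sub>R x + r *\<^sub>R y" by (simp add: scaleR_L2_def caddr)
  show "(r + s) *\<^sub>R x = r *\<^sub>R x + s *\<^sub>R x" by (simp add: scaleR_L2_def cadd)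
  show "r *\<^sub>R s *\<^sub>R x = (r * s) *\<^sub>R x" by (simp add: scaleR_L2_def cc)
  show "1 *\<^sub>R x = x" by (simp add: scaleR_L2_def one)
  show icomm: "cinner x y = cnj (cinner y x)" for x y :: "'a L2"
  proof transfer
    fix f g :: "real \<Rightarrow> complex ^ 'a"
    have "cdot u v = cnj (cdot v u)" for u v :: "complex ^ 'a"
      by (simp add: cdot_def mult.commute)
    hence "(\<lambda>x. cdot (f x) (g x)) = (\<lambda>x. cnj (cdot (g x) (f x)))" by (rule ext)
    thus "(\<integral>x. cdot (f x) (g x) \<partial>half_line) = cnj (\<integral>x. cdot (g x) (f x) \<partial>half_line)"
      by simp
  qed
  show iadd: "cinner x (y + z) = cinner x y + cinner x z" for x y z :: "'a L2"
    by transfer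
      (simp add: cdot_def[of _ "_ + _"] ring_distribs sum.distrib L2_rel_refl integrable_cdot
        flip: cdot_def)
  show iscale: "cinner x (a *\<^sub>C y) = a * cinner x y" for a and x y :: "'a L2"
  proof transfer
    fix a and f g :: "real \<Rightarrow> complex ^ 'a"
    have "cdot u (a *s v) = a * cdot u v" for u v :: "complex ^ 'a"
      by (simp add: cdot_def sum_distrib_left mult_ac)
    thus "(\<integral>x. cdot (f x) (a *s g x) \<partial>half_line) = a * (\<integral>x. cdot (f x) (g x) \<partial>half_line)"
      by simp
  qed
  show "inner x y = Re (cinner x y)" by (simp add: inner_L2_def)
  show "inner x y = inner y x"
    unfolding inner_L2_def by (subst icomm) simp
  show "inner (x + y) z = inner x z + inner y z"
    unfolding inner_L2_def by (subst (1 2 3) icomm) (simp add: iadd)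
  show "inner (r *\<^sub>R x) y = r * inner x y"
    unfolding inner_L2_def scaleR_L2_def by (subst (1 2) icomm) (simp add: iscale)
  have self: "Re (\<integral>x. cdot (f x) (f x) \<partial>half_line) = (\<integral>x. (norm (f x))\<^sup>2 \<partial>half_line)"
    if "square_integrable f" for f :: "real \<Rightarrow> complex ^ 'a"
    using integral_Re[OF integrable_cdot[OF that that]] by (simp add: Re_cdot_self)
  show "0 \<le> inner x x"
    unfolding inner_L2_def by transfer (simp add: L2_rel_refl self)
  show "inner x x = 0 \<longleftrightarrow> x = 0"
    unfolding inner_L2_def
  proof transfer
    fix f :: "real \<Rightarrow> complex ^ 'a" assume "L2_rel f f"
    hence f: "square_integrable f" by (simp add: L2_rel_refl)
    have "(\<integral>x. (norm (f x))\<^sup>2 \<partial>half_line) = 0 \<longleftrightarrow> (AE x in half_line. (norm (f x))\<^sup>2 = 0)"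
      using f by (intro integral_nonneg_eq_0_iff_AE) (auto simp: square_integrable_def)
    thus "Re (\<integral>x. cdot (f x) (f x) \<partial>half_line) = 0 \<longleftrightarrow> L2_rel f (\<lambda>_. 0)"
      using f by (simp add: self L2_rel_def square_integrable_zero)
  qed
qed (rule norm_L2_def dist_L2_def sgn_L2_def uniformity_L2_def open_L2_def)+

end


section \<open>The full Fock space\<close>

text \<open>
  A word \<open>[e\<^sub>1, \<dots>, e\<^sub>n]\<close> stands for the elementary tensor
  \<open>e\<^sub>1 \<otimes> \<dots> \<otimes> e\<^sub>n\<close>, the empty word for the vacuum.  The following is the inner product of
  elementary tensors in the orthogonal sum of the tensor powers.
\<close>

fun word_inner :: "'a::complex_inner list \<Rightarrow> 'a list \<Rightarrow> complex" where
  "word_inner [] [] = 1"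
| "word_inner (x # u) (y # v) = cinner x y * word_inner u v"
| "word_inner [] (y # v) = 0"
| "word_inner (x # u) [] = 0"

text \<open>
  Formal linear combinations of words are lists of pairs (coefficient, word).  The algebraic direct
  sum of the algebraic tensor powers is their quotient by the combinations orthogonal to all
  words; these are also the combinations of norm zero.
\<close>

definition comb_eval :: "'a::complex_inner list \<Rightarrow> (complex \<times> 'a list) list \<Rightarrow> complex" where
  "comb_eval u \<psi> = (\<Sum>(d, v)\<leftarrow>\<psi>. d * word_inner u v)"

definition comb_inner ::
    "(complex \<times> 'a::complex_inner list) list \<Rightarrow> (complex \<times> 'a list) list \<Rightarrow> complex" where
  "comb_inner \<phi> \<psi> = (\<Sum>(c, u)\<leftarrow>\<phi>. cnj c * comb_eval u \<psi>)"

definition comb_scale ::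
    "complex \<Rightarrow> (complex \<times> 'a list) list \<Rightarrow> (complex \<times> 'a list) list" where
  "comb_scale a = map (\<lambda>(c, u). (a * c, u))"

lemma word_inner_commute: "word_inner u v = cnj (word_inner v u)"
  by (induction u v rule: word_inner.induct) (auto simp: cinner_commute[symmetric])

lemma comb_eval_simps [simp]:
  "comb_eval u [] = 0"
  "comb_eval u ((d, v) # \<psi>) = d * word_inner u v + comb_eval u \<psi>"
  by (simp_all add: comb_eval_def)

lemma comb_inner_simps [simp]:
  "comb_inner [] \<psi> = 0"
  "comb_inner ((c, u) # \<phi>) \<psi> = cnj c * comb_eval u \<psi> + comb_inner \<phi> \<psi>"
  by (simp_all add: comb_inner_def)

lemma comb_scale_simps [simp]:
  "comb_scale a [] = []"
  "comb_scale a ((c, u) # \<phi>) = (a * c, u) # comb_scale a \<phi>"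
  by (simp_all add: comb_scale_def)

lemma comb_eval_append: "comb_eval u (\<phi> @ \<psi>) = comb_eval u \<phi> + comb_eval u \<psi>"
  by (simp add: comb_eval_def)

lemma comb_eval_scale: "comb_eval u (comb_scale a \<phi>) = a * comb_eval u \<phi>"
  by (induction \<phi>) (auto simp: ring_distribs)

lemma comb_inner_append_right: "comb_inner \<phi> (\<psi> @ \<rho>) = comb_inner \<phi> \<psi> + comb_inner \<phi> \<rho>"
  by (induction \<phi>) (auto simp: comb_eval_append ring_distribs)

lemma comb_inner_scale_right: "comb_inner \<phi> (comb_scale a \<psi>) = a * comb_inner \<phi> \<psi>"
  by (induction \<phi>) (auto simp: comb_eval_scale ring_distribs)

lemma comb_inner_Nil_right: "comb_inner \<phi> [] = 0"
  by (induction \<phi>) auto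

lemma comb_inner_Cons_right:
  "comb_inner \<phi> ((d, v) # \<psi>) = d * cnj (comb_eval v \<phi>) + comb_inner \<phi> \<psi>"
proof (induction \<phi>)
  case (Cons p \<phi>)
  show ?case
    by (cases p) (simp add: Cons.IH ring_distribs, subst word_inner_commute, simp)
qed (simp add: comb_inner_Nil_right)

lemma comb_inner_commute: "comb_inner \<phi> \<psi> = cnj (comb_inner \<psi> \<phi>)"
  by (induction \<phi>) (auto simp: comb_inner_Cons_right comb_inner_Nil_right)

lemma ex_finite_orthonormal:
  fixes S :: "'a::complex_inner set"
  assumes "finite S"
  shows "\<exists>B. finite B \<and> (\<forall>b\<in>B. \<forall>b'\<in>B. cinner b b' = (if b = b' then 1 else 0)) \<and>
           (\<forall>x\<in>S. x = (\<Sum>b\<in>B. cinner b x *\<^sub>C b))"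
  using assms
proof (induction S)
  case (insert x S)
  then obtain B where B: "finite B" "\<And>b b'. b \<in> B \<Longrightarrow> b' \<in> B \<Longrightarrow> cinner b b' = (if b = b' then 1 else 0)"
    "\<And>y. y \<in> S \<Longrightarrow> y = (\<Sum>b\<in>B. cinner b y *\<^sub>C b)" by blast
  define r where "r = x - (\<Sum>b\<in>B. cinner b x *\<^sub>C b)"
  have br: "cinner b r = 0" if "b \<in> B" for b
  proof -
    have "cinner b (\<Sum>b'\<in>B. cinner b' x *\<^sub>C b') = (\<Sum>b'\<in>B. if b = b' then cinner b' x else 0)"
      unfolding cinner_sum_right by (rule sum.cong) (auto simp: cinner_scaleC_right B that)
    thus ?thesis using that B(1) by (simp add: r_def cinner_diff_right)
  qed
  hence rb: "cinner r b = 0" if "b \<in> B" for b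
    using that cinner_commute[of r b] by simp
  show ?case
  proof (cases "r = 0")
    case True
    thus ?thesis using B by (intro exI[of _ B]) (auto simp: r_def)
  next
    case False
    define e where "e = complex_of_real (inverse (norm r)) *\<^sub>C r"
    have rr: "cinner r r = complex_of_real (norm r) * complex_of_real (norm r)"
      by (simp add: cinner_self power2_norm_eq_inner[symmetric] power2_eq_square)
    have ee: "cinner e e = 1" using False
      by (simp add: e_def cinner_scaleC_left cinner_scaleC_right rr divide_simps)
    have eb: "cinner e b = 0" "cinner b e = 0" if "b \<in> B" for b
      using that by (auto simp: e_def cinner_scaleC_left cinner_scaleC_right br rb)
    hence "e \<notin> B" using ee by force
    have y: "cinner e y = 0" if "y \<in> S" for y
      by (subst B(3)[OF that]) (simp add: cinner_sum_right cinner_scaleC_right eb)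
    have "cinner r x = cinner r (r + (\<Sum>b\<in>B. cinner b x *\<^sub>C b))" by (simp add: r_def)
    also have "\<dots> = cinner r r"
      by (simp add: cinner_add_right cinner_sum_right cinner_scaleC_right rb)
    finally have "cinner e x *\<^sub>C e = r" using False
      by (simp add: e_def cinner_scaleC_left scaleC_scaleC rr scaleC_one divide_simps)
    hence "x = (\<Sum>b\<in>insert e B. cinner b x *\<^sub>C b)"
      using \<open>e \<notin> B\<close> B(1) by (simp add: r_def)
    moreover have "z = (\<Sum>b\<in>insert e B. cinner b z *\<^sub>C b)" if "z \<in> S" for z
      using \<open>e \<notin> B\<close> B(1) B(3)[OF that] y[OF that] by simp
    ultimately show ?thesis
      using B ee eb \<open>e \<notin> B\<close> by (intro exI[of _ "insert e B"]) auto
  qed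
qed auto

lemma ex_finite_Parseval:
  fixes S :: "'a::complex_inner set"
  assumes "finite S"
  shows "\<exists>B. finite B \<and> (\<forall>x\<in>S. \<forall>y\<in>S. cinner x y = (\<Sum>b\<in>B. cnj (cinner b x) * cinner b y))"
proof -
  obtain B where B: "finite B" "\<And>x. x \<in> S \<Longrightarrow> x = (\<Sum>b\<in>B. cinner b x *\<^sub>C b)"
    using ex_finite_orthonormal[OF assms] by blast
  have "cinner x y = (\<Sum>b\<in>B. cnj (cinner b x) * cinner b y)" if "x \<in> S" for x y
    by (subst B(2)[OF that]) (simp add: cinner_sum_left cinner_scaleC_left)
  thus ?thesis using B(1) by blast
qed

lemma word_inner_nonneg:
  fixes w :: "'i \<Rightarrow> 'a::complex_inner list"
  assumes "finite I" "\<And>i. i \<in> I \<Longrightarrow> length (w i) \<le> n"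
  shows "0 \<le> Re (\<Sum>i\<in>I. \<Sum>j\<in>I. cnj (c i) * c j * word_inner (w i) (w j))"
  using assms(2)
proof (induction n arbitrary: c w)
  case 0
  hence "(\<Sum>i\<in>I. \<Sum>j\<in>I. cnj (c i) * c j * word_inner (w i) (w j)) = cnj (sum c I) * sum c I"
    by (simp add: sum_product)
  also have "\<dots> = complex_of_real ((cmod (sum c I))\<^sup>2)"
    by (simp only: complex_norm_square mult.commute)
  finally show ?case by (simp only: Re_complex_of_real) simp
next
  case (Suc n)
  obtain B where B: "finite B"
    "\<And>i j. i \<in> I \<Longrightarrow> j \<in> I \<Longrightarrow> cinner (hd (w i)) (hd (w j))
      = (\<Sum>b\<in>B. cnj (cinner b (hd (w i))) * cinner b (hd (w j)))"
    using ex_finite_Parseval[of "(\<lambda>i. hd (w i)) ` I"] assms(1) by auto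
  define c0 where "c0 i = of_bool (w i = []) * c i" for i
  define d where "d b i = of_bool (w i \<noteq> []) * c i * cinner b (hd (w i))" for b i
  have "cnj (c i) * c j * word_inner (w i) (w j)
      = cnj (c0 i) * c0 j + (\<Sum>b\<in>B. cnj (d b i) * d b j * word_inner (tl (w i)) (tl (w j)))"
    if "i \<in> I" "j \<in> I" for i j
    using B(2)[OF that]
    by (cases "w i"; cases "w j")
       (simp_all add: c0_def d_def sum_distrib_left sum_distrib_right mult_ac)
  hence "(\<Sum>i\<in>I. \<Sum>j\<in>I. cnj (c i) * c j * word_inner (w i) (w j))
      = (\<Sum>i\<in>I. \<Sum>j\<in>I. cnj (c0 i) * c0 j)
        + (\<Sum>i\<in>I. \<Sum>j\<in>I. \<Sum>b\<in>B. cnj (d b i) * d b j * word_inner (tl (w i)) (tl (w j)))"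
    by (simp add: sum.distrib)
  also have "(\<Sum>i\<in>I. \<Sum>j\<in>I. cnj (c0 i) * c0 j) = cnj (sum c0 I) * sum c0 I"
    by (simp add: sum_product)
  also have "(\<Sum>i\<in>I. \<Sum>j\<in>I. \<Sum>b\<in>B. cnj (d b i) * d b j * word_inner (tl (w i)) (tl (w j)))
      = (\<Sum>b\<in>B. \<Sum>i\<in>I. \<Sum>j\<in>I. cnj (d b i) * d b j * word_inner (tl (w i)) (tl (w j)))"
  proof -
    have "(\<Sum>i\<in>I. \<Sum>j\<in>I. \<Sum>b\<in>B. g i j b) = (\<Sum>b\<in>B. \<Sum>i\<in>I. \<Sum>j\<in>I. g i j b)"
      for g :: "'i \<Rightarrow> 'i \<Rightarrow> 'a \<Rightarrow> complex"
      by (simp only: sum.swap[of _ B])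
    thus ?thesis .
  qed
  finally have "Re (\<Sum>i\<in>I. \<Sum>j\<in>I. cnj (c i) * c j * word_inner (w i) (w j))
      = Re (cnj (sum c0 I) * sum c0 I)
        + (\<Sum>b\<in>B. Re (\<Sum>i\<in>I. \<Sum>j\<in>I. cnj (d b i) * d b j * word_inner (tl (w i)) (tl (w j))))"
    by simp
  moreover have "0 \<le> Re (\<Sum>i\<in>I. \<Sum>j\<in>I. cnj (d b i) * d b j * word_inner (tl (w i)) (tl (w j)))" for b
    using Suc.prems by (intro Suc.IH) force
  moreover have "cnj (sum c0 I) * sum c0 I = complex_of_real ((cmod (sum c0 I))\<^sup>2)"
    by (simp only: complex_norm_square mult.commute)
  hence "0 \<le> Re (cnj (sum c0 I) * sum c0 I)" by (simp only: Re_complex_of_real) simp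
  ultimately show ?case by (simp only: sum_nonneg add_nonneg_nonneg)
qed

lemma comb_inner_nonneg: "0 \<le> Re (comb_inner \<phi> \<phi>)"
proof -
  define c where "c i = fst (\<phi> ! i)" for i
  define w where "w i = snd (\<phi> ! i)" for i
  have eval: "comb_eval u \<phi> = (\<Sum>j<length \<phi>. c j * word_inner u (w j))" for u
    by (simp add: comb_eval_def sum_list_sum_nth c_def w_def case_prod_beta atLeast0LessThan)
  have "comb_inner \<phi> \<phi> = (\<Sum>i<length \<phi>. \<Sum>j<length \<phi>. cnj (c i) * c j * word_inner (w i) (w j))"
    by (simp add: comb_inner_def eval sum_list_sum_nth case_prod_beta atLeast0LessThan
        sum_distrib_left mult.assoc c_def w_def)
  moreover have "\<exists>n. \<forall>i<length \<phi>. length (w i) \<le> n"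
    by (rule exI[of _ "\<Sum>i<length \<phi>. length (w i)"]) (auto intro: member_le_sum)
  ultimately show ?thesis using word_inner_nonneg[of "{..<length \<phi>}" w _ c] by auto
qed

lemma comb_inner_self_eq_0:
  assumes "Re (comb_inner \<phi> \<phi>) = 0" shows "comb_eval u \<phi> = 0"
proof (rule ccontr)
  define z where "z = comb_eval u \<phi>"
  define k where "k = Re (word_inner u u)"
  assume "comb_eval u \<phi> \<noteq> 0"
  hence z: "(cmod z)\<^sup>2 > 0" by (simp add: z_def)
  have k: "k \<ge> 0" using comb_inner_nonneg[of "[(1, u)]"] by (simp add: k_def)
  define s where "s = - complex_of_real (1 / (k + 1)) * z"
  have "comb_inner ((s, u) # \<phi>) ((s, u) # \<phi>)
      = s * cnj s * word_inner u u + (cnj s * z + cnj (cnj s * z)) + comb_inner \<phi> \<phi>"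
    using word_inner_commute[of u u]
    by (simp add: comb_inner_Cons_right z_def ring_distribs mult_ac)
  also have "\<dots> = complex_of_real ((cmod s)\<^sup>2) * word_inner u u
      + (cnj s * z + cnj (cnj s * z)) + comb_inner \<phi> \<phi>"
    by (simp only: complex_norm_square)
  finally have "Re (comb_inner ((s, u) # \<phi>) ((s, u) # \<phi>)) = (cmod s)\<^sup>2 * k + 2 * Re (cnj s * z)"
    using assms
    by (simp only: plus_complex.sel Re_complex_of_real Im_complex_of_real times_complex.sel
        complex_cnj k_def cnj.sel) simp
  also have "cnj s * z = - complex_of_real ((1 / (k + 1)) * (cmod z)\<^sup>2)"
    unfolding s_def of_real_mult complex_norm_square by (simp add: mult_ac)
  also have "(cmod s)\<^sup>2 = (1 / (k + 1))\<^sup>2 * (cmod z)\<^sup>2"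
    by (simp add: s_def norm_mult power_mult_distrib norm_divide power_divide k flip: of_real_add)
  also have "(1 / (k + 1))\<^sup>2 * (cmod z)\<^sup>2 * k + 2 * Re (- complex_of_real (1 / (k + 1) * (cmod z)\<^sup>2))
      = - (k + 2) / (k + 1)\<^sup>2 * (cmod z)\<^sup>2"
  proof -
    define h where "h = k + 1"
    have h: "k = h - 1" "h \<noteq> 0" using k by (auto simp: h_def)
    show ?thesis unfolding h(1) using h(2) by (simp add: field_simps power2_eq_square)
  qed
  also have "\<dots> < 0"
    using k z by (intro mult_neg_pos divide_neg_pos) auto
  finally show False using comb_inner_nonneg[of "(s, u) # \<phi>"] by linarith
qed

definition comb_rel ::
    "(complex \<times> 'a::complex_inner list) list \<Rightarrow> (complex \<times> 'a list) list \<Rightarrow> bool" where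
  "comb_rel \<phi> \<psi> \<longleftrightarrow> (\<forall>u. comb_eval u \<phi> = comb_eval u \<psi>)"

quotient_type (overloaded) 'a alg_fock = "(complex \<times> 'a::complex_inner list) list" / comb_rel
  by (rule equivpI) (auto simp: comb_rel_def reflp_def symp_def transp_def)

lemma comb_inner_cong:
  assumes "comb_rel \<phi> \<phi>'" "comb_rel \<psi> \<psi>'" shows "comb_inner \<phi> \<psi> = comb_inner \<phi>' \<psi>'"
proof -
  have *: "comb_inner \<rho> \<phi> = comb_inner \<rho> \<phi>'" if "comb_rel \<phi> \<phi>'" for \<rho> \<phi> \<phi>' :: "(complex \<times> 'a list) list"
    using that by (simp add: comb_inner_def comb_rel_def)
  have "comb_inner \<phi> \<psi> = comb_inner \<phi> \<psi>'" by (rule *[OF assms(2)])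
  also have "\<dots> = cnj (comb_inner \<psi>' \<phi>)" by (rule comb_inner_commute)
  also have "\<dots> = cnj (comb_inner \<psi>' \<phi>')" by (simp add: *[OF assms(1)])
  also have "\<dots> = comb_inner \<phi>' \<psi>'" by (rule comb_inner_commute[symmetric])
  finally show ?thesis .
qed

instantiation alg_fock :: (complex_inner) complex_inner
begin

lift_definition zero_alg_fock :: "'a alg_fock" is "[]" .

lift_definition plus_alg_fock :: "'a alg_fock \<Rightarrow> 'a alg_fock \<Rightarrow> 'a alg_fock" is "(@)"
  by (simp add: comb_rel_def comb_eval_append)

lift_definition scaleC_alg_fock :: "complex \<Rightarrow> 'a alg_fock \<Rightarrow> 'a alg_fock" is comb_scale
  by (simp add: comb_rel_def comb_eval_scale)

lift_definition cinner_alg_fock :: "'a alg_fock \<Rightarrow> 'a alg_fock \<Rightarrow> complex" is comb_inner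
  by (rule comb_inner_cong)

definition uminus_alg_fock :: "'a alg_fock \<Rightarrow> 'a alg_fock" where
  "uminus_alg_fock x = (- 1) *\<^sub>C x"
definition minus_alg_fock :: "'a alg_fock \<Rightarrow> 'a alg_fock \<Rightarrow> 'a alg_fock" where
  "minus_alg_fock x y = x + (- 1) *\<^sub>C y"
definition scaleR_alg_fock :: "real \<Rightarrow> 'a alg_fock \<Rightarrow> 'a alg_fock" where
  "scaleR_alg_fock r x = complex_of_real r *\<^sub>C x"
definition inner_alg_fock :: "'a alg_fock \<Rightarrow> 'a alg_fock \<Rightarrow> real" where
  "inner_alg_fock x y = Re (cinner x y)"
definition norm_alg_fock :: "'a alg_fock \<Rightarrow> real" where
  "norm_alg_fock x = sqrt (inner x x)"
definition dist_alg_fock :: "'a alg_fock \<Rightarrow> 'a alg_fock \<Rightarrow> real" where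
  "dist_alg_fock x y = norm (x - y)"
definition sgn_alg_fock :: "'a alg_fock \<Rightarrow> 'a alg_fock" where
  "sgn_alg_fock x = inverse (norm x) *\<^sub>R x"
definition [code del]: "(uniformity :: ('a alg_fock \<times> 'a alg_fock) filter)
   = (INF e\<in>{0 <..}. principal {(x, y). dist x y < e})"
definition [code del]: "open (U :: 'a alg_fock set)
   \<longleftrightarrow> (\<forall>x\<in>U. eventually (\<lambda>(x', y). x' = x \<longrightarrow> y \<in> U) uniformity)"

instance
proof
  fix x y z :: "'a alg_fock" and a b :: complex and r s :: real
  note simps = comb_rel_def comb_eval_append comb_eval_scale
  show "x + y + z = x + (y + z)" by transfer (simp add: simps)
  show "x + y = y + x" by transfer (simp add: simps)
  show "0 + x = x" by transfer (simp add: simps)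
  have one: "1 *\<^sub>C x = x" for x :: "'a alg_fock" by transfer (simp add: simps)
  show cadd: "(a + b) *\<^sub>C x = a *\<^sub>C x + b *\<^sub>C x" for a b and x :: "'a alg_fock"
    by transfer (simp add: simps ring_distribs)
  have c0: "0 *\<^sub>C x = 0" for x :: "'a alg_fock" by transfer (simp add: simps)
  show "- x + x = 0"
    using cadd[of "- 1" 1 x] by (simp add: one c0 uminus_alg_fock_def)
  show "x - y = x + - y"
    by (simp add: minus_alg_fock_def uminus_alg_fock_def)
  show caddr: "a *\<^sub>C (x + y) = a *\<^sub>C x + a *\<^sub>C y" for a and x y :: "'a alg_fock"
    by transfer (simp add: simps ring_distribs)
  show cc: "a *\<^sub>C b *\<^sub>C x = (a * b) *\<^sub>C x" for a b and x :: "'a alg_fock"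
    by transfer (simp add: simps)
  show "r *\<^sub>R x = complex_of_real r *\<^sub>C x" by (simp add: scaleR_alg_fock_def)
  show "r *\<^sub>R (x + y) = r *\<^sub>R x + r *\<^sub>R y" by (simp add: scaleR_alg_fock_def caddr)
  show "(r + s) *\<^sub>R x = r *\<^sub>R x + s *\<^sub>R x" by (simp add: scaleR_alg_fock_def cadd)
  show "r *\<^sub>R s *\<^sub>R x = (r * s) *\<^sub>R x" by (simp add: scaleR_alg_fock_def cc)
  show "1 *\<^sub>R x = x" by (simp add: scaleR_alg_fock_def one)
  show icomm: "cinner x y = cnj (cinner y x)" for x y :: "'a alg_fock"
    by transfer (rule comb_inner_commute)
  show iadd: "cinner x (y + z) = cinner x y + cinner x z" for x y z :: "'a alg_fock"
    by transfer (rule comb_inner_append_right)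
  show iscale: "cinner x (a *\<^sub>C y) = a * cinner x y" for a and x y :: "'a alg_fock"
    by transfer (rule comb_inner_scale_right)
  show "inner x y = Re (cinner x y)" by (simp add: inner_alg_fock_def)
  show "inner x y = inner y x"
    unfolding inner_alg_fock_def by (subst icomm) simp
  show "inner (x + y) z = inner x z + inner y z"
    unfolding inner_alg_fock_def by (subst (1 2 3) icomm) (simp add: iadd)
  show "inner (r *\<^sub>R x) y = r * inner x y"
    unfolding inner_alg_fock_def scaleR_alg_fock_def by (subst (1 2) icomm) (simp add: iscale)
  show "0 \<le> inner x x"
    unfolding inner_alg_fock_def by transfer (rule comb_inner_nonneg)
  show "inner x x = 0 \<longleftrightarrow> x = 0"
    unfolding inner_alg_fock_def
  proof transfer
    fix \<phi> :: "(complex \<times> 'a list) list"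
    show "Re (comb_inner \<phi> \<phi>) = 0 \<longleftrightarrow> comb_rel \<phi> []"
      using comb_inner_self_eq_0[of \<phi>] comb_inner_cong[of \<phi> "[]" \<phi> "[]"]
      by (auto simp: comb_rel_def)
  qed
qed (rule norm_alg_fock_def dist_alg_fock_def sgn_alg_fock_def
    uniformity_alg_fock_def open_alg_fock_def)+

end

lift_definition alg_tensor :: "'a::complex_inner list \<Rightarrow> 'a alg_fock" is "\<lambda>u. [(1, u)]" .

text \<open>
  Completing the algebraic sum of the algebraic tensor powers yields the orthogonal Hilbert sum of
  the Hilbert space tensor powers.
\<close>

type_synonym 'a fock = "'a alg_fock completion"

definition tensor :: "'a::complex_inner list \<Rightarrow> 'a fock" where
  "tensor u = to_completion (alg_tensor u)"

lemma cinner_tensor: "cinner (tensor u) (tensor v) = word_inner u v"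
proof -
  have "cinner (alg_tensor u) (alg_tensor v) = word_inner u v"
    by transfer simp
  thus ?thesis by (simp add: tensor_def cinner_to_completion)
qed

lemma closure_cspan_tensor: "closure (cspan (range tensor)) = (UNIV :: 'a::complex_inner fock set)"
proof -
  have step: "abs_alg_fock ((c, u) # \<phi>) = c *\<^sub>C alg_tensor u + abs_alg_fock \<phi>"
    for c u and \<phi> :: "(complex \<times> 'a list) list"
    by (simp add: alg_tensor.abs_eq scaleC_alg_fock.abs_eq plus_alg_fock.abs_eq)
  have zero: "to_completion 0 = (0 :: 'a fock)"
    using to_completion_scaleC[of 0 0] by simp
  have abs: "to_completion (abs_alg_fock \<phi>) \<in> cspan (range tensor)"
    for \<phi> :: "(complex \<times> 'a list) list"
  proof (induction \<phi>)
    case Nil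
    have "abs_alg_fock [] = (0 :: 'a alg_fock)" by (simp add: zero_alg_fock_def)
    thus ?case by (simp add: zero complex_vector.span_zero)
  next
    case (Cons p \<phi>)
    obtain c u where p: "p = (c, u)" by (cases p)
    show ?case
      unfolding p step to_completion_add to_completion_scaleC tensor_def[symmetric]
      by (intro complex_vector.span_add complex_vector.span_scale Cons.IH)
         (rule complex_vector.span_base, rule rangeI)
  qed
  have "to_completion x \<in> cspan (range tensor)" for x :: "'a alg_fock"
    by (induct x rule: alg_fock.abs_induct) (rule abs)
  hence "range to_completion \<subseteq> cspan (range (tensor :: 'a list \<Rightarrow> _))" by auto
  from closure_mono[OF this] show ?thesis by (auto simp: closure_range_to_completion)
qed

text \<open>
  The operators on the Fock space are given by their values on the elementary tensors, which
  determine a bounded complex-linear operator uniquely because they are total.  The second argument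
  of \<open>gauge\<close> is a vector of the Fock space, the first one is meant to be bounded and
  complex-linear.
\<close>

definition creation :: "'a::complex_inner \<Rightarrow> 'a fock \<Rightarrow> 'a fock" where
  "creation f = (THE A. bounded_clinear A \<and> (\<forall>w. A (tensor w) = tensor (f # w)))"

definition annihilation :: "'a::complex_inner \<Rightarrow> 'a fock \<Rightarrow> 'a fock" where
  "annihilation f = (THE A. bounded_clinear A \<and> A (tensor []) = 0 \<and>
     (\<forall>e w. A (tensor (e # w)) = cinner f e *\<^sub>C tensor w))"

definition gauge :: "('a::complex_inner \<Rightarrow> 'a) \<Rightarrow> 'a fock \<Rightarrow> 'a fock" where
  "gauge T = (THE A. bounded_clinear A \<and> A (tensor []) = 0 \<and>
     (\<forall>e w. A (tensor (e # w)) = tensor (T e # w)))"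


section \<open>The continuous-time operators\<close>

text \<open>
  \<open>step_vec j s t\<close> is the function equal to the \<open>j\<close>-th canonical basis vector on \<open>[s, t)\<close> and to zero
  elsewhere.
\<close>

lift_definition step_vec :: "'n::finite \<Rightarrow> real \<Rightarrow> real \<Rightarrow> 'n L2"
  is "\<lambda>j s t x. if s \<le> x \<and> x < t then axis j 1 else 0"
proof -
  fix j :: 'n and s t :: real
  let ?f = "\<lambda>x. if s \<le> x \<and> x < t then axis j 1 else 0 :: complex ^ 'n"
  have meas: "?f \<in> borel_measurable half_line"
    by (intro measurable_restrict_space1) measurable
  have "integrable lborel (\<lambda>x. indicator {0..} x *\<^sub>R (norm (?f x))\<^sup>2)"
  proof (rule Bochner_Integration.integrable_bound)
    show "integrable lborel (\<lambda>x. indicator {s..t} x :: real)"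
      by (rule integrable_real_indicator) (auto simp: emeasure_lborel_Icc_eq)
    show "(\<lambda>x. indicator {0..} x *\<^sub>R (norm (?f x))\<^sup>2) \<in> borel_measurable lborel" by measurable
    show "AE x in lborel. norm (indicator {0..} x *\<^sub>R (norm (?f x))\<^sup>2) \<le> norm (indicator {s..t} x :: real)"
      by (intro AE_I2) (auto simp: indicator_def)
  qed
  hence "integrable half_line (\<lambda>x. (norm (?f x))\<^sup>2)"
    by (subst integrable_restrict_space) simp_all
  with meas show "L2_rel ?f ?f" by (simp add: L2_rel_refl square_integrable_def)
qed

text \<open>
  \<open>comp_shift i j t\<close> maps \<open>g\<close> to the function whose \<open>j\<close>-th component is the \<open>i\<close>-th component of \<open>g\<close>
  multiplied with the indicator of \<open>[0, t)\<close>, the other components being zero.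
\<close>

lift_definition comp_shift :: "'n::finite \<Rightarrow> 'n \<Rightarrow> real \<Rightarrow> 'n L2 \<Rightarrow> 'n L2"
  is "\<lambda>i j t g x. if 0 \<le> x \<and> x < t then axis j (g x $ i) else 0"
proof -
  fix i j :: 'n and t :: real and g h :: "real \<Rightarrow> complex ^ 'n"
  let ?F = "\<lambda>g x. if 0 \<le> x \<and> x < t then axis j (g x $ i) else 0 :: complex ^ 'n"
  assume gh: "L2_rel g h"
  have "square_integrable (?F f)" if f: "square_integrable f" for f :: "real \<Rightarrow> complex ^ 'n"
  proof (rule square_integrable_bound[OF f, where C = 1])
    show "?F f \<in> borel_measurable half_line"
    proof (rule measurable_If)
      show "(\<lambda>x. axis j (f x $ i)) \<in> borel_measurable half_line"
        using f unfolding square_integrable_def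
        by (intro borel_measurable_axis borel_measurable_vec_nth') simp
      have "{x \<in> space half_line. 0 \<le> x \<and> x < t} = {0..<t}"
        by (auto simp: space_restrict_space)
      thus "{x \<in> space half_line. 0 \<le> x \<and> x < t} \<in> sets half_line"
        by (subst sets_restrict_space_iff) auto
    qed simp
    show "norm (?F f x) \<le> 1 * norm (f x)" for x
      by (auto simp: norm_axis' Finite_Cartesian_Product.norm_nth_le)
  qed
  with gh show "L2_rel (?F g) (?F h)" by (auto simp: L2_rel_def)
qed

text \<open>
  An index in \<open>{0, \<dots>, N}\<close> is an element of \<open>'n option\<close> with \<open>CARD('n) = N\<close>, the index \<open>0\<close> being
  \<open>None\<close>.  In \<open>cont_op i j\<close>, as in \<open>disc_op i j\<close> below, \<open>i\<close> is the upper and \<open>j\<close> the lower index of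
  the operator.
\<close>

fun cont_op :: "'n::finite option \<Rightarrow> 'n option \<Rightarrow> real \<Rightarrow> 'n L2 fock \<Rightarrow> 'n L2 fock" where
  "cont_op None (Some j) t = creation (step_vec j 0 t)"
| "cont_op (Some i) None t = annihilation (step_vec i 0 t)"
| "cont_op (Some i) (Some j) t = gauge (comp_shift i j t)"
| "cont_op None None t = (\<lambda>\<psi>. t *\<^sub>R \<psi>)"


section \<open>Partitions and toy Fock spaces\<close>

definition is_partition :: "(nat \<Rightarrow> real) \<Rightarrow> bool" where
  "is_partition p \<longleftrightarrow> p 0 = 0 \<and> strict_mono p \<and> (\<Union>k. {p k..<p (Suc k)}) = {0..}"

definition mesh :: "(nat \<Rightarrow> real) \<Rightarrow> ennreal" where
  "mesh p = (SUP k. ennreal \<bar>p (Suc k) - p k\<bar>)"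

definition partition_refines :: "(nat \<Rightarrow> real) \<Rightarrow> (nat \<Rightarrow> real) \<Rightarrow> bool" where
  "partition_refines q p \<longleftrightarrow> range p \<subseteq> range q"

definition toy_letter :: "(nat \<Rightarrow> real) \<Rightarrow> nat \<times> 'n::finite \<Rightarrow> 'n L2" where
  "toy_letter p = (\<lambda>(k, j). (1 / sqrt (p (Suc k) - p k)) *\<^sub>R step_vec j (p k) (p (Suc k)))"

definition adapted :: "(nat \<times> 'n) list \<Rightarrow> bool" where
  "adapted \<sigma> \<longleftrightarrow> (\<forall>m. Suc m < length \<sigma> \<longrightarrow> fst (\<sigma> ! m) \<noteq> fst (\<sigma> ! Suc m))"

definition toy_word :: "(nat \<Rightarrow> real) \<Rightarrow> (nat \<times> 'n::finite) list \<Rightarrow> 'n L2 fock" where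
  "toy_word p \<sigma> = tensor (map (toy_letter p) \<sigma>)"

definition toy_fock :: "(nat \<Rightarrow> real) \<Rightarrow> 'n::finite L2 fock set" where
  "toy_fock p = closure (cspan (toy_word p ` {\<sigma>. adapted \<sigma>}))"

definition not_start :: "nat \<Rightarrow> (nat \<times> 'n) list \<Rightarrow> bool" where
  "not_start k \<sigma> \<longleftrightarrow> \<sigma> = [] \<or> fst (hd \<sigma>) \<noteq> k"

text \<open>
  In the free product of copies of \<open>\<complex>\<^sup>N\<^sup>+\<^sup>1\<close>, an adapted word not starting at \<open>k\<close>
  has the vacuum as its component at the site \<open>k\<close>; \<open>put k l \<sigma>\<close> is the word with this
  component replaced by the \<open>l\<close>-th basis vector.
\<close>

fun put :: "nat \<Rightarrow> 'n option \<Rightarrow> (nat \<times> 'n) list \<Rightarrow> (nat \<times> 'n) list" where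
  "put k None \<sigma> = \<sigma>"
| "put k (Some j) \<sigma> = (k, j) # \<sigma>"

text \<open>
  The matrix unit \<open>X\<^sup>l \<mapsto> \<delta>\<^sub>i\<^sub>l X\<^sup>j\<close> on the \<open>k\<close>-th copy, extended by zero to the orthogonal
  complement of the toy Fock space.
\<close>

definition disc_op :: "(nat \<Rightarrow> real) \<Rightarrow> 'n::finite option \<Rightarrow> 'n option \<Rightarrow> nat \<Rightarrow>
    'n L2 fock \<Rightarrow> 'n L2 fock" where
  "disc_op p i j k = (THE A. bounded_clinear A \<and>
     (\<forall>\<sigma> l. adapted \<sigma> \<longrightarrow> not_start k \<sigma> \<longrightarrow>
        A (toy_word p (put k l \<sigma>)) = (if l = i then toy_word p (put k j \<sigma>) else 0)) \<and>
     (\<forall>\<psi>. (\<forall>\<phi>\<in>toy_fock p. cinner \<phi> \<psi> = 0) \<longrightarrow> A \<psi> = 0))"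

definition weight_exp :: "'n option \<Rightarrow> 'n option \<Rightarrow> real" where
  "weight_exp i j = (of_bool (i = None) + of_bool (j = None)) / 2"

end

theory Submission
  imports Defs
begin

text \<open>
  Writing \<open>l\<close> and \<open>l\<^sup>*\<close> for creation and annihilation, \<open>X = X\<^sup>j(k)\<close>, \<open>Y = X\<^sup>i(k)\<close> and \<open>P\<close> for the
  projection onto the toy Fock space, the discrete operators are \<open>P l(X) P\<close>, \<open>l\<^sup>*(Y) P\<close>,
  \<open>l(X) l\<^sup>*(Y) P\<close> and \<open>P - Q\<^sub>k P\<close>, where \<open>Q\<^sub>k\<close> is the sum of
  \<open>l(X\<^sup>m(k)) l\<^sup>*(X\<^sup>m(k))\<close> over \<open>m\<close>.  Hence, if
  \<open>t'\<close> is the first partition point after \<open>t\<close>, the weighted sums are \<open>P a(t') P\<close>, up to an error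
  of norm at most the mesh when \<open>i = j = 0\<close>, and the second claim follows from the first.

  For the first claim, the vectors \<open>\<psi>\<close> with \<open>P\<^sub>n \<psi> \<longlonglongrightarrow> \<psi>\<close> form a closed subspace containing the vacuum.
  It is stable under creation of a step function on \<open>[0, t)\<close>: on the toy Fock space, creation of
  the step function on \<open>[0, t')\<close> fails to preserve that space only through the part where the first
  two letters sit at the same site, and that part has norm at most the square root of the mesh.  As step
  functions are total in \<open>L\<^sup>2\<close>, the subspace contains all elementary tensors.
\<close>

section \<open>Bounded complex-linear maps and closed subspaces\<close>

lemma bounded_clinearI:
  assumes "\<And>x y. A (x + y) = A x + A y" "\<And>c x. A (c *\<^sub>C x) = c *\<^sub>C A x"
    and "\<And>x. norm (A x) \<le> C * norm x"
  shows "bounded_clinear A"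
  unfolding bounded_clinear_def
  by (intro conjI allI bounded_linear_intro[where K = C])
     (use assms in \<open>auto simp: scaleR_scaleC mult.commute\<close>)

lemma
  assumes "bounded_clinear A"
  shows bounded_clinear_add: "A (x + y) = A x + A y"
    and bounded_clinear_diff: "A (x - y) = A x - A y"
    and bounded_clinear_zero: "A 0 = 0"
    and bounded_clinear_scaleC: "A (c *\<^sub>C x) = c *\<^sub>C A x"
    and bounded_clinear_scaleR: "A (r *\<^sub>R x) = r *\<^sub>R A x"
    and bounded_clinear_sum: "A (\<Sum>i\<in>I. f i) = (\<Sum>i\<in>I. A (f i))"
proof -
  interpret bounded_linear A using assms by (simp add: bounded_clinear_def)
  show "A (x + y) = A x + A y" "A (x - y) = A x - A y" "A 0 = 0" "A (r *\<^sub>R x) = r *\<^sub>R A x"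
    "A (\<Sum>i\<in>I. f i) = (\<Sum>i\<in>I. A (f i))"
    by (rule add diff zero scaleR sum)+
  show "A (c *\<^sub>C x) = c *\<^sub>C A x" using assms by (simp add: bounded_clinear_def)
qed

lemma bounded_clinear_tendsto:
  "bounded_clinear A \<Longrightarrow> (f \<longlongrightarrow> l) F \<Longrightarrow> ((\<lambda>x. A (f x)) \<longlongrightarrow> A l) F"
  unfolding bounded_clinear_def by (blast intro: bounded_linear.tendsto)

lemma bounded_clinear_compose:
  "bounded_clinear A \<Longrightarrow> bounded_clinear B \<Longrightarrow> bounded_clinear (\<lambda>x. A (B x))"
  unfolding bounded_clinear_def by (auto intro: bounded_linear_compose)

lemma bounded_clinear_ident: "bounded_clinear (\<lambda>x. x)"
  unfolding bounded_clinear_def by auto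

lemma bounded_clinear_const_zero: "bounded_clinear (\<lambda>x. 0)"
  unfolding bounded_clinear_def by auto

lemma bounded_clinear_plus:
  "bounded_clinear A \<Longrightarrow> bounded_clinear B \<Longrightarrow> bounded_clinear (\<lambda>x. A x + B x)"
  unfolding bounded_clinear_def by (auto intro: bounded_linear_add simp: scaleC_add_right)

lemma bounded_clinear_scaleC_right:
  "bounded_clinear A \<Longrightarrow> bounded_clinear (\<lambda>x. c *\<^sub>C A x)"
proof -
  assume A: "bounded_clinear A"
  then obtain K where K: "\<And>x. norm (A x) \<le> norm x * K"
    unfolding bounded_clinear_def using bounded_linear.bounded by blast
  show ?thesis
  proof (rule bounded_clinearI[where C = "cmod c * K"])
    show "norm (c *\<^sub>C A x) \<le> cmod c * K * norm x" for x
      using mult_left_mono[OF K[of x] norm_ge_zero[of c]] by (simp add: norm_scaleC mult_ac)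
  qed (auto simp: bounded_clinear_add[OF A] bounded_clinear_scaleC[OF A] scaleC_add_right
      scaleC_scaleC mult.commute)
qed

lemma bounded_clinear_scaleR_right:
  "bounded_clinear A \<Longrightarrow> bounded_clinear (\<lambda>x. r *\<^sub>R A x)"
  unfolding scaleR_scaleC by (rule bounded_clinear_scaleC_right)

lemma bounded_clinear_minus:
  "bounded_clinear A \<Longrightarrow> bounded_clinear B \<Longrightarrow> bounded_clinear (\<lambda>x. A x - B x)"
  using bounded_clinear_plus[OF _ bounded_clinear_scaleC_right[of B "- 1"], of A]
  by (simp add: scaleC_one)

lemma bounded_clinear_sum_fun:
  "(\<And>i. i \<in> I \<Longrightarrow> bounded_clinear (A i)) \<Longrightarrow> bounded_clinear (\<lambda>x. \<Sum>i\<in>I. A i x)"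
  by (induction I rule: infinite_finite_induct)
     (auto intro: bounded_clinear_plus bounded_clinear_const_zero)

lemma tendsto_cinner:
  fixes f g :: "'b \<Rightarrow> 'a::complex_inner"
  assumes "(f \<longlongrightarrow> a) F" "(g \<longlongrightarrow> b) F"
  shows "((\<lambda>x. cinner (f x) (g x)) \<longlongrightarrow> cinner a b) F"
proof -
  have eq: "cinner x y = Complex (inner x y) (inner (\<i> *\<^sub>C x) y)" for x y :: 'a
    by (rule complex_eqI) (auto simp: inner_cinner cinner_scaleC_left)
  have "bounded_clinear (\<lambda>x. \<i> *\<^sub>C x :: 'a)"
    by (intro bounded_clinear_scaleC_right bounded_clinear_ident)
  from bounded_clinear_tendsto[OF this assms(1)] show ?thesis
    unfolding eq by (intro tendsto_Complex tendsto_inner assms)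
qed

lemma closed_orthogonal: "closed {y::'a::complex_inner. cinner x y = 0}"
  unfolding closed_sequential_limits
proof (intro allI impI, elim conjE)
  fix f and l :: 'a assume f: "\<forall>n. f n \<in> {y. cinner x y = 0}" "f \<longlonglongrightarrow> l"
  have "(\<lambda>n. cinner x (f n)) \<longlonglongrightarrow> cinner x l" by (intro tendsto_cinner tendsto_const f)
  with f(1) show "l \<in> {y. cinner x y = 0}" by (simp add: LIMSEQ_const_iff)
qed

lemma subspace_orthogonal: "complex_vector.subspace {y::'a::complex_inner. cinner x y = 0}"
  by (auto simp: complex_vector.subspace_def cinner_add_right cinner_scaleC_right)

lemma csubspace_scaleR:
  "complex_vector.subspace N \<Longrightarrow> x \<in> N \<Longrightarrow> r *\<^sub>R x \<in> N"
  unfolding scaleR_scaleC by (rule complex_vector.subspace_scale)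

lemma csubspace_closure:
  fixes S :: "'a::complex_inner set"
  assumes "complex_vector.subspace S" shows "complex_vector.subspace (closure S)"
  unfolding complex_vector.subspace_def
proof (intro conjI ballI allI)
  show "0 \<in> closure S"
    using assms closure_subset complex_vector.subspace_0 by blast
  fix x assume "x \<in> closure S"
  then obtain f where f: "\<And>n. f n \<in> S" "f \<longlonglongrightarrow> x" by (auto simp: closure_sequential)
  show "c *\<^sub>C x \<in> closure S" for c
    unfolding closure_sequential
    using f assms bounded_clinear_tendsto[OF bounded_clinear_scaleC_right[OF bounded_clinear_ident] f(2)]
    by (intro exI[of _ "\<lambda>n. c *\<^sub>C f n"]) (auto simp: complex_vector.subspace_scale)
  fix y assume "y \<in> closure S"
  then obtain g where g: "\<And>n. g n \<in> S" "g \<longlonglongrightarrow> y" by (auto simp: closure_sequential)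
  show "x + y \<in> closure S"
    unfolding closure_sequential
    using f g assms by (intro exI[of _ "\<lambda>n. f n + g n"])
      (auto simp: complex_vector.subspace_add intro: tendsto_add)
qed

lemma closure_cspan_subset:
  fixes S N :: "'a::complex_inner set"
  assumes "S \<subseteq> N" "complex_vector.subspace N" "closed N"
  shows "closure (cspan S) \<subseteq> N"
  by (intro closure_minimal complex_vector.span_minimal assms)

lemma csubspace_vimage:
  assumes A: "bounded_clinear A" and N: "complex_vector.subspace N"
  shows "complex_vector.subspace {x. A x \<in> N}"
  using N by (auto simp: complex_vector.subspace_def bounded_clinear_add[OF A]
      bounded_clinear_scaleC[OF A] bounded_clinear_zero[OF A])

lemma closed_vimage_bounded_clinear:
  assumes A: "bounded_clinear A" and N: "closed N"
  shows "closed {x. A x \<in> N}"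
proof -
  have "closed (A -` N)"
    using A unfolding bounded_clinear_def by (intro closed_vimage N linear_continuous_on) auto
  thus ?thesis by (simp add: vimage_def)
qed

lemma bounded_clinear_closure_cspan:
  assumes "bounded_clinear A" "complex_vector.subspace N" "closed N"
    and "\<And>x. x \<in> S \<Longrightarrow> A x \<in> N" and "x \<in> closure (cspan S)"
  shows "A x \<in> N"
proof -
  have "closure (cspan S) \<subseteq> {x. A x \<in> N}"
    using assms(4)
    by (intro closure_cspan_subset csubspace_vimage closed_vimage_bounded_clinear assms(1-3)) auto
  thus ?thesis using assms(5) by blast
qed

lemma bounded_clinear_eq_on_closure_cspan:
  assumes A: "bounded_clinear A" and B: "bounded_clinear B"
    and "\<And>x. x \<in> S \<Longrightarrow> A x = B x" "x \<in> closure (cspan S)"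
  shows "A x = B x"
proof -
  have "A x - B x \<in> {0}"
    by (rule bounded_clinear_closure_cspan[OF bounded_clinear_minus[OF A B] _ _ _ assms(4)])
       (auto simp: assms(3))
  thus ?thesis by simp
qed

lemma
  fixes A :: "nat \<Rightarrow> 'a::complex_inner \<Rightarrow> 'b::complex_inner"
  assumes A: "\<And>n. bounded_clinear (A n)" and B: "bounded_clinear B"
    and bound: "\<And>n x. norm (A n x) \<le> C * norm x"
  shows subspace_converging: "complex_vector.subspace {x. (\<lambda>n. A n x) \<longlonglongrightarrow> B x}"
    and closed_converging: "closed {x. (\<lambda>n. A n x) \<longlonglongrightarrow> B x}"
proof -
  show "complex_vector.subspace {x. (\<lambda>n. A n x) \<longlonglongrightarrow> B x}"
    by (auto simp: complex_vector.subspace_def bounded_clinear_add[OF A] bounded_clinear_add[OF B]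
        bounded_clinear_zero[OF A] bounded_clinear_zero[OF B]
        bounded_clinear_scaleC[OF A] bounded_clinear_scaleC[OF B]
        intro: tendsto_add
        bounded_clinear_tendsto[OF bounded_clinear_scaleC_right[OF bounded_clinear_ident]])
  obtain K where K: "\<And>x. norm (B x) \<le> norm x * K" "K > 0"
    using B bounded_linear.pos_bounded unfolding bounded_clinear_def by blast
  define D where "D = \<bar>C\<bar> + K + 1"
  have D: "D > 0" using K by (simp add: D_def)
  have "(\<lambda>n. A n x) \<longlonglongrightarrow> B x" if x: "x \<in> closure {x. (\<lambda>n. A n x) \<longlonglongrightarrow> B x}" for x
  proof (rule LIMSEQ_I)
    fix e :: real assume e: "e > 0"
    obtain y where y: "(\<lambda>n. A n y) \<longlonglongrightarrow> B y" "dist y x < e / (2 * D)"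
      using x e D unfolding closure_approachable by (metis divide_pos_pos mem_Collect_eq mult_pos_pos zero_less_numeral)
    obtain N where N: "\<And>n. n \<ge> N \<Longrightarrow> norm (A n y - B y) < e / 2"
      using LIMSEQ_D[OF y(1), of "e / 2"] e by auto
    have "norm (A n x - B x) < e" if "n \<ge> N" for n
    proof -
      have "A n x - B x = A n (x - y) + (A n y - B y) - B (x - y)"
        by (simp add: bounded_clinear_diff[OF A] bounded_clinear_diff[OF B])
      hence "norm (A n x - B x) \<le> norm (A n (x - y)) + norm (A n y - B y) + norm (B (x - y))"
        using norm_triangle_ineq4[of "A n (x - y) + (A n y - B y)" "B (x - y)"]
          norm_triangle_ineq[of "A n (x - y)" "A n y - B y"] by simp
      also have "\<dots> = norm (A n (x - y)) + norm (B (x - y)) + norm (A n y - B y)" by simp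
      also have "\<dots> \<le> C * norm (x - y) + norm (x - y) * K + norm (A n y - B y)"
        by (intro add_mono bound K order.refl)
      also have "\<dots> \<le> D * norm (x - y) + norm (A n y - B y)"
        using mult_right_mono[OF abs_ge_self norm_ge_zero, of C "x - y"]
        unfolding D_def distrib_right by (simp add: mult.commute add_increasing2)
      also have "D * norm (x - y) \<le> e / 2"
        using y(2) D by (simp add: dist_norm norm_minus_commute field_simps)
      finally show ?thesis using N[OF that] by simp
    qed
    thus "\<exists>N. \<forall>n\<ge>N. norm (A n x - B x) < e" by blast
  qed
  thus "closed {x. (\<lambda>n. A n x) \<longlonglongrightarrow> B x}"
    unfolding closure_subset_eq[symmetric] by blast
qed

section \<open>Orthogonal projections\<close>

lemma norm_sum_orthogonal:
  fixes x :: "'i \<Rightarrow> 'a::complex_inner"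
  assumes "finite I" "\<And>i j. i \<in> I \<Longrightarrow> j \<in> I \<Longrightarrow> i \<noteq> j \<Longrightarrow> cinner (x i) (x j) = 0"
  shows "(norm (\<Sum>i\<in>I. x i))\<^sup>2 = (\<Sum>i\<in>I. (norm (x i))\<^sup>2)"
  using assms
proof (induction I)
  case (insert a I)
  have "inner (x a) (\<Sum>i\<in>I. x i) = 0"
    unfolding inner_cinner cinner_sum_right
    by (subst sum.neutral) (use insert in force)+
  thus ?case
    using insert by (simp add: power2_norm_eq_inner inner_add_left inner_add_right inner_commute)
qed simp

lemma ex_orthogonal_projection:
  fixes M :: "'a::{complex_inner, complete_space} set"
  assumes M: "complex_vector.subspace M" "closed M"
  shows "\<exists>y\<in>M. \<forall>z\<in>M. cinner z (x - y) = 0"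
proof -
  define d where "d = infdist x M"
  have ne: "M \<noteq> {}" using M complex_vector.subspace_0 by blast
  have d: "d \<ge> 0" "\<And>m. m \<in> M \<Longrightarrow> d \<le> norm (x - m)"
    unfolding d_def by (auto simp: infdist_nonneg dist_norm[symmetric] infdist_le)
  have "\<exists>m\<in>M. norm (x - m) < d + 1 / Suc n" for n
  proof -
    have "infdist x M < d + 1 / Suc n" unfolding d_def by simp
    thus ?thesis
      unfolding infdist_notempty[OF ne] dist_norm
      by (subst (asm) cINF_less_iff) (auto simp: ne intro!: bdd_belowI2[where m = 0])
  qed
  then obtain m where m: "\<And>n. m n \<in> M" "\<And>n. norm (x - m n) < d + 1 / Suc n" by metis
  have lim: "(\<lambda>n. norm (x - m n)) \<longlonglongrightarrow> d"
  proof (rule tendsto_sandwich[OF _ _ tendsto_const])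
    show "(\<lambda>n. d + 1 / real (Suc n)) \<longlonglongrightarrow> d"
      using tendsto_add[OF tendsto_const LIMSEQ_inverse_real_of_nat, of d]
      by (simp add: inverse_eq_divide)
  qed (use m d in \<open>auto intro!: always_eventually less_imp_le\<close>)
  have "Cauchy m"
  proof (rule CauchyI)
    fix e :: real assume e: "e > 0"
    have lim2: "(\<lambda>n. (norm (x - m n))\<^sup>2) \<longlonglongrightarrow> d\<^sup>2" by (intro tendsto_power lim)
    then obtain N where N: "\<And>n. n \<ge> N \<Longrightarrow> \<bar>(norm (x - m n))\<^sup>2 - d\<^sup>2\<bar> < e\<^sup>2 / 4"
      using LIMSEQ_D[OF lim2, of "e\<^sup>2 / 4"] e by (auto simp: real_norm_def)
    have "norm (m a - m b) < e" if "a \<ge> N" "b \<ge> N" for a b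
    proof -
      have "(norm (m a - m b))\<^sup>2 = 2 * (norm (x - m a))\<^sup>2 + 2 * (norm (x - m b))\<^sup>2
          - 4 * (norm (x - (1/2) *\<^sub>R (m a + m b)))\<^sup>2"
        unfolding power2_norm_eq_inner
        by (simp add: inner_diff_left inner_diff_right inner_add_left inner_add_right inner_commute
            field_simps)
      moreover have "d\<^sup>2 \<le> (norm (x - (1/2) *\<^sub>R (m a + m b)))\<^sup>2"
        using d m M by (intro power_mono) (auto intro!: csubspace_scaleR complex_vector.subspace_add)
      ultimately have "(norm (m a - m b))\<^sup>2 < e\<^sup>2"
        using N[OF that(1)] N[OF that(2)] by linarith
      thus ?thesis using e by (simp add: power2_less_imp_less)
    qed
    thus "\<exists>N. \<forall>a\<ge>N. \<forall>b\<ge>N. norm (m a - m b) < e" by blast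
  qed
  then obtain y where y: "m \<longlonglongrightarrow> y" using Cauchy_convergent_iff convergent_def by blast
  have yM: "y \<in> M" using M(2) y m(1) closed_sequentially by blast
  have yd: "norm (x - y) = d"
    using LIMSEQ_unique[OF tendsto_norm[OF tendsto_diff[OF tendsto_const y]] lim] by simp
  have re: "inner z (x - y) = 0" if z: "z \<in> M" for z
  proof (cases "z = 0")
    case False
    define t where "t = inner z (x - y) / (norm z)\<^sup>2"
    have "d\<^sup>2 \<le> (norm (x - (y + t *\<^sub>R z)))\<^sup>2"
      using d yM z M by (intro power_mono) (auto intro!: csubspace_scaleR complex_vector.subspace_add)
    also have "\<dots> = d\<^sup>2 - 2 * t * inner z (x - y) + t\<^sup>2 * (norm z)\<^sup>2"
      unfolding yd[symmetric] power2_norm_eq_inner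
      by (simp add: inner_diff_left inner_diff_right inner_add_left inner_add_right inner_commute
          algebra_simps power2_eq_square)
    also have "\<dots> = d\<^sup>2 - (inner z (x - y))\<^sup>2 / (norm z)\<^sup>2"
      using False by (simp add: t_def field_simps power2_eq_square)
    finally show ?thesis using False by (simp add: field_simps)
  qed simp
  have "cinner z (x - y) = 0" if z: "z \<in> M" for z
    using re[OF z] re[OF complex_vector.subspace_scale[OF M(1) z, of \<i>]]
    by (simp add: complex_eq_iff inner_cinner cinner_scaleC_left)
  thus ?thesis using yM by blast
qed

lemma
  fixes M :: "'a::{complex_inner, complete_space} set"
  assumes M: "complex_vector.subspace M" "closed M"
  shows orth_proj_in: "orth_proj M x \<in> M"
    and orth_proj_orthogonal: "z \<in> M \<Longrightarrow> cinner z (x - orth_proj M x) = 0"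
    and orth_proj_unique: "y \<in> M \<Longrightarrow> (\<And>z. z \<in> M \<Longrightarrow> cinner z (x - y) = 0) \<Longrightarrow> orth_proj M x = y"
proof -
  have uniq: "y = y'" if "y \<in> M" "\<forall>z\<in>M. cinner z (x - y) = 0" "y' \<in> M" "\<forall>z\<in>M. cinner z (x - y') = 0" for y y'
  proof -
    have "cinner (y - y') (x - y' - (x - y)) = 0"
      using that complex_vector.subspace_diff[OF M(1)] by (subst cinner_diff_right) simp
    thus ?thesis by simp
  qed
  hence "\<exists>!y. y \<in> M \<and> (\<forall>z\<in>M. cinner z (x - y) = 0)"
    using ex_orthogonal_projection[OF M, of x] by blast
  from theI'[OF this] have *: "orth_proj M x \<in> M \<and> (\<forall>z\<in>M. cinner z (x - orth_proj M x) = 0)"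
    by (simp add: orth_proj_def)
  thus "orth_proj M x \<in> M" "z \<in> M \<Longrightarrow> cinner z (x - orth_proj M x) = 0" by auto
  show "y \<in> M \<Longrightarrow> (\<And>z. z \<in> M \<Longrightarrow> cinner z (x - y) = 0) \<Longrightarrow> orth_proj M x = y"
    using * uniq by blast
qed

context
  fixes M :: "'a::{complex_inner, complete_space} set"
  assumes M: "complex_vector.subspace M" "closed M"
begin

lemma orth_proj_ident: "x \<in> M \<Longrightarrow> orth_proj M x = x"
  by (rule orth_proj_unique[OF M]) auto

lemma orth_proj_eq_0: "(\<And>z. z \<in> M \<Longrightarrow> cinner z x = 0) \<Longrightarrow> orth_proj M x = 0"
  by (rule orth_proj_unique[OF M]) (auto simp: complex_vector.subspace_0[OF M(1)])

lemma orth_proj_Pythagoras: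
  assumes "y \<in> M"
  shows "(norm (x - y))\<^sup>2 = (norm (x - orth_proj M x))\<^sup>2 + (norm (orth_proj M x - y))\<^sup>2"
proof -
  have "inner (orth_proj M x - y) (x - orth_proj M x) = 0"
    unfolding inner_cinner
    by (subst orth_proj_orthogonal[OF M]) (auto intro: complex_vector.subspace_diff[OF M(1)] orth_proj_in[OF M] assms)
  hence "orthogonal (x - orth_proj M x) (orth_proj M x - y)"
    by (simp add: orthogonal_def inner_commute)
  from norm_add_Pythagorean[OF this] show ?thesis by simp
qed

lemma norm_orth_proj_diff_le:
  assumes "y \<in> M" shows "norm (x - orth_proj M x) \<le> norm (x - y)"
proof (rule power2_le_imp_le)
  show "(norm (x - orth_proj M x))\<^sup>2 \<le> (norm (x - y))\<^sup>2"
    using orth_proj_Pythagoras[OF assms, of x] by simp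
qed simp

lemma norm_orth_proj_le: "norm (orth_proj M x) \<le> norm x"
proof (rule power2_le_imp_le)
  have "(norm x)\<^sup>2 = (norm (x - orth_proj M x))\<^sup>2 + (norm (orth_proj M x))\<^sup>2"
    using orth_proj_Pythagoras[OF complex_vector.subspace_0[OF M(1)], of x]
    by (simp only: diff_zero)
  thus "(norm (orth_proj M x))\<^sup>2 \<le> (norm x)\<^sup>2" by simp
qed simp

lemma bounded_clinear_orth_proj: "bounded_clinear (orth_proj M)"
proof (rule bounded_clinearI[where C = 1])
  show "orth_proj M (x + y) = orth_proj M x + orth_proj M y" for x y
  proof (rule orth_proj_unique[OF M])
    show "orth_proj M x + orth_proj M y \<in> M"
      by (intro complex_vector.subspace_add[OF M(1)] orth_proj_in[OF M])
    show "cinner z (x + y - (orth_proj M x + orth_proj M y)) = 0" if "z \<in> M" for z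
      unfolding add_diff_add cinner_add_right by (simp add: orth_proj_orthogonal[OF M that])
  qed
  show "orth_proj M (c *\<^sub>C x) = c *\<^sub>C orth_proj M x" for c x
  proof (rule orth_proj_unique[OF M])
    show "c *\<^sub>C orth_proj M x \<in> M"
      by (intro complex_vector.subspace_scale[OF M(1)] orth_proj_in[OF M])
    show "cinner z (c *\<^sub>C x - c *\<^sub>C orth_proj M x) = 0" if "z \<in> M" for z
      unfolding complex_vector.scale_right_diff_distrib[symmetric] cinner_scaleC_right
      by (simp add: orth_proj_orthogonal[OF M that])
  qed
qed (simp add: norm_orth_proj_le)

end

section \<open>Extension from a total family\<close>

lemma bounded_clinear_extension:
  fixes x :: "'i \<Rightarrow> 'a::complex_inner" and g :: "'i \<Rightarrow> 'b::{complex_inner, complete_space}"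
  assumes total: "closure (cspan (range x)) = UNIV"
    and bound: "\<And>I c. finite I \<Longrightarrow> norm (\<Sum>i\<in>I. c i *\<^sub>C g i) \<le> C * norm (\<Sum>i\<in>I. c i *\<^sub>C x i)"
  shows "\<exists>A. bounded_clinear A \<and> (\<forall>i. A (x i) = g i) \<and> (\<forall>y. norm (A y) \<le> C * norm y)"
proof -
  define X where "X = (\<lambda>c. \<Sum>i | c i \<noteq> 0. c i *\<^sub>C x i)"
  define G where "G = (\<lambda>c. \<Sum>i | c i \<noteq> 0. c i *\<^sub>C g i)"
  define F where "F = {c :: 'i \<Rightarrow> complex. finite {i. c i \<noteq> 0}}"
  have support: "(\<Sum>i | c i \<noteq> 0. c i *\<^sub>C f i) = (\<Sum>i\<in>I. c i *\<^sub>C f i)"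
    if "finite I" "{i. c i \<noteq> 0} \<subseteq> I" for c I and f :: "'i \<Rightarrow> 'z::complex_inner"
    using that by (intro sum.mono_neutral_left) auto
  have add: "(\<Sum>i | a i + b i \<noteq> 0. (a i + b i) *\<^sub>C f i)
      = (\<Sum>i | a i \<noteq> 0. a i *\<^sub>C f i) + (\<Sum>i | b i \<noteq> 0. b i *\<^sub>C f i)" "(\<lambda>i. a i + b i) \<in> F"
    if "a \<in> F" "b \<in> F" for a b and f :: "'i \<Rightarrow> 'z::complex_inner"
  proof -
    let ?I = "{i. a i \<noteq> 0} \<union> {i. b i \<noteq> 0}"
    have I: "finite ?I" using that by (auto simp: F_def)
    show "(\<lambda>i. a i + b i) \<in> F"
      unfolding F_def mem_Collect_eq by (rule finite_subset[OF _ I]) auto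
    show "(\<Sum>i | a i + b i \<noteq> 0. (a i + b i) *\<^sub>C f i)
      = (\<Sum>i | a i \<noteq> 0. a i *\<^sub>C f i) + (\<Sum>i | b i \<noteq> 0. b i *\<^sub>C f i)"
      by (subst (1 2 3) support[OF I]) (auto simp: sum.distrib scaleC_add_left)
  qed
  have scale: "(\<Sum>i | k * b i \<noteq> 0. (k * b i) *\<^sub>C f i) = k *\<^sub>C (\<Sum>i | b i \<noteq> 0. b i *\<^sub>C f i)"
    "(\<lambda>i. k * b i) \<in> F" if "b \<in> F" for k b and f :: "'i \<Rightarrow> 'z::complex_inner"
  proof -
    have I: "finite {i. b i \<noteq> 0}" using that by (auto simp: F_def)
    show "(\<lambda>i. k * b i) \<in> F"
      unfolding F_def mem_Collect_eq by (rule finite_subset[OF _ I]) auto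
    show "(\<Sum>i | k * b i \<noteq> 0. (k * b i) *\<^sub>C f i) = k *\<^sub>C (\<Sum>i | b i \<noteq> 0. b i *\<^sub>C f i)"
      by (subst (1 2) support[OF I]) (auto simp: complex_vector.scale_sum_right scaleC_scaleC)
  qed
  have hom: "X (\<lambda>i. a i + b i) = X a + X b" "G (\<lambda>i. a i + b i) = G a + G b"
    "X (\<lambda>i. k * b i) = k *\<^sub>C X b" "G (\<lambda>i. k * b i) = k *\<^sub>C G b"
    if "a \<in> F" "b \<in> F" for a b k
    unfolding X_def G_def using that by (intro add(1) scale(1); simp)+
  have GX: "norm (G c) \<le> C * norm (X c)" if "c \<in> F" for c
    using bound that by (simp add: F_def X_def G_def)
  have Gdiff: "norm (G a - G b) \<le> C * norm (X a - X b)" if "a \<in> F" "b \<in> F" for a b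
    using GX[OF add(2)[OF that(1) scale(2)[OF that(2), of "- 1"]]]
    unfolding hom(1,2)[OF that(1) scale(2)[OF that(2), of "- 1"]] hom(3,4)[OF that]
    by (simp add: scaleC_one)
  have unit: "(\<lambda>i. of_bool (i = k)) \<in> F"
    "(\<Sum>i | of_bool (i = k) \<noteq> (0::complex). of_bool (i = k) *\<^sub>C f i) = f k"
    for k and f :: "'i \<Rightarrow> 'z::complex_inner"
    by (simp_all add: F_def scaleC_one)
  have "complex_vector.subspace (X ` F)"
    unfolding complex_vector.subspace_def
  proof (intro conjI ballI allI)
    show "0 \<in> X ` F" by (rule image_eqI[of _ _ "\<lambda>_. 0"]) (auto simp: X_def F_def)
  qed (auto simp flip: hom intro!: imageI add(2) scale(2))
  moreover have "range x \<subseteq> X ` F"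
  proof clarify
    fix k
    have "X (\<lambda>i. of_bool (i = k)) = x k" unfolding X_def by (rule unit(2))
    thus "x k \<in> X ` F" using imageI[OF unit(1), of X k] by simp
  qed
  ultimately have "cspan (range x) \<subseteq> X ` F" by (simp add: complex_vector.span_minimal)
  from closure_mono[OF this] total have dense: "y \<in> closure (X ` F)" for y by auto
  have "\<exists>s. (\<forall>n. s n \<in> F) \<and> (\<lambda>n. X (s n)) \<longlonglongrightarrow> y" for y
  proof -
    obtain z where z: "\<And>n. z n \<in> X ` F" "z \<longlonglongrightarrow> y"
      using dense[of y] unfolding closure_sequential by blast
    have "\<forall>n. \<exists>c. c \<in> F \<and> z n = X c" using z(1) by blast
    then obtain s where "\<And>n. s n \<in> F" "\<And>n. z n = X (s n)" by metis
    moreover from this(2) have "z = (\<lambda>n. X (s n))" by (rule ext)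
    ultimately show ?thesis using z(2) by blast
  qed
  then obtain s where s: "\<And>y n. s y n \<in> F" "\<And>y. (\<lambda>n. X (s y n)) \<longlonglongrightarrow> y" by metis
  have Cauchy: "Cauchy (\<lambda>n. G (s y n))" for y
  proof -
    have "Cauchy (\<lambda>n. X (s y n))" using s(2) LIMSEQ_imp_Cauchy by blast
    show ?thesis
    proof (rule CauchyI)
      fix e :: real assume e: "e > 0"
      obtain N where N: "\<And>m n. m \<ge> N \<Longrightarrow> n \<ge> N \<Longrightarrow> norm (X (s y m) - X (s y n)) < e / (\<bar>C\<bar> + 1)"
        using CauchyD[OF \<open>Cauchy (\<lambda>n. X (s y n))\<close>, of "e / (\<bar>C\<bar> + 1)"] e by auto
      have "norm (G (s y m) - G (s y n)) < e" if "m \<ge> N" "n \<ge> N" for m n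
      proof -
        have "norm (G (s y m) - G (s y n)) \<le> C * norm (X (s y m) - X (s y n))"
          by (rule Gdiff) (rule s)+
        also have "\<dots> \<le> (\<bar>C\<bar> + 1) * norm (X (s y m) - X (s y n))"
          by (intro mult_right_mono) auto
        also have "\<dots> < e" using N[OF that] by (simp add: field_simps)
        finally show ?thesis .
      qed
      thus "\<exists>N. \<forall>m\<ge>N. \<forall>n\<ge>N. norm (G (s y m) - G (s y n)) < e" by blast
    qed
  qed
  define A where "A y = lim (\<lambda>n. G (s y n))" for y
  have A: "(\<lambda>n. G (s y n)) \<longlonglongrightarrow> A y" for y
    unfolding A_def using Cauchy[of y] by (simp add: Cauchy_convergent_iff convergent_LIMSEQ_iff)
  have limG: "(\<lambda>n. G (a n)) \<longlonglongrightarrow> A y" if "\<And>n. a n \<in> F" "(\<lambda>n. X (a n)) \<longlonglongrightarrow> y" for a y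
  proof -
    have "(\<lambda>n. G (a n) - G (s y n)) \<longlonglongrightarrow> 0"
    proof (rule Lim_null_comparison)
      show "\<forall>\<^sub>F n in sequentially. norm (G (a n) - G (s y n)) \<le> C * norm (X (a n) - X (s y n))"
        using Gdiff s that by simp
      have "(\<lambda>n. C * norm (X (a n) - X (s y n))) \<longlonglongrightarrow> C * norm (y - y)"
        by (intro tendsto_intros that s)
      thus "(\<lambda>n. C * norm (X (a n) - X (s y n))) \<longlonglongrightarrow> 0" by simp
    qed
    from tendsto_add[OF this A[of y]] show ?thesis by simp
  qed
  have "norm (A y) \<le> C * norm y" for y
    by (rule LIMSEQ_le[OF tendsto_norm[OF A] tendsto_mult[OF tendsto_const tendsto_norm[OF s(2)]]])
       (use GX s in blast)
  moreover have "A (x k) = g k" for k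
    using limG[of "\<lambda>_ i. of_bool (i = k)" "x k"] unit(1)
    by (auto simp: X_def G_def unit(2) LIMSEQ_const_iff)
  moreover have "A (y + z) = A y + A z" for y z
  proof -
    have "(\<lambda>n. X (\<lambda>i. s y n i + s z n i)) \<longlonglongrightarrow> y + z"
      using tendsto_add[OF s(2) s(2), of y z] by (simp add: hom s(1))
    from limG[OF add(2)[OF s(1) s(1)] this] tendsto_add[OF A A, of y z]
    show ?thesis by (intro LIMSEQ_unique) (auto simp: hom s(1))
  qed
  moreover have "A (k *\<^sub>C y) = k *\<^sub>C A y" for k y
  proof -
    note lim = bounded_clinear_tendsto[OF bounded_clinear_scaleC_right[OF bounded_clinear_ident], of _ _ _ k]
    have "(\<lambda>n. X (\<lambda>i. k * s y n i)) \<longlonglongrightarrow> k *\<^sub>C y"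
      using lim[OF s(2), of y] by (simp add: hom(3)[OF s(1) s(1)])
    from limG[OF scale(2)[OF s(1)] this] lim[OF A, of y]
    show ?thesis by (intro LIMSEQ_unique) (auto simp: hom(4)[OF s(1) s(1)])
  qed
  ultimately show ?thesis
    by (intro exI[of _ A] conjI bounded_clinearI[where C = C]) auto
qed

lemma cinner_bounded_clinear_eqI:
  fixes x :: "'i \<Rightarrow> 'a::complex_inner"
  assumes total: "closure (cspan (range x)) = UNIV"
    and B: "bounded_clinear B" and D: "bounded_clinear D"
    and eq: "\<And>i. cinner a (B (x i)) = cinner c (D (x i))"
  shows "cinner a (B \<psi>) = cinner c (D \<psi>)"
proof -
  let ?N = "{\<psi>. cinner a (B \<psi>) = cinner c (D \<psi>)}"
  have "closure (cspan (range x)) \<subseteq> ?N"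
  proof (rule closure_cspan_subset)
    show "complex_vector.subspace ?N"
      by (auto simp: complex_vector.subspace_def bounded_clinear_add[OF B] bounded_clinear_add[OF D]
          bounded_clinear_zero[OF B] bounded_clinear_zero[OF D] cinner_add_right cinner_scaleC_right
          bounded_clinear_scaleC[OF B] bounded_clinear_scaleC[OF D])
    show "closed ?N"
      unfolding closed_sequential_limits
    proof (intro allI impI, elim conjE)
      fix f l assume f: "\<forall>n. f n \<in> ?N" and lim: "f \<longlonglongrightarrow> l"
      have "(\<lambda>n. cinner a (B (f n))) \<longlonglongrightarrow> cinner a (B l)"
        "(\<lambda>n. cinner c (D (f n))) \<longlonglongrightarrow> cinner c (D l)"
        by (intro tendsto_cinner tendsto_const bounded_clinear_tendsto[OF B lim]
            bounded_clinear_tendsto[OF D lim])+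
      with f show "l \<in> ?N" by (simp add: LIMSEQ_unique)
    qed
  qed (auto simp: eq)
  thus ?thesis using total by blast
qed

lemma cinner_sesquilinear_eqI:
  fixes x :: "'i \<Rightarrow> 'a::complex_inner"
  assumes total: "closure (cspan (range x)) = UNIV"
    and A: "bounded_clinear A" and B: "bounded_clinear B"
    and C: "bounded_clinear C" and D: "bounded_clinear D"
    and eq: "\<And>i j. cinner (A (x i)) (B (x j)) = cinner (C (x i)) (D (x j))"
  shows "cinner (A \<phi>) (B \<psi>) = cinner (C \<phi>) (D \<psi>)"
proof (rule cinner_bounded_clinear_eqI[OF total B D])
  fix j
  have "cinner (B (x j)) (A \<phi>) = cinner (D (x j)) (C \<phi>)"
  proof (rule cinner_bounded_clinear_eqI[OF total A C])
    show "cinner (B (x j)) (A (x i)) = cinner (D (x j)) (C (x i))" for i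
      using arg_cong[OF eq[of i j], of cnj] by (simp only: cinner_commute[symmetric])
  qed
  thus "cinner (A \<phi>) (B (x j)) = cinner (C \<phi>) (D (x j))"
    by (metis cinner_commute)
qed

lemma cinner_ext: "(\<And>\<phi>. cinner \<phi> x = cinner \<phi> y) \<Longrightarrow> x = (y :: 'a::complex_inner)"
  using cinner_eq_zero_iff[of "x - y"] by (simp add: cinner_diff_right)

lemma norm_power2_cinner: "complex_of_real ((norm x)\<^sup>2) = cinner x (x :: 'a::complex_inner)"
  by (simp add: cinner_self power2_norm_eq_inner)

lemma cinner_sum_sum:
  "cinner (\<Sum>i\<in>I. c i *\<^sub>C f i) (\<Sum>j\<in>J. d j *\<^sub>C g j)
    = (\<Sum>i\<in>I. \<Sum>j\<in>J. cnj (c i) * d j * cinner (f i) (g j :: 'a::complex_inner))"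
  unfolding cinner_sum_left cinner_sum_right[of "_ *\<^sub>C _"]
  by (simp add: cinner_scaleC_left cinner_scaleC_right mult_ac)

section \<open>Operators on the full Fock space\<close>

lemma fock_operator_eqI:
  fixes A B :: "'a::complex_inner fock \<Rightarrow> 'b::complex_inner"
  assumes "bounded_clinear A" "bounded_clinear B" "\<And>w. A (tensor w) = B (tensor w)"
  shows "A = B"
proof
  show "A \<psi> = B \<psi>" for \<psi>
    by (rule bounded_clinear_eq_on_closure_cspan[OF assms(1,2), of "range tensor"])
       (auto simp: assms(3) closure_cspan_tensor)
qed

lemma fock_eqI:
  assumes "\<And>u. cinner (tensor u) x = cinner (tensor u) y" shows "x = (y :: 'a::complex_inner fock)"
proof (rule cinner_ext)
  fix \<phi> :: "'a fock"
  have "cinner x \<phi> = cinner y \<phi>"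
    by (rule cinner_bounded_clinear_eqI[OF closure_cspan_tensor bounded_clinear_ident bounded_clinear_ident])
       (metis assms cinner_commute)
  thus "cinner \<phi> x = cinner \<phi> y" by (metis cinner_commute)
qed

lemma tensor_Cons_add: "tensor ((f + g) # w) = tensor (f # w) + tensor (g # w)"
proof (rule fock_eqI)
  show "cinner (tensor u) (tensor ((f + g) # w)) = cinner (tensor u) (tensor (f # w) + tensor (g # w))" for u
    by (cases u) (simp_all add: cinner_tensor cinner_add_right ring_distribs)
qed

lemma tensor_Cons_scaleC: "tensor (c *\<^sub>C f # w) = c *\<^sub>C tensor (f # w)"
proof (rule fock_eqI)
  show "cinner (tensor u) (tensor (c *\<^sub>C f # w)) = cinner (tensor u) (c *\<^sub>C tensor (f # w))" for u
    by (cases u) (simp_all add: cinner_tensor cinner_scaleC_right)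
qed

lemma cinner_tensor_Cons:
  "cinner (tensor (e # u)) (tensor (f # v)) = cinner e f * cinner (tensor u) (tensor v)"
  by (simp add: cinner_tensor)

lemma
  fixes f :: "'a::complex_inner"
  shows bounded_clinear_creation: "bounded_clinear (creation f)"
    and creation_tensor: "creation f (tensor w) = tensor (f # w)"
proof -
  have bound: "norm (\<Sum>w\<in>I. c w *\<^sub>C tensor (f # w)) \<le> norm f * norm (\<Sum>w\<in>I. c w *\<^sub>C tensor w)"
    for I and c :: "'a list \<Rightarrow> complex"
  proof (rule power2_le_imp_le)
    have "complex_of_real ((norm (\<Sum>w\<in>I. c w *\<^sub>C tensor (f # w)))\<^sup>2)
        = complex_of_real ((norm f)\<^sup>2 * (norm (\<Sum>w\<in>I. c w *\<^sub>C tensor w))\<^sup>2)"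
      unfolding of_real_mult norm_power2_cinner cinner_sum_sum cinner_tensor_Cons
      by (simp add: sum_distrib_left mult_ac)
    thus "(norm (\<Sum>w\<in>I. c w *\<^sub>C tensor (f # w)))\<^sup>2
        \<le> (norm f * norm (\<Sum>w\<in>I. c w *\<^sub>C tensor w))\<^sup>2"
      unfolding of_real_eq_iff power_mult_distrib by simp
  qed simp
  obtain A where "bounded_clinear A \<and> (\<forall>w. A (tensor w) = tensor (f # w))"
    using bounded_clinear_extension[OF closure_cspan_tensor bound] by blast
  hence "\<exists>!A. bounded_clinear A \<and> (\<forall>w. A (tensor w) = tensor (f # w))"
    by (intro ex1I[of _ A]) (auto intro: fock_operator_eqI)
  from theI'[OF this] show "bounded_clinear (creation f)" "creation f (tensor w) = tensor (f # w)"
    by (simp_all add: creation_def)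
qed

lemma cinner_creation: "cinner (creation f \<phi>) (creation g \<psi>) = cinner f g * cinner \<phi> \<psi>"
proof -
  have "cinner (creation f \<phi>) (creation g \<psi>) = cinner \<phi> (cinner f g *\<^sub>C \<psi>)"
    by (rule cinner_sesquilinear_eqI[OF closure_cspan_tensor])
       (auto simp: creation_tensor cinner_tensor_Cons cinner_scaleC_right
         intro: bounded_clinear_creation bounded_clinear_ident bounded_clinear_scaleC_right)
  thus ?thesis by (simp add: cinner_scaleC_right)
qed

lemma norm_creation: "norm (creation f \<psi>) = norm f * norm \<psi>"
proof -
  have "complex_of_real ((norm (creation f \<psi>))\<^sup>2) = complex_of_real ((norm f * norm \<psi>)\<^sup>2)"
    unfolding power_mult_distrib of_real_mult norm_power2_cinner cinner_creation ..
  thus ?thesis unfolding of_real_eq_iff by (simp add: power2_eq_iff_nonneg)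
qed

lemma bounded_clinear_creation_left: "bounded_clinear (\<lambda>f. creation f \<psi>)"
proof (rule bounded_clinearI[where C = "norm \<psi>"])
  show "creation (f + g) \<psi> = creation f \<psi> + creation g \<psi>" for f g
    by (rule fun_cong[where x = \<psi>], rule fock_operator_eqI)
       (auto simp: creation_tensor tensor_Cons_add
         intro: bounded_clinear_creation bounded_clinear_plus)
  show "creation (c *\<^sub>C f) \<psi> = c *\<^sub>C creation f \<psi>" for c f
    by (rule fun_cong[where x = \<psi>], rule fock_operator_eqI)
       (auto simp: creation_tensor tensor_Cons_scaleC
         intro: bounded_clinear_creation bounded_clinear_scaleC_right)
qed (simp add: norm_creation)

lemma
  fixes f :: "'a::complex_inner"
  shows bounded_clinear_annihilation: "bounded_clinear (annihilation f)"
    and annihilation_vacuum: "annihilation f (tensor []) = 0"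
    and annihilation_tensor_Cons: "annihilation f (tensor (e # w)) = cinner f e *\<^sub>C tensor w"
proof -
  define g where "g w = (case w of [] \<Rightarrow> 0 | e # v \<Rightarrow> cinner f e *\<^sub>C tensor v)" for w
  have adj: "cinner \<phi> (g w) = cinner (creation f \<phi>) (tensor w)" for \<phi> w
  proof -
    have "cinner (g w) \<phi> = cinner (tensor w) (creation f \<phi>)"
    proof (rule cinner_bounded_clinear_eqI[OF closure_cspan_tensor bounded_clinear_ident
          bounded_clinear_creation])
      show "cinner (g w) (tensor u) = cinner (tensor w) (creation f (tensor u))" for u
        by (cases w) (simp_all add: g_def creation_tensor cinner_tensor cinner_scaleC_left
            cinner_commute[symmetric])
    qed
    thus ?thesis by (metis cinner_commute)
  qed
  have bound: "norm (\<Sum>w\<in>I. c w *\<^sub>C g w) \<le> norm f * norm (\<Sum>w\<in>I. c w *\<^sub>C tensor w)" for I c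
  proof -
    define \<zeta> where "\<zeta> = (\<Sum>w\<in>I. c w *\<^sub>C g w)"
    have "complex_of_real ((norm \<zeta>)\<^sup>2) = cinner (creation f \<zeta>) (\<Sum>w\<in>I. c w *\<^sub>C tensor w)"
      unfolding norm_power2_cinner
      by (subst (2) \<zeta>_def) (simp add: cinner_sum_right cinner_scaleC_right adj)
    hence "(norm \<zeta>)\<^sup>2 = cmod (cinner (creation f \<zeta>) (\<Sum>w\<in>I. c w *\<^sub>C tensor w))"
      by (metis norm_of_real abs_of_nonneg zero_le_power2)
    also have "\<dots> \<le> norm f * norm \<zeta> * norm (\<Sum>w\<in>I. c w *\<^sub>C tensor w)"
      using cinner_Cauchy_Schwarz[of "creation f \<zeta>"] by (simp add: norm_creation)
    finally have "norm \<zeta> * norm \<zeta> \<le> norm \<zeta> * (norm f * norm (\<Sum>w\<in>I. c w *\<^sub>C tensor w))"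
      by (simp add: power2_eq_square mult_ac)
    thus ?thesis unfolding \<zeta>_def[symmetric] by (cases "\<zeta> = 0") auto
  qed
  let ?Q = "\<lambda>A. bounded_clinear A \<and> A (tensor []) = 0 \<and>
     (\<forall>e w. A (tensor (e # w)) = cinner f e *\<^sub>C tensor w)"
  obtain A where "bounded_clinear A" "\<And>w. A (tensor w) = g w"
    using bounded_clinear_extension[OF closure_cspan_tensor bound] by blast
  hence A: "?Q A" by (simp add: g_def)
  have "B = C" if "?Q B" "?Q C" for B C
  proof (rule fock_operator_eqI)
    show "B (tensor w) = C (tensor w)" for w using that by (cases w) auto
  qed (use that in auto)
  with A have "\<exists>!A. ?Q A" by blast
  from theI'[OF this] show "bounded_clinear (annihilation f)" "annihilation f (tensor []) = 0"
    "annihilation f (tensor (e # w)) = cinner f e *\<^sub>C tensor w"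
    by (simp_all add: annihilation_def)
qed

lemma cinner_annihilation: "cinner \<phi> (annihilation f \<psi>) = cinner (creation f \<phi>) \<psi>"
proof (rule cinner_sesquilinear_eqI[OF closure_cspan_tensor bounded_clinear_ident
      bounded_clinear_annihilation bounded_clinear_creation bounded_clinear_ident])
  show "cinner (tensor u) (annihilation f (tensor v)) = cinner (creation f (tensor u)) (tensor v)" for u v
    by (cases v) (simp_all add: annihilation_vacuum annihilation_tensor_Cons creation_tensor
        cinner_tensor cinner_scaleC_right)
qed

lemma cinner_annihilation_left: "cinner (annihilation f \<phi>) \<psi> = cinner \<phi> (creation f \<psi>)"
  using cinner_annihilation[of \<psi> f \<phi>] by (metis cinner_commute)

lemma annihilation_diff_left: "annihilation (f - g) \<psi> = annihilation f \<psi> - annihilation g \<psi>"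
  by (rule cinner_ext)
     (simp add: cinner_annihilation cinner_diff_right cinner_diff_left
       bounded_clinear_diff[OF bounded_clinear_creation_left])

lemma annihilation_scaleR_left: "annihilation (r *\<^sub>R f) \<psi> = r *\<^sub>R annihilation f \<psi>"
  by (rule cinner_ext)
     (simp add: cinner_annihilation cinner_scaleC_left cinner_scaleC_right scaleR_scaleC
       bounded_clinear_scaleC[OF bounded_clinear_creation_left])

lemma annihilation_sum_left: "annihilation (\<Sum>i\<in>I. f i) \<psi> = (\<Sum>i\<in>I. annihilation (f i) \<psi>)"
  by (rule cinner_ext)
     (simp add: cinner_annihilation cinner_sum_left cinner_sum_right
       bounded_clinear_sum[OF bounded_clinear_creation_left])

lemma norm_annihilation_le: "norm (annihilation f \<psi>) \<le> norm f * norm \<psi>"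
proof -
  let ?\<zeta> = "annihilation f \<psi>"
  have "(norm ?\<zeta>)\<^sup>2 = cmod (cinner ?\<zeta> ?\<zeta>)"
    by (simp only: cinner_self norm_of_real power2_norm_eq_inner abs_of_nonneg[OF inner_ge_zero])
  also have "\<dots> \<le> norm f * norm ?\<zeta> * norm \<psi>"
    unfolding cinner_annihilation
    using cinner_Cauchy_Schwarz[of "creation f ?\<zeta>"] by (simp add: norm_creation)
  finally have "norm ?\<zeta> * norm ?\<zeta> \<le> norm ?\<zeta> * (norm f * norm \<psi>)"
    by (simp add: power2_eq_square mult_ac)
  thus ?thesis by (cases "?\<zeta> = 0") auto
qed

lemma norm_sum_creation:
  assumes "finite I" "\<And>i j. i \<in> I \<Longrightarrow> j \<in> I \<Longrightarrow> i \<noteq> j \<Longrightarrow> cinner (x i) (x j) = 0"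
  shows "(norm (\<Sum>i\<in>I. creation (x i) (\<psi> i)))\<^sup>2 = (\<Sum>i\<in>I. (norm (x i))\<^sup>2 * (norm (\<psi> i))\<^sup>2)"
  using norm_sum_orthogonal[of I "\<lambda>i. creation (x i) (\<psi> i)"] assms
  by (simp add: cinner_creation norm_creation power_mult_distrib)

lemma annihilation_Bessel:
  assumes "finite I" "\<And>i j. i \<in> I \<Longrightarrow> j \<in> I \<Longrightarrow> i \<noteq> j \<Longrightarrow> cinner (x i) (x j) = 0"
    and "\<And>i. i \<in> I \<Longrightarrow> norm (x i) = 1"
  shows "(\<Sum>i\<in>I. (norm (annihilation (x i) \<phi>))\<^sup>2) \<le> (norm \<phi>)\<^sup>2"
proof -
  define G where "G = (\<Sum>i\<in>I. creation (x i) (annihilation (x i) \<phi>))"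
  have G: "(norm G)\<^sup>2 = (\<Sum>i\<in>I. (norm (annihilation (x i) \<phi>))\<^sup>2)"
    unfolding G_def using norm_sum_creation[OF assms(1,2)] assms(3) by simp
  have "complex_of_real (\<Sum>i\<in>I. (norm (annihilation (x i) \<phi>))\<^sup>2) = cinner \<phi> G"
    unfolding of_real_sum norm_power2_cinner
    by (simp add: G_def cinner_sum_right cinner_annihilation_left)
  hence "complex_of_real ((norm G)\<^sup>2) = cinner \<phi> G" by (simp only: G)
  hence "(norm G)\<^sup>2 = cmod (cinner \<phi> G)" by (metis norm_of_real abs_of_nonneg zero_le_power2)
  also have "\<dots> \<le> norm \<phi> * norm G" by (rule cinner_Cauchy_Schwarz)
  finally have "norm G * norm G \<le> norm \<phi> * norm G" by (simp add: power2_eq_square)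
  hence "norm G \<le> norm \<phi>" by (cases "G = 0") auto
  from power_mono[OF this, of 2] show ?thesis by (simp add: G)
qed

text \<open>
  Expanding the tails of the words in a finite orthonormal family turns an operator on the first
  tensor factor into a direct sum of copies of it.
\<close>

lemma norm_sum_tensor_Cons:
  fixes v :: "'i \<Rightarrow> 'a::complex_inner list"
  assumes "finite J"
  shows "\<exists>B. finite B \<and> (\<forall>e. (norm (\<Sum>i\<in>J. c i *\<^sub>C tensor (e i # v i)))\<^sup>2
      = (\<Sum>b\<in>B. (norm (\<Sum>i\<in>J. (c i * cinner b (tensor (v i))) *\<^sub>C e i))\<^sup>2))"
proof -
  obtain B where B: "finite B" "\<And>i j. i \<in> J \<Longrightarrow> j \<in> J \<Longrightarrow> cinner (tensor (v i)) (tensor (v j))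
      = (\<Sum>b\<in>B. cnj (cinner b (tensor (v i))) * cinner b (tensor (v j)))"
    using ex_finite_Parseval[of "(\<lambda>i. tensor (v i)) ` J"] assms by auto
  have "(norm (\<Sum>i\<in>J. c i *\<^sub>C tensor (e i # v i)))\<^sup>2
      = (\<Sum>b\<in>B. (norm (\<Sum>i\<in>J. (c i * cinner b (tensor (v i))) *\<^sub>C e i))\<^sup>2)" for e
  proof -
    let ?h = "\<lambda>b i j. cnj (c i * cinner b (tensor (v i))) * (c j * cinner b (tensor (v j))) * cinner (e i) (e j)"
    have "complex_of_real ((norm (\<Sum>i\<in>J. c i *\<^sub>C tensor (e i # v i)))\<^sup>2) = (\<Sum>i\<in>J. \<Sum>j\<in>J. \<Sum>b\<in>B. ?h b i j)"
      unfolding norm_power2_cinner cinner_sum_sum cinner_tensor_Cons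
      by (intro sum.cong refl) (simp add: B sum_distrib_left mult_ac)
    also have "\<dots> = (\<Sum>b\<in>B. \<Sum>i\<in>J. \<Sum>j\<in>J. ?h b i j)"
      by (simp only: sum.swap[of _ B])
    also have "\<dots> = complex_of_real (\<Sum>b\<in>B. (norm (\<Sum>i\<in>J. (c i * cinner b (tensor (v i))) *\<^sub>C e i))\<^sup>2)"
      unfolding of_real_sum norm_power2_cinner cinner_sum_sum ..
    finally show ?thesis by (simp only: of_real_eq_iff)
  qed
  thus ?thesis using B(1) by blast
qed

lemma
  fixes T :: "'a::complex_inner \<Rightarrow> 'a"
  assumes T: "bounded_clinear T" and C: "\<And>e. norm (T e) \<le> C * norm e" "C \<ge> 0"
  shows bounded_clinear_gauge: "bounded_clinear (gauge T)"
    and gauge_vacuum: "gauge T (tensor []) = 0"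
    and gauge_tensor_Cons: "gauge T (tensor (e # w)) = tensor (T e # w)"
    and norm_gauge_le: "norm (gauge T \<psi>) \<le> C * norm \<psi>"
proof -
  define g where "g w = (case w of [] \<Rightarrow> 0 | e # v \<Rightarrow> tensor (T e # v))" for w
  have bound: "norm (\<Sum>w\<in>I. c w *\<^sub>C g w) \<le> C * norm (\<Sum>w\<in>I. c w *\<^sub>C tensor w)"
    if I: "finite I" for I c
  proof (rule power2_le_imp_le)
    define J where "J = I - {[]}"
    have J: "finite J" using I by (simp add: J_def)
    obtain B where B: "finite B" "\<And>e. (norm (\<Sum>w\<in>J. c w *\<^sub>C tensor (e w # tl w)))\<^sup>2
        = (\<Sum>b\<in>B. (norm (\<Sum>w\<in>J. (c w * cinner b (tensor (tl w))) *\<^sub>C e w))\<^sup>2)"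
      using norm_sum_tensor_Cons[OF J, of c tl] by blast
    have "(\<Sum>w\<in>I. c w *\<^sub>C g w) = (\<Sum>w\<in>J. c w *\<^sub>C tensor (T (hd w) # tl w))"
      using I by (intro sum.mono_neutral_cong_right) (auto simp: J_def g_def split: list.split)
    hence "(norm (\<Sum>w\<in>I. c w *\<^sub>C g w))\<^sup>2
        = (\<Sum>b\<in>B. (norm (T (\<Sum>w\<in>J. (c w * cinner b (tensor (tl w))) *\<^sub>C hd w)))\<^sup>2)"
      by (simp add: B(2) bounded_clinear_sum[OF T] bounded_clinear_scaleC[OF T])
    also have "\<dots> \<le> (\<Sum>b\<in>B. (C * norm (\<Sum>w\<in>J. (c w * cinner b (tensor (tl w))) *\<^sub>C hd w))\<^sup>2)"
      by (intro sum_mono power_mono C norm_ge_zero)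
    also have "\<dots> = C\<^sup>2 * (norm (\<Sum>w\<in>J. c w *\<^sub>C tensor (hd w # tl w)))\<^sup>2"
      by (simp add: B(2) power_mult_distrib sum_distrib_left)
    also have "(\<Sum>w\<in>J. c w *\<^sub>C tensor (hd w # tl w)) = (\<Sum>w\<in>J. c w *\<^sub>C tensor w)"
      by (intro sum.cong) (auto simp: J_def)
    also have "(norm (\<Sum>w\<in>J. c w *\<^sub>C tensor w))\<^sup>2 \<le> (norm (\<Sum>w\<in>I. c w *\<^sub>C tensor w))\<^sup>2"
    proof (cases "[] \<in> I")
      case True
      have "cinner (tensor []) (tensor w) = 0" if "w \<in> J" for w :: "'a list"
        using that by (cases w) (auto simp: J_def cinner_tensor)
      hence "orthogonal (c [] *\<^sub>C tensor []) (\<Sum>w\<in>J. c w *\<^sub>C tensor w)"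
        unfolding orthogonal_def inner_cinner
        by (simp add: cinner_sum_right cinner_scaleC_right cinner_scaleC_left)
      from norm_add_Pythagorean[OF this] show ?thesis
        using True I by (subst sum.remove[of I "[]"]) (simp_all add: J_def)
    qed (simp add: J_def)
    finally show "(norm (\<Sum>w\<in>I. c w *\<^sub>C g w))\<^sup>2 \<le> (C * norm (\<Sum>w\<in>I. c w *\<^sub>C tensor w))\<^sup>2"
      by (simp add: power_mult_distrib mult_left_mono)
  qed (simp add: C)
  let ?Q = "\<lambda>A. bounded_clinear A \<and> A (tensor []) = 0 \<and>
     (\<forall>e w. A (tensor (e # w)) = tensor (T e # w))"
  obtain A where A: "bounded_clinear A" "\<And>w. A (tensor w) = g w" "\<And>\<psi>. norm (A \<psi>) \<le> C * norm \<psi>"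
    using bounded_clinear_extension[OF closure_cspan_tensor bound] by blast
  hence Q: "?Q A" by (simp add: g_def)
  have uniq: "B = D" if "?Q B" "?Q D" for B D
  proof (rule fock_operator_eqI)
    show "B (tensor w) = D (tensor w)" for w using that by (cases w) auto
  qed (use that in auto)
  have "gauge T = A"
    unfolding gauge_def by (rule the_equality) (use Q uniq in blast)+
  thus "bounded_clinear (gauge T)" "gauge T (tensor []) = 0"
    "gauge T (tensor (e # w)) = tensor (T e # w)" "norm (gauge T \<psi>) \<le> C * norm \<psi>"
    using A Q by auto
qed

section \<open>Step functions\<close>

lemma space_half_line: "space half_line = {0..}"
  by (simp add: space_restrict_space)

lemma sets_half_line_borel: "A \<in> sets half_line \<Longrightarrow> A \<in> sets borel"
  by (auto simp: sets_restrict_space)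

lemma square_integrable_bound_on:
  assumes "integrable half_line w" "f \<in> borel_measurable half_line"
    and "\<And>x. x \<ge> 0 \<Longrightarrow> (norm (f x))\<^sup>2 \<le> w x"
  shows "square_integrable f"
  unfolding square_integrable_def
proof
  have [measurable]: "f \<in> borel_measurable half_line" by fact
  show "integrable half_line (\<lambda>x. (norm (f x))\<^sup>2)"
  proof (rule Bochner_Integration.integrable_bound[OF assms(1)])
    show "(\<lambda>x. (norm (f x))\<^sup>2) \<in> borel_measurable half_line" by measurable
    show "AE x in half_line. norm ((norm (f x))\<^sup>2) \<le> norm (w x)"
      using assms(3) by (intro AE_I2) (force simp: space_half_line)
  qed
qed fact

lemma square_integrable_sum:
  "(\<And>i. i \<in> I \<Longrightarrow> square_integrable (f i)) \<Longrightarrow> square_integrable (\<lambda>x. \<Sum>i\<in>I. f i x)"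
  by (induction I rule: infinite_finite_induct)
     (auto simp: square_integrable_zero intro: square_integrable_add)

lemma abs_L2_add:
  "square_integrable f \<Longrightarrow> square_integrable g \<Longrightarrow> abs_L2 (\<lambda>x. f x + g x) = abs_L2 f + abs_L2 g"
  by (subst plus_L2.abs_eq) (auto simp: L2_rel_refl)

lemma abs_L2_scaleC:
  "square_integrable f \<Longrightarrow> abs_L2 (\<lambda>x. c *s f x) = c *\<^sub>C abs_L2 f"
  by (subst scaleC_L2.abs_eq) (auto simp: L2_rel_refl)

lemma abs_L2_sum:
  "(\<And>i. i \<in> I \<Longrightarrow> square_integrable (f i)) \<Longrightarrow> abs_L2 (\<lambda>x. \<Sum>i\<in>I. f i x) = (\<Sum>i\<in>I. abs_L2 (f i))"
  by (induction I rule: infinite_finite_induct)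
     (auto simp: zero_L2.abs_eq[symmetric] abs_L2_add square_integrable_sum)

lemma abs_L2_eqI:
  assumes "square_integrable f" "square_integrable g" "\<And>x. x \<ge> 0 \<Longrightarrow> f x = g x"
  shows "abs_L2 f = abs_L2 g"
proof -
  have "L2_rel f g"
    using assms by (auto simp: L2_rel_def space_half_line intro!: AE_I2)
  thus ?thesis using Quotient3_rel[OF Quotient3_L2] unfolding L2_rel_def by blast
qed

lemma norm_abs_L2:
  assumes "square_integrable f"
  shows "(norm (abs_L2 f))\<^sup>2 = (\<integral>x. (norm (f x))\<^sup>2 \<partial>half_line)"
proof -
  have "(norm (abs_L2 f))\<^sup>2 = Re (\<integral>x. cdot (f x) (f x) \<partial>half_line)"
    unfolding power2_norm_eq_inner inner_cinner
    by (subst cinner_L2.abs_eq) (auto simp: L2_rel_refl assms)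
  also have "\<dots> = (\<integral>x. (norm (f x))\<^sup>2 \<partial>half_line)"
    using integral_Re[OF integrable_cdot[OF assms assms]] by (simp add: Re_cdot_self)
  finally show ?thesis .
qed

lemma square_integrable_diff:
  "square_integrable f \<Longrightarrow> square_integrable g \<Longrightarrow> square_integrable (\<lambda>x. f x - g x)"
  using square_integrable_add[OF _ square_integrable_scaleC[of g "- 1"], of f] by simp

lemma abs_L2_diff:
  assumes "square_integrable f" "square_integrable g"
  shows "abs_L2 (\<lambda>x. f x - g x) = abs_L2 f - abs_L2 g"
  using abs_L2_add[OF square_integrable_diff[OF assms] assms(2)] by simp

lemma L2_dominated_convergence:
  assumes F: "\<And>n. square_integrable (F n)" and f: "square_integrable f"
    and w: "integrable half_line w"
    and bound: "\<And>n x. x \<ge> 0 \<Longrightarrow> (norm (F n x - f x))\<^sup>2 \<le> w x"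
    and lim: "\<And>x. x \<ge> 0 \<Longrightarrow> (\<lambda>n. F n x) \<longlonglongrightarrow> f x"
  shows "(\<lambda>n. abs_L2 (F n)) \<longlonglongrightarrow> abs_L2 f"
proof -
  have [measurable]: "F n \<in> borel_measurable half_line" "f \<in> borel_measurable half_line" for n
    using F f by (auto simp: square_integrable_def)
  have "(\<lambda>n. \<integral>x. (norm (F n x - f x))\<^sup>2 \<partial>half_line) \<longlonglongrightarrow> (\<integral>x. 0 \<partial>half_line)"
  proof (rule integral_dominated_convergence)
    show "AE x in half_line. (\<lambda>n. (norm (F n x - f x))\<^sup>2) \<longlonglongrightarrow> 0"
    proof (rule AE_I2)
      fix x assume "x \<in> space half_line"
      hence "(\<lambda>n. (norm (F n x - f x))\<^sup>2) \<longlonglongrightarrow> (norm (f x - f x))\<^sup>2"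
        by (intro tendsto_intros lim) (simp add: space_half_line)
      thus "(\<lambda>n. (norm (F n x - f x))\<^sup>2) \<longlonglongrightarrow> 0" by simp
    qed
    show "AE x in half_line. norm ((norm (F n x - f x))\<^sup>2) \<le> w x" for n
      using bound by (intro AE_I2) (simp add: space_half_line)
  qed (use w in measurable)
  hence "(\<lambda>n. (norm (abs_L2 (F n) - abs_L2 f))\<^sup>2) \<longlonglongrightarrow> 0"
    by (simp add: abs_L2_diff[symmetric] norm_abs_L2 square_integrable_diff F f)
  from tendsto_real_sqrt[OF this] have "(\<lambda>n. norm (abs_L2 (F n) - abs_L2 f)) \<longlonglongrightarrow> 0" by simp
  from tendsto_norm_zero_cancel[OF this] show ?thesis by (simp add: LIM_zero_iff)
qed

definition ind_vec :: "'n::finite \<Rightarrow> real set \<Rightarrow> real \<Rightarrow> complex ^ 'n" where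
  "ind_vec j A x = (if x \<in> A then axis j 1 else 0)"

lemma norm_ind_vec: "norm (ind_vec j A x) = indicator A x"
  by (simp add: ind_vec_def norm_axis' indicator_def)

lemma integrable_indicator_half_line:
  assumes "A \<in> sets borel" "emeasure half_line (A \<inter> {0..}) < \<infinity>"
  shows "integrable half_line (indicator A :: real \<Rightarrow> real)"
proof -
  have "integrable half_line (indicator (A \<inter> {0..}) :: real \<Rightarrow> real)"
    using assms by (intro integrable_real_indicator) (auto simp: sets_restrict_space)
  thus ?thesis
    by (rule Bochner_Integration.integrable_cong[THEN iffD1, rotated -1])
       (auto simp: space_half_line indicator_def)
qed

lemma square_integrable_ind_vec:
  assumes "A \<in> sets borel" "emeasure half_line (A \<inter> {0..}) < \<infinity>"
  shows "square_integrable (ind_vec j A)"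
proof (rule square_integrable_bound_on[OF integrable_indicator_half_line[OF assms]])
  have [measurable]: "A \<in> sets borel" by fact
  show "ind_vec j A \<in> borel_measurable half_line"
    unfolding ind_vec_def[abs_def] by (intro measurable_restrict_space1) measurable
qed (simp add: norm_ind_vec indicator_def)

lemma emeasure_half_line_bounded:
  assumes "A \<in> sets borel" "A \<subseteq> {0..<T}"
  shows "emeasure half_line (A \<inter> {0..}) < \<infinity>"
proof -
  have "emeasure half_line (A \<inter> {0..}) = emeasure lborel A"
    using assms by (subst emeasure_restrict_space) (auto simp: Int_absorb2 subset_iff)
  also have "\<dots> \<le> emeasure lborel {0..<T}" using assms by (intro emeasure_mono) auto
  also have "\<dots> < \<infinity>" by (cases "0 \<le> T") auto
  finally show ?thesis .
qed

lemma step_vec_eq_ind_vec: "step_vec j s t = abs_L2 (ind_vec j {s..<t})"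
  unfolding step_vec.abs_eq ind_vec_def[abs_def] by simp

lemma square_integrable_step: "square_integrable (ind_vec j {s..<t})"
proof -
  have "{s..<t} \<inter> {0..} \<subseteq> {0..<t}" by auto
  from emeasure_half_line_bounded[OF _ this]
  have "emeasure half_line ({s..<t} \<inter> {0..}) < \<infinity>" by (simp add: Int_assoc)
  thus ?thesis by (rule square_integrable_ind_vec[rotated]) simp
qed

context
  fixes N :: "'n::finite L2 set"
  assumes N: "complex_vector.subspace N" "closed N"
    and steps: "\<And>j t. t \<ge> 0 \<Longrightarrow> step_vec j 0 t \<in> N"
begin

lemma bounded_ind_vec_in_closed_subspace:
  assumes "A \<in> sets borel"
  shows "abs_L2 (ind_vec j (A \<inter> {0..<T})) \<in> N"
proof -
  have sq: "square_integrable (ind_vec j (B \<inter> {0..<T}))" if "B \<in> sets borel" for B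
    using that by (intro square_integrable_ind_vec emeasure_half_line_bounded[of _ T]) auto
  have stable: "Int_stable (range lessThan :: real set set)"
    unfolding Int_stable_def
  proof clarify
    fix a b :: real
    have "{..<a} \<inter> {..<b} = {..<min a b}" by auto
    thus "{..<a} \<inter> {..<b} \<in> range lessThan" by blast
  qed
  have "A \<in> sigma_sets UNIV (range lessThan)"
    using assms unfolding borel_Iio by simp
  have "range (lessThan :: real \<Rightarrow> _) \<subseteq> Pow UNIV" by simp
  from stable this \<open>A \<in> sigma_sets UNIV (range lessThan)\<close> show ?thesis
  proof (induction rule: sigma_sets_induct_disjoint)
    fix B :: "real set" assume "B \<in> range lessThan"
    then obtain b where B: "B = {..<b}" by auto
    have "{..<b} \<inter> {0..<T} = {0..<max 0 (min b T)}" by auto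
    thus "abs_L2 (ind_vec j (B \<inter> {0..<T})) \<in> N"
      using steps[of "max 0 (min b T)" j] by (simp add: B step_vec_eq_ind_vec)
  next
    show "abs_L2 (ind_vec j ({} \<inter> {0..<T})) \<in> N"
      using complex_vector.subspace_0[OF N(1)] by (simp add: ind_vec_def[abs_def] zero_L2.abs_eq[symmetric])
  next
    fix B assume "B \<in> sigma_sets UNIV (range (lessThan :: real \<Rightarrow> _))"
      and IH: "abs_L2 (ind_vec j (B \<inter> {0..<T})) \<in> N"
    hence B: "B \<in> sets borel" unfolding borel_Iio by simp
    have "ind_vec j ((UNIV - B) \<inter> {0..<T}) = (\<lambda>x. ind_vec j {0..<T} x - ind_vec j (B \<inter> {0..<T}) x)"
      by (auto simp: ind_vec_def fun_eq_iff)
    hence "abs_L2 (ind_vec j ((UNIV - B) \<inter> {0..<T})) = step_vec j 0 T - abs_L2 (ind_vec j (B \<inter> {0..<T}))"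
      using sq[OF B] by (simp add: abs_L2_diff square_integrable_step step_vec_eq_ind_vec)
    moreover have "step_vec j 0 T \<in> N"
    proof (cases "T \<ge> 0")
      case False
      hence "{0..<T} = {0..<0}" by auto
      thus ?thesis using steps[of 0 j] by (simp add: step_vec_eq_ind_vec)
    qed (simp add: steps)
    ultimately show "abs_L2 (ind_vec j ((UNIV - B) \<inter> {0..<T})) \<in> N"
      using IH complex_vector.subspace_diff[OF N(1)] by simp
  next
    fix B :: "nat \<Rightarrow> real set"
    assume disj: "disjoint_family B" and "range B \<subseteq> sigma_sets UNIV (range lessThan)"
      and IH: "\<And>i. abs_L2 (ind_vec j (B i \<inter> {0..<T})) \<in> N"
    hence B [measurable]: "B i \<in> sets borel" for i
      unfolding borel_Iio by auto
    let ?U = "\<lambda>n. \<Union>i<n. B i"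
    have part: "abs_L2 (ind_vec j (?U n \<inter> {0..<T})) \<in> N" for n
    proof (induction n)
      case 0
      show ?case
        using complex_vector.subspace_0[OF N(1)] by (simp add: ind_vec_def[abs_def] zero_L2.abs_eq[symmetric])
    next
      case (Suc n)
      have "x \<notin> B n" if "x \<in> B i" "i < n" for x i
        using disjoint_family_onD[OF disj, of i n] that by auto
      hence "ind_vec j (?U (Suc n) \<inter> {0..<T})
          = (\<lambda>x. ind_vec j (?U n \<inter> {0..<T}) x + ind_vec j (B n \<inter> {0..<T}) x)"
        by (auto simp: ind_vec_def fun_eq_iff less_Suc_eq)
      hence "abs_L2 (ind_vec j (?U (Suc n) \<inter> {0..<T}))
          = abs_L2 (ind_vec j (?U n \<inter> {0..<T})) + abs_L2 (ind_vec j (B n \<inter> {0..<T}))"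
        by (simp only:) (intro abs_L2_add sq B sets.finite_UN; simp)
      thus ?case using Suc IH complex_vector.subspace_add[OF N(1)] by simp
    qed
    have "(\<lambda>n. abs_L2 (ind_vec j (?U n \<inter> {0..<T}))) \<longlonglongrightarrow> abs_L2 (ind_vec j (\<Union>(range B) \<inter> {0..<T}))"
    proof (rule L2_dominated_convergence)
      show "integrable half_line (indicator {0..<T} :: real \<Rightarrow> real)"
        by (rule integrable_indicator_half_line[OF _ emeasure_half_line_bounded[OF _ order.refl]])
           simp_all
      show "(norm (ind_vec j (?U n \<inter> {0..<T}) x - ind_vec j (\<Union>(range B) \<inter> {0..<T}) x))\<^sup>2
          \<le> indicator {0..<T} x" for n x
        by (auto simp: ind_vec_def indicator_def norm_axis')
      show "(\<lambda>n. ind_vec j (?U n \<inter> {0..<T}) x) \<longlonglongrightarrow> ind_vec j (\<Union>(range B) \<inter> {0..<T}) x" for x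
      proof (cases "x \<in> \<Union>(range B)")
        case True
        then obtain i where i: "x \<in> B i" by auto
        have "\<forall>\<^sub>F n in sequentially. ind_vec j (?U n \<inter> {0..<T}) x = ind_vec j (\<Union>(range B) \<inter> {0..<T}) x"
          using eventually_gt_at_top[of i] by eventually_elim (use i in \<open>auto simp: ind_vec_def\<close>)
        thus ?thesis by (rule tendsto_eventually)
      qed (auto simp: ind_vec_def)
    qed (auto intro!: sq)
    from closed_sequentially[OF N(2) part this]
    show "abs_L2 (ind_vec j (\<Union>(range B) \<inter> {0..<T})) \<in> N" .
  qed
qed

lemma ind_vec_in_closed_subspace:
  assumes A: "A \<in> sets half_line" "emeasure half_line A < \<infinity>"
  shows "abs_L2 (ind_vec j A) \<in> N"
proof -
  have A0: "A \<in> sets borel" "A \<inter> {0..} = A"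
    using sets_half_line_borel[OF A(1)] sets.sets_into_space[OF A(1)] unfolding space_half_line
    by auto
  have "(\<lambda>n. abs_L2 (ind_vec j (A \<inter> {0..<real n}))) \<longlonglongrightarrow> abs_L2 (ind_vec j A)"
  proof (rule L2_dominated_convergence)
    show "square_integrable (ind_vec j (A \<inter> {0..<real n}))" for n
      using A0 by (intro square_integrable_ind_vec emeasure_half_line_bounded[of _ "real n"]) auto
    show "square_integrable (ind_vec j A)"
      using A A0 by (intro square_integrable_ind_vec) auto
    show "integrable half_line (indicator A :: real \<Rightarrow> real)"
      using A A0 by (intro integrable_indicator_half_line) auto
    show "(norm (ind_vec j (A \<inter> {0..<real n}) x - ind_vec j A x))\<^sup>2 \<le> indicator A x" for n x
      by (auto simp: ind_vec_def indicator_def norm_axis')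
    show "(\<lambda>n. ind_vec j (A \<inter> {0..<real n}) x) \<longlonglongrightarrow> ind_vec j A x" if "x \<ge> 0" for x
    proof -
      obtain m where m: "x < real m" using reals_Archimedean2 by blast
      have "\<forall>\<^sub>F n in sequentially. ind_vec j (A \<inter> {0..<real n}) x = ind_vec j A x"
        using eventually_ge_at_top[of m] by eventually_elim (use m that in \<open>auto simp: ind_vec_def\<close>)
      thus ?thesis by (rule tendsto_eventually)
    qed
  qed
  from closed_sequentially[OF N(2) bounded_ind_vec_in_closed_subspace[OF A0(1)] this]
  show ?thesis .
qed

lemma simple_function_in_closed_subspace:
  assumes s: "simple_function half_line s" and sq: "square_integrable s"
  shows "abs_L2 s \<in> N"
proof -
  define R where "R = s ` {0..} - {0}"
  define A where "A y = s -` {y} \<inter> {0..}" for y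
  have R: "finite R" using simple_functionD(1)[OF s] by (simp add: R_def space_half_line)
  have A: "A y \<in> sets half_line" for y
    using simple_functionD(2)[OF s, of "{y}"] by (simp add: A_def space_half_line)
  have fin: "emeasure half_line (A y) < \<infinity>" if "y \<in> R" for y
  proof -
    have y: "norm y > 0" using that by (simp add: R_def)
    have "integrable half_line (\<lambda>x. (norm (s x))\<^sup>2 / (norm y)\<^sup>2)"
      using sq by (simp add: square_integrable_def)
    hence "integrable half_line (indicator (A y) :: real \<Rightarrow> real)"
    proof (rule Bochner_Integration.integrable_bound)
      show "AE x in half_line. norm (indicator (A y) x :: real) \<le> norm ((norm (s x))\<^sup>2 / (norm y)\<^sup>2)"
        using y by (intro AE_I2) (auto simp: A_def indicator_def)
    qed (use A in measurable)
    moreover have "A y \<inter> space half_line = A y" by (auto simp: A_def space_half_line)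
    ultimately show ?thesis by (simp add: integrable_indicator_iff)
  qed
  have sqA: "square_integrable (ind_vec j (A y))" if "y \<in> R" for j and y
    using A[of y] fin[OF that] by (intro square_integrable_ind_vec)
      (auto simp: sets_half_line_borel A_def Int_assoc)
  have "abs_L2 s = abs_L2 (\<lambda>x. \<Sum>y\<in>R. \<Sum>j\<in>UNIV. (y $ j) *s ind_vec j (A y) x)"
  proof (rule abs_L2_eqI)
    show "s x = (\<Sum>y\<in>R. \<Sum>j\<in>UNIV. (y $ j) *s ind_vec j (A y) x)" if x: "x \<ge> 0" for x
    proof -
      have *: "(\<Sum>j\<in>UNIV. (y $ j) *s ind_vec j (A y) x) = (if s x = y then y else 0)" for y
        using x basis_expansion[of y] by (cases "s x = y") (simp_all add: A_def ind_vec_def)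
      have "(\<Sum>y\<in>R. if s x = y then y else 0) = (if s x \<in> R then s x else 0)"
        using R by simp
      moreover have "s x \<in> R \<or> s x = 0" using x by (auto simp: R_def)
      ultimately show ?thesis by (auto simp: *)
    qed
  qed (auto intro!: sq square_integrable_sum square_integrable_scaleC sqA)
  also have "\<dots> = (\<Sum>y\<in>R. \<Sum>j\<in>UNIV. (y $ j) *\<^sub>C abs_L2 (ind_vec j (A y)))"
    by (simp add: abs_L2_sum abs_L2_scaleC square_integrable_sum square_integrable_scaleC sqA)
  also have "\<dots> \<in> N"
    by (intro complex_vector.subspace_sum complex_vector.subspace_scale N
        ind_vec_in_closed_subspace A fin)
  finally show ?thesis .
qed

lemma closed_subspace_eq_UNIV: "N = UNIV"
proof -
  have "g \<in> N" for g
  proof (induct g rule: L2.abs_induct)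
    case (1 f)
    hence f: "square_integrable f" by (simp add: L2_rel_refl)
    hence "f \<in> borel_measurable half_line" by (simp add: square_integrable_def)
    then obtain F where F: "\<And>i. simple_function half_line (F i)"
      "\<And>x. x \<in> space half_line \<Longrightarrow> (\<lambda>i. F i x) \<longlonglongrightarrow> f x"
      "\<And>i x. x \<in> space half_line \<Longrightarrow> dist (F i x) 0 \<le> 2 * dist (f x) 0"
      using borel_measurable_implies_sequence_metric[of f half_line 0] by blast
    have w: "integrable half_line (\<lambda>x. 9 * (norm (f x))\<^sup>2)"
      using f by (simp add: square_integrable_def)
    have Fsq: "square_integrable (F i)" for i
    proof (rule square_integrable_bound_on[OF w])
      show "F i \<in> borel_measurable half_line"
        by (rule borel_measurable_simple_function[OF F(1)])
      show "(norm (F i x))\<^sup>2 \<le> 9 * (norm (f x))\<^sup>2" if "x \<ge> 0" for x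
      proof -
        have "(norm (F i x))\<^sup>2 \<le> 4 * (norm (f x))\<^sup>2"
          using power_mono[OF F(3)[of x i], of 2] that
          by (simp add: space_half_line power_mult_distrib)
        also have "\<dots> \<le> 9 * (norm (f x))\<^sup>2" by simp
        finally show ?thesis .
      qed
    qed
    have "(\<lambda>i. abs_L2 (F i)) \<longlonglongrightarrow> abs_L2 f"
    proof (rule L2_dominated_convergence[OF Fsq f w])
      show "(norm (F i x - f x))\<^sup>2 \<le> 9 * (norm (f x))\<^sup>2" if "x \<ge> 0" for i x
      proof -
        have "norm (F i x - f x) \<le> 3 * norm (f x)"
          using norm_triangle_ineq4[of "F i x" "f x"] F(3)[of x i] that by (simp add: space_half_line)
        from power_mono[OF this, of 2] show ?thesis by (simp add: power_mult_distrib)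
      qed
    qed (use F in \<open>auto simp: space_half_line\<close>)
    from closed_sequentially[OF N(2) simple_function_in_closed_subspace[OF F(1) Fsq] this]
    show "abs_L2 f \<in> N" .
  qed
  thus ?thesis by blast
qed

end

lemma step_vec_append:
  assumes "a \<le> b" "b \<le> c" shows "step_vec j a c = step_vec j a b + step_vec j b c"
proof -
  have "ind_vec j {a..<c} = (\<lambda>x. ind_vec j {a..<b} x + ind_vec j {b..<c} x)"
    using assms by (auto simp: ind_vec_def fun_eq_iff)
  thus ?thesis by (simp add: step_vec_eq_ind_vec abs_L2_add square_integrable_step)
qed

lemma cinner_step_vec_eq_0:
  assumes "i \<noteq> j \<or> b \<le> c \<or> d \<le> a"
  shows "cinner (step_vec i a b) (step_vec j c d) = 0"
proof -
  have "cdot (ind_vec i {a..<b} x) (ind_vec j {c..<d} x) = 0" for x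
    unfolding cdot_def by (rule sum.neutral) (use assms in \<open>auto simp: ind_vec_def axis_def\<close>)
  thus ?thesis
    unfolding step_vec_eq_ind_vec
    by (subst cinner_L2.abs_eq) (auto simp: L2_rel_refl square_integrable_step)
qed

lemma norm_step_vec:
  assumes "0 \<le> a" "a \<le> b" shows "norm (step_vec j a b) = sqrt (b - a)"
proof -
  have "(indicator {a..<b} x :: real)\<^sup>2 = indicator {a..<b} x" for x
    by (simp add: indicator_def)
  hence "(norm (step_vec j a b))\<^sup>2 = measure half_line ({a..<b} \<inter> space half_line)"
    by (simp add: step_vec_eq_ind_vec norm_abs_L2 square_integrable_step norm_ind_vec)
  also have "{a..<b} \<inter> space half_line = {a..<b}" using assms by (auto simp: space_half_line)
  also have "measure half_line {a..<b} = measure lborel {a..<b}"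
    using assms by (intro measure_restrict_space) auto
  also have "\<dots> = b - a" using assms by simp
  finally show ?thesis using assms by (metis norm_ge_zero real_sqrt_unique)
qed

lemma norm_step_vec_diff:
  assumes "0 \<le> s" "s \<le> t"
  shows "norm (step_vec j 0 t - step_vec j 0 s) = sqrt (t - s)"
  using step_vec_append[of 0 s t j] norm_step_vec[of s t j] assms by simp

lemma comp_shift_abs_L2:
  "square_integrable g \<Longrightarrow>
    comp_shift i j t (abs_L2 g) = abs_L2 (\<lambda>x. if 0 \<le> x \<and> x < t then axis j (g x $ i) else 0)"
  by (subst comp_shift.abs_eq) (auto simp: L2_rel_refl)

lemma square_integrable_comp_shift:
  fixes f :: "real \<Rightarrow> complex ^ 'n::finite"
  assumes "square_integrable f"
  shows "square_integrable (\<lambda>x. if 0 \<le> x \<and> x < t then axis j (f x $ i) else 0 :: complex ^ 'n)"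
proof (rule square_integrable_bound[OF assms, where C = 1])
  have f [measurable]: "f \<in> borel_measurable half_line"
    using assms by (simp add: square_integrable_def)
  have "{x \<in> space half_line. 0 \<le> x \<and> x < t} = {0..<t}"
    by (auto simp: space_half_line)
  hence "{x \<in> space half_line. 0 \<le> x \<and> x < t} \<in> sets half_line"
    by (subst sets_restrict_space_iff) auto
  thus "(\<lambda>x. if 0 \<le> x \<and> x < t then axis j (f x $ i) else 0 :: complex ^ 'n) \<in> borel_measurable half_line"
    by (intro measurable_If borel_measurable_axis borel_measurable_vec_nth' f) simp
qed (auto simp: norm_axis' Finite_Cartesian_Product.norm_nth_le)

lemma norm_comp_shift_le: "norm (comp_shift i j t g) \<le> norm g"
proof (induct g rule: L2.abs_induct)
  case (1 f)
  hence f: "square_integrable f" by (simp add: L2_rel_refl)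
  show ?case
  proof (rule power2_le_imp_le)
    show "(norm (comp_shift i j t (abs_L2 f)))\<^sup>2 \<le> (norm (abs_L2 f))\<^sup>2"
      unfolding comp_shift_abs_L2[OF f] norm_abs_L2[OF f] norm_abs_L2[OF square_integrable_comp_shift[OF f]]
    proof (rule integral_mono)
      show "(norm (if 0 \<le> x \<and> x < t then axis j (f x $ i) else 0 :: complex ^ 'a))\<^sup>2 \<le> (norm (f x))\<^sup>2" for x
        by (auto simp: norm_axis' intro!: power_mono Finite_Cartesian_Product.norm_nth_le)
    qed (use f square_integrable_comp_shift[OF f] in \<open>simp_all add: square_integrable_def\<close>)
  qed simp
qed

lemma bounded_clinear_comp_shift: "bounded_clinear (comp_shift i j t)"
proof (rule bounded_clinearI[where C = 1])
  show "comp_shift i j t (x + y) = comp_shift i j t x + comp_shift i j t y" for x y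
  proof (induct x rule: L2.abs_induct)
    case (1 f)
    hence f: "square_integrable f" by (simp add: L2_rel_refl)
    show ?case
    proof (induct y rule: L2.abs_induct)
      case (1 g)
      hence g: "square_integrable g" by (simp add: L2_rel_refl)
      have "(\<lambda>x. if 0 \<le> x \<and> x < t then axis j ((f x + g x) $ i) else 0)
        = (\<lambda>x. (if 0 \<le> x \<and> x < t then axis j (f x $ i) else 0)
          + (if 0 \<le> x \<and> x < t then axis j (g x $ i) else 0))"
        by (auto simp: fun_eq_iff vec_eq_iff axis_def)
      thus ?case
        using f g by (simp add: comp_shift_abs_L2 square_integrable_add square_integrable_comp_shift
            flip: abs_L2_add)
    qed
  qed
  show "comp_shift i j t (c *\<^sub>C x) = c *\<^sub>C comp_shift i j t x" for c x
  proof (induct x rule: L2.abs_induct)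
    case (1 f)
    hence f: "square_integrable f" by (simp add: L2_rel_refl)
    have "(\<lambda>x. if 0 \<le> x \<and> x < t then axis j ((c *s f x) $ i) else 0)
      = (\<lambda>x. c *s (if 0 \<le> x \<and> x < t then axis j (f x $ i) else 0))"
      by (auto simp: fun_eq_iff vec_eq_iff axis_def)
    thus ?case
      using f by (simp add: comp_shift_abs_L2 square_integrable_scaleC square_integrable_comp_shift
          flip: abs_L2_scaleC)
  qed
qed (simp add: norm_comp_shift_le)

lemma comp_shift_step_vec:
  assumes "0 \<le> a"
  shows "comp_shift i j t (step_vec l a b) = (if l = i then step_vec j a (min t b) else 0)"
proof -
  have "(\<lambda>x. if 0 \<le> x \<and> x < t then axis j (ind_vec l {a..<b} x $ i) else 0)
      = (if l = i then ind_vec j {a..<min t b} else (\<lambda>_. 0))"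
    using assms by (auto simp: fun_eq_iff vec_eq_iff axis_def ind_vec_def)
  thus ?thesis
    by (simp add: step_vec_eq_ind_vec comp_shift_abs_L2 square_integrable_step zero_L2.abs_eq[symmetric])
qed

lemma creation_tendsto:
  fixes f :: "nat \<Rightarrow> 'a::complex_inner"
  assumes f: "f \<longlonglongrightarrow> g" and x: "x \<longlonglongrightarrow> y"
  shows "(\<lambda>n. creation (f n) (x n)) \<longlonglongrightarrow> creation g y"
proof -
  have "(\<lambda>n. creation (f n - g) (x n)) \<longlonglongrightarrow> 0"
  proof (rule tendsto_norm_zero_cancel)
    have "(\<lambda>n. norm (f n - g) * norm (x n)) \<longlonglongrightarrow> norm (g - g) * norm y"
      by (intro tendsto_intros f x)
    thus "(\<lambda>n. norm (creation (f n - g) (x n))) \<longlonglongrightarrow> 0" by (simp add: norm_creation)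
  qed
  from tendsto_add[OF this bounded_clinear_tendsto[OF bounded_clinear_creation x, of g]]
  show ?thesis by (simp add: bounded_clinear_diff[OF bounded_clinear_creation_left])
qed

lemma annihilation_tendsto:
  fixes f :: "nat \<Rightarrow> 'a::complex_inner"
  assumes f: "f \<longlonglongrightarrow> g" and x: "x \<longlonglongrightarrow> y"
  shows "(\<lambda>n. annihilation (f n) (x n)) \<longlonglongrightarrow> annihilation g y"
proof -
  have "(\<lambda>n. annihilation (f n - g) (x n)) \<longlonglongrightarrow> 0"
  proof (rule Lim_null_comparison)
    have "(\<lambda>n. norm (f n - g) * norm (x n)) \<longlonglongrightarrow> norm (g - g) * norm y"
      by (intro tendsto_intros f x)
    thus "(\<lambda>n. norm (f n - g) * norm (x n)) \<longlonglongrightarrow> 0" by simp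
  qed (simp add: norm_annihilation_le)
  from tendsto_add[OF this bounded_clinear_tendsto[OF bounded_clinear_annihilation x, of g]]
  show ?thesis by (simp add: annihilation_diff_left)
qed

section \<open>The toy Fock space of a partition\<close>

lemma all_nat_split: "(\<forall>m::nat. Q m) \<longleftrightarrow> Q 0 \<and> (\<forall>m. Q (Suc m))"
  by (metis not0_implies_Suc)

lemma adapted_Cons: "adapted ((k, j) # \<sigma>) \<longleftrightarrow> adapted \<sigma> \<and> not_start k \<sigma>"
proof -
  have "adapted ((k, j) # \<sigma>) \<longleftrightarrow> (Suc 0 < length ((k, j) # \<sigma>) \<longrightarrow> k \<noteq> fst (\<sigma> ! 0)) \<and> adapted \<sigma>"
    unfolding adapted_def using all_nat_split[of "\<lambda>m. Suc m < length ((k, j) # \<sigma>) \<longrightarrow> fst (((k, j) # \<sigma>) ! m) \<noteq> fst (((k, j) # \<sigma>) ! Suc m)"]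
    by simp
  moreover have "(Suc 0 < length ((k, j) # \<sigma>) \<longrightarrow> k \<noteq> fst (\<sigma> ! 0)) \<longleftrightarrow> not_start k \<sigma>"
    by (cases \<sigma>) (auto simp: not_start_def)
  ultimately show ?thesis by blast
qed

lemma adapted_Nil: "adapted []"
  by (simp add: adapted_def)

lemma adapted_put: "adapted \<sigma> \<Longrightarrow> not_start k \<sigma> \<Longrightarrow> adapted (put k l \<sigma>)"
  by (cases l) (auto simp: adapted_Cons)

lemma adapted_eq_put:
  assumes "adapted \<tau>"
  obtains l \<sigma> where "adapted \<sigma>" "not_start k \<sigma>" "\<tau> = put k l \<sigma>"
proof (cases "not_start k \<tau>")
  case False
  then obtain j \<sigma> where "\<tau> = (k, j) # \<sigma>"
    by (cases \<tau>) (auto simp: not_start_def)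
  thus ?thesis using assms that[of \<sigma> "Some j"] by (simp add: adapted_Cons)
qed (use assms that[of \<tau> None] in simp)

lemma subspace_toy_fock: "complex_vector.subspace (toy_fock p)"
  unfolding toy_fock_def by (intro csubspace_closure complex_vector.subspace_span)

lemma closed_toy_fock: "closed (toy_fock p)"
  by (simp add: toy_fock_def)

lemmas toy_fock_subspace = subspace_toy_fock closed_toy_fock

lemma toy_word_in_toy_fock: "adapted \<sigma> \<Longrightarrow> toy_word p \<sigma> \<in> toy_fock p"
  unfolding toy_fock_def
  by (rule subsetD[OF closure_subset]) (auto intro: complex_vector.span_base)

lemma toy_fock_induct:
  assumes "bounded_clinear A" "complex_vector.subspace N" "closed N"
    and "\<And>\<sigma>. adapted \<sigma> \<Longrightarrow> A (toy_word p \<sigma>) \<in> N" and "\<phi> \<in> toy_fock p"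
  shows "A \<phi> \<in> N"
  using assms(4,5) unfolding toy_fock_def
  by (elim bounded_clinear_closure_cspan[OF assms(1-3), rotated]) auto

lemma toy_operator_eqI:
  fixes A B :: "'n::finite L2 fock \<Rightarrow> 'n L2 fock"
  assumes A: "bounded_clinear A" and B: "bounded_clinear B"
    and eq: "\<And>\<sigma>. adapted \<sigma> \<Longrightarrow> A (toy_word p \<sigma>) = B (toy_word p \<sigma>)"
    and orth: "\<And>\<psi>. (\<forall>\<phi>\<in>toy_fock p. cinner \<phi> \<psi> = 0) \<Longrightarrow> A \<psi> = B \<psi>"
  shows "A = B"
proof
  fix \<psi>
  let ?P = "orth_proj (toy_fock p)"
  have "A (?P \<psi>) - B (?P \<psi>) \<in> {0}"
    by (rule toy_fock_induct[where p = p, OF bounded_clinear_minus[OF A B]])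
       (auto simp: eq orth_proj_in[OF toy_fock_subspace])
  moreover have "A (\<psi> - ?P \<psi>) = B (\<psi> - ?P \<psi>)"
    by (rule orth) (simp add: orth_proj_orthogonal[OF toy_fock_subspace])
  ultimately show "A \<psi> = B \<psi>"
    by (simp add: bounded_clinear_diff[OF A] bounded_clinear_diff[OF B])
qed

definition site_proj :: "(nat \<Rightarrow> real) \<Rightarrow> nat \<Rightarrow> 'n::finite L2 fock \<Rightarrow> 'n L2 fock" where
  "site_proj p k \<phi> = (\<Sum>l\<in>UNIV. creation (toy_letter p (k, l)) (annihilation (toy_letter p (k, l)) \<phi>))"

lemma bounded_clinear_site_proj: "bounded_clinear (site_proj p k)"
  unfolding site_proj_def[abs_def]
  by (intro bounded_clinear_sum_fun
      bounded_clinear_compose[OF bounded_clinear_creation bounded_clinear_annihilation])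

lemma creation_toy_word:
  "creation (toy_letter p x) (toy_word p \<sigma>) = toy_word p (x # \<sigma>)"
  by (simp add: toy_word_def creation_tensor)

abbreviation (input) toy_proj :: "(nat \<Rightarrow> real) \<Rightarrow> 'n::finite L2 fock \<Rightarrow> 'n L2 fock" where
  "toy_proj p \<equiv> orth_proj (toy_fock p)"

lemmas bounded_clinear_toy_proj = bounded_clinear_orth_proj[OF toy_fock_subspace]

context
  fixes p :: "nat \<Rightarrow> real"
  assumes p: "is_partition p"
begin

lemma partition_0: "p 0 = 0"
  using p by (simp add: is_partition_def)

lemma partition_less_iff: "p k < p l \<longleftrightarrow> k < l"
  using p by (simp add: is_partition_def strict_mono_less)

lemma partition_le_iff: "p k \<le> p l \<longleftrightarrow> k \<le> l"
  using p by (simp add: is_partition_def strict_mono_less_eq)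

lemma partition_nonneg: "0 \<le> p k"
  using partition_le_iff[of 0 k] by (simp add: partition_0)

lemma partition_index:
  assumes "t \<ge> 0"
  obtains K where "{k. p k \<le> t} = {..K}" "p K \<le> t" "t < p (Suc K)"
proof -
  have "t \<in> (\<Union>k. {p k..<p (Suc k)})" using assms p by (simp add: is_partition_def)
  then obtain K where K: "p K \<le> t" "t < p (Suc K)" by auto
  have "p k \<le> t \<longleftrightarrow> k \<le> K" for k
    using K partition_le_iff[of k K] partition_less_iff[of k "Suc K"] by linarith
  with K that show ?thesis by (auto simp: set_eq_iff)
qed

lemma step_vec_eq_toy_letter:
  "step_vec j (p k) (p (Suc k)) = sqrt (p (Suc k) - p k) *\<^sub>R toy_letter p (k, j)"
  using partition_less_iff[of k "Suc k"] by (simp add: toy_letter_def)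

lemma norm_toy_letter: "norm (toy_letter p x) = 1"
  using partition_less_iff[of "fst x" "Suc (fst x)"] partition_nonneg[of "fst x"]
  by (cases x) (simp add: toy_letter_def norm_step_vec)

lemma cinner_toy_letter: "cinner (toy_letter p x) (toy_letter p y) = (if x = y then 1 else 0)"
proof (cases "x = y")
  case True
  thus ?thesis using norm_power2_cinner[of "toy_letter p x"] by (simp add: norm_toy_letter)
next
  case False
  obtain k i l j where xy: "x = (k, i)" "y = (l, j)" by (cases x, cases y)
  have "i \<noteq> j \<or> p (Suc k) \<le> p l \<or> p (Suc l) \<le> p k"
    using False unfolding partition_le_iff xy by auto
  hence "cinner (step_vec i (p k) (p (Suc k))) (step_vec j (p l) (p (Suc l))) = 0"
    by (rule cinner_step_vec_eq_0)
  thus ?thesis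
    using False by (simp add: xy toy_letter_def scaleR_scaleC cinner_scaleC_left cinner_scaleC_right)
qed

lemma cinner_toy_word: "cinner (toy_word p \<sigma>) (toy_word p \<tau>) = (if \<sigma> = \<tau> then 1 else 0)"
proof -
  have "word_inner (map (toy_letter p) \<sigma>) (map (toy_letter p) \<tau>) = (if \<sigma> = \<tau> then 1 else 0)"
    by (induction \<sigma> \<tau> rule: list_induct2') (auto simp: cinner_toy_letter)
  thus ?thesis by (simp add: toy_word_def cinner_tensor)
qed

lemma orth_proj_toy_word:
  "orth_proj (toy_fock p) (toy_word p \<sigma>) = (if adapted \<sigma> then toy_word p \<sigma> else 0)"
proof (cases "adapted \<sigma>")
  case False
  have "toy_fock p \<subseteq> {z. cinner (toy_word p \<sigma>) z = 0}"
    unfolding toy_fock_def using False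
    by (intro closure_cspan_subset subspace_orthogonal closed_orthogonal)
       (auto simp: cinner_toy_word)
  hence "cinner z (toy_word p \<sigma>) = 0" if "z \<in> toy_fock p" for z
    using that cinner_commute[of z "toy_word p \<sigma>"] by auto
  with False show ?thesis by (simp add: orth_proj_eq_0[OF toy_fock_subspace])
qed (simp add: orth_proj_ident[OF toy_fock_subspace] toy_word_in_toy_fock)

lemma annihilation_toy_word:
  "annihilation (toy_letter p x) (toy_word p \<sigma>)
    = (if \<sigma> \<noteq> [] \<and> hd \<sigma> = x then toy_word p (tl \<sigma>) else 0)"
  by (cases \<sigma>) (auto simp: toy_word_def annihilation_vacuum annihilation_tensor_Cons
      cinner_toy_letter scaleC_one)

lemma site_proj_toy_word:
  "site_proj p k (toy_word p \<sigma>) = (if not_start k \<sigma> then 0 else toy_word p \<sigma>)"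
proof (cases "not_start k \<sigma>")
  case True
  thus ?thesis
    unfolding site_proj_def
    by (auto simp: annihilation_toy_word not_start_def bounded_clinear_zero[OF bounded_clinear_creation]
        intro!: sum.neutral)
next
  case False
  then obtain j \<tau> where \<sigma>: "\<sigma> = (k, j) # \<tau>" by (cases \<sigma>) (auto simp: not_start_def)
  have "creation (toy_letter p (k, l)) (annihilation (toy_letter p (k, l)) (toy_word p \<sigma>))
      = (if l = j then toy_word p \<sigma> else 0)" for l
    by (auto simp: annihilation_toy_word \<sigma> creation_toy_word bounded_clinear_zero[OF bounded_clinear_creation])
  thus ?thesis using False by (simp add: site_proj_def)
qed

lemma norm_site_proj:
  "(norm (site_proj p k \<phi>))\<^sup>2 = (\<Sum>l\<in>UNIV. (norm (annihilation (toy_letter p (k, l)) \<phi>))\<^sup>2)"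
  unfolding site_proj_def
  by (subst norm_sum_creation) (auto simp: cinner_toy_letter norm_toy_letter)

lemma sum_norm_site_proj_le: "finite I \<Longrightarrow> (\<Sum>k\<in>I. (norm (site_proj p k \<phi>))\<^sup>2) \<le> (norm \<phi>)\<^sup>2"
  using annihilation_Bessel[of "I \<times> UNIV" "toy_letter p" \<phi>]
  by (simp add: norm_site_proj sum.cartesian_product cinner_toy_letter norm_toy_letter)

lemma cinner_site_proj: "k \<noteq> l \<Longrightarrow> cinner (site_proj p k \<phi>) (site_proj p l \<psi>) = 0"
  by (simp add: site_proj_def cinner_sum_left cinner_sum_right cinner_creation cinner_toy_letter)

lemma norm_weighted_site_proj_le:
  assumes I: "finite I" and m: "\<And>k. k \<in> I \<Longrightarrow> \<bar>c k\<bar> \<le> m" "m \<ge> 0"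
  shows "norm (\<Sum>k\<in>I. c k *\<^sub>R site_proj p k \<phi>) \<le> m * norm \<phi>"
proof (rule power2_le_imp_le)
  have "(norm (\<Sum>k\<in>I. c k *\<^sub>R site_proj p k \<phi>))\<^sup>2 = (\<Sum>k\<in>I. (c k)\<^sup>2 * (norm (site_proj p k \<phi>))\<^sup>2)"
    by (subst norm_sum_orthogonal[OF I])
       (auto simp: scaleR_scaleC cinner_scaleC_left cinner_scaleC_right cinner_site_proj norm_scaleC
         power_mult_distrib)
  also have "\<dots> \<le> (\<Sum>k\<in>I. m\<^sup>2 * (norm (site_proj p k \<phi>))\<^sup>2)"
    using m by (intro sum_mono mult_right_mono) (auto simp: abs_le_square_iff[symmetric])
  also have "\<dots> \<le> (m * norm \<phi>)\<^sup>2"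
    using mult_left_mono[OF sum_norm_site_proj_le[OF I, of \<phi>], of "m\<^sup>2"]
    by (simp add: sum_distrib_left power_mult_distrib)
  finally show "(norm (\<Sum>k\<in>I. c k *\<^sub>R site_proj p k \<phi>))\<^sup>2 \<le> (m * norm \<phi>)\<^sup>2" .
qed (simp add: m)

lemma sum_step_vec: "(\<Sum>k\<le>K. step_vec j (p k) (p (Suc k))) = step_vec j 0 (p (Suc K))"
proof (induction K)
  case (Suc K)
  have "p (Suc K) \<le> p (Suc (Suc K))" by (simp only: partition_le_iff)
  with Suc show ?case by (simp add: step_vec_append[OF partition_nonneg])
qed (simp add: partition_0)

lemma sum_toy_letter:
  "(\<Sum>k\<le>K. sqrt (p (Suc k) - p k) *\<^sub>R toy_letter p (k, j)) = step_vec j 0 (p (Suc K))"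
  by (simp only: sum_step_vec flip: step_vec_eq_toy_letter)

lemma creation_step_vec:
  "creation (step_vec j 0 (p (Suc K))) \<phi>
    = (\<Sum>k\<le>K. sqrt (p (Suc k) - p k) *\<^sub>R creation (toy_letter p (k, j)) \<phi>)"
  by (simp add: bounded_clinear_sum[OF bounded_clinear_creation_left]
      bounded_clinear_scaleR[OF bounded_clinear_creation_left] flip: sum_toy_letter)

lemma annihilation_step_vec:
  "annihilation (step_vec j 0 (p (Suc K))) \<phi>
    = (\<Sum>k\<le>K. sqrt (p (Suc k) - p k) *\<^sub>R annihilation (toy_letter p (k, j)) \<phi>)"
  by (simp add: annihilation_sum_left annihilation_scaleR_left flip: sum_toy_letter)

text \<open>
  Creation leads out of the toy Fock space only through the words with two equal leading sites;
  removing them costs the square root of the mesh.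
\<close>

definition diagonal_part :: "'n::finite \<Rightarrow> nat \<Rightarrow> 'n L2 fock \<Rightarrow> 'n L2 fock" where
  "diagonal_part j K \<phi> =
     (\<Sum>k\<le>K. creation (step_vec j (p k) (p (Suc k))) (site_proj p k \<phi>))"

lemma creation_minus_diagonal_part:
  assumes "\<phi> \<in> toy_fock p"
  shows "creation (step_vec j 0 (p (Suc K))) \<phi> - diagonal_part j K \<phi> \<in> toy_fock p"
proof (rule toy_fock_induct[OF _ toy_fock_subspace _ assms])
  show "bounded_clinear (\<lambda>\<phi>. creation (step_vec j 0 (p (Suc K))) \<phi> - diagonal_part j K \<phi>)"
    unfolding diagonal_part_def
    by (intro bounded_clinear_minus bounded_clinear_sum_fun bounded_clinear_creation
        bounded_clinear_compose[OF bounded_clinear_creation bounded_clinear_site_proj])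
  fix \<sigma> :: "(nat \<times> 'a) list" assume \<sigma>: "adapted \<sigma>"
  have "creation (step_vec j 0 (p (Suc K))) (toy_word p \<sigma>) - diagonal_part j K (toy_word p \<sigma>)
      = (\<Sum>k\<le>K. sqrt (p (Suc k) - p k) *\<^sub>R (if not_start k \<sigma> then toy_word p ((k, j) # \<sigma>) else 0))"
    unfolding creation_step_vec diagonal_part_def sum_subtractf[symmetric]
    by (intro sum.cong refl)
       (simp add: site_proj_toy_word step_vec_eq_toy_letter creation_toy_word
         bounded_clinear_scaleR[OF bounded_clinear_creation_left]
         bounded_clinear_zero[OF bounded_clinear_creation])
  also have "\<dots> \<in> toy_fock p"
    using \<sigma> by (intro complex_vector.subspace_sum csubspace_scaleR subspace_toy_fock)
      (auto simp: adapted_Cons complex_vector.subspace_0[OF subspace_toy_fock]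
        intro!: toy_word_in_toy_fock)
  finally show "creation (step_vec j 0 (p (Suc K))) (toy_word p \<sigma>) - diagonal_part j K (toy_word p \<sigma>)
      \<in> toy_fock p" .
qed

lemma norm_diagonal_part_le:
  assumes m: "\<And>k. p (Suc k) - p k \<le> m"
  shows "norm (diagonal_part j K \<phi>) \<le> sqrt m * norm \<phi>"
proof (rule power2_le_imp_le)
  have d: "0 \<le> p (Suc k) - p k" for k using partition_le_iff[of k "Suc k"] by simp
  hence m0: "0 \<le> m" using m order.trans by blast
  have "(norm (diagonal_part j K \<phi>))\<^sup>2 = (\<Sum>k\<le>K. (p (Suc k) - p k) * (norm (site_proj p k \<phi>))\<^sup>2)"
    unfolding diagonal_part_def
    by (subst norm_sum_creation)
       (use d in \<open>auto simp: step_vec_eq_toy_letter norm_toy_letter scaleR_scaleC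
         cinner_scaleC_left cinner_scaleC_right cinner_toy_letter norm_scaleC\<close>)
  also have "\<dots> \<le> (\<Sum>k\<le>K. m * (norm (site_proj p k \<phi>))\<^sup>2)"
    by (intro sum_mono mult_right_mono m) simp
  also have "\<dots> \<le> (sqrt m * norm \<phi>)\<^sup>2"
    using mult_left_mono[OF sum_norm_site_proj_le[of "{..K}" \<phi>] m0] m0
    by (simp add: sum_distrib_left power_mult_distrib)
  finally show "(norm (diagonal_part j K \<phi>))\<^sup>2 \<le> (sqrt m * norm \<phi>)\<^sup>2" .
  show "0 \<le> sqrt m * norm \<phi>" using m0 by simp
qed

lemma disc_op_eqI:
  fixes A :: "'n::finite L2 fock \<Rightarrow> 'n L2 fock"
  assumes A: "bounded_clinear A"
    and val: "\<And>\<sigma> l. adapted \<sigma> \<Longrightarrow> not_start k \<sigma> \<Longrightarrow>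
        A (toy_word p (put k l \<sigma>)) = (if l = i then toy_word p (put k j \<sigma>) else 0)"
    and orth: "\<And>\<psi>. (\<forall>\<phi>\<in>toy_fock p. cinner \<phi> \<psi> = 0) \<Longrightarrow> A \<psi> = 0"
  shows "disc_op p i j k = A"
  unfolding disc_op_def
proof (rule the_equality)
  fix B assume B: "bounded_clinear B \<and> (\<forall>\<sigma> l. adapted \<sigma> \<longrightarrow> not_start k \<sigma> \<longrightarrow>
        B (toy_word p (put k l \<sigma>)) = (if l = i then toy_word p (put k j \<sigma>) else 0)) \<and>
     (\<forall>\<psi>. (\<forall>\<phi>\<in>toy_fock p. cinner \<phi> \<psi> = 0) \<longrightarrow> B \<psi> = 0)"
  show "B = A"
  proof (rule toy_operator_eqI)
    fix \<tau> :: "(nat \<times> 'n) list" assume "adapted \<tau>"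
    then obtain l \<sigma> where "adapted \<sigma>" "not_start k \<sigma>" "\<tau> = put k l \<sigma>" by (rule adapted_eq_put)
    thus "B (toy_word p \<tau>) = A (toy_word p \<tau>)" using B val by simp
  qed (use A B orth in auto)
qed (use assms in auto)

lemma orth_proj_toy_orthogonal: "(\<forall>\<phi>\<in>toy_fock p. cinner \<phi> \<psi> = 0) \<Longrightarrow> toy_proj p \<psi> = 0"
  by (rule orth_proj_eq_0[OF toy_fock_subspace]) blast

lemmas bounded_clinear_disc_forms =
  bounded_clinear_minus[OF bounded_clinear_toy_proj
    bounded_clinear_compose[OF bounded_clinear_site_proj bounded_clinear_toy_proj]]
  bounded_clinear_compose[OF bounded_clinear_toy_proj
    bounded_clinear_compose[OF bounded_clinear_creation bounded_clinear_toy_proj]]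
  bounded_clinear_compose[OF bounded_clinear_annihilation bounded_clinear_toy_proj]
  bounded_clinear_compose[OF bounded_clinear_creation
    bounded_clinear_compose[OF bounded_clinear_annihilation bounded_clinear_toy_proj]]

lemma disc_op_None_Some:
  "disc_op p None (Some j) k = (\<lambda>\<psi>. toy_proj p (creation (toy_letter p (k, j)) (toy_proj p \<psi>)))"
proof (rule disc_op_eqI)
  fix \<sigma> :: "(nat \<times> 'a) list" and l assume "adapted \<sigma>" "not_start k \<sigma>"
  thus "toy_proj p (creation (toy_letter p (k, j)) (toy_proj p (toy_word p (put k l \<sigma>))))
      = (if l = None then toy_word p (put k (Some j) \<sigma>) else 0)"
    by (cases l) (auto simp: orth_proj_toy_word adapted_put creation_toy_word adapted_Cons not_start_def)
qed (rule bounded_clinear_disc_forms, simp add: orth_proj_toy_orthogonal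
    bounded_clinear_zero[OF bounded_clinear_creation] bounded_clinear_zero[OF bounded_clinear_toy_proj])

lemma disc_op_Some_None:
  "disc_op p (Some i) None k = (\<lambda>\<psi>. annihilation (toy_letter p (k, i)) (toy_proj p \<psi>))"
proof (rule disc_op_eqI)
  fix \<sigma> :: "(nat \<times> 'a) list" and l assume "adapted \<sigma>" "not_start k \<sigma>"
  thus "annihilation (toy_letter p (k, i)) (toy_proj p (toy_word p (put k l \<sigma>)))
      = (if l = Some i then toy_word p (put k None \<sigma>) else 0)"
    by (cases l) (auto simp: orth_proj_toy_word adapted_put annihilation_toy_word adapted_Cons not_start_def)
qed (rule bounded_clinear_disc_forms, simp add: orth_proj_toy_orthogonal
    bounded_clinear_zero[OF bounded_clinear_annihilation])

lemma disc_op_Some_Some: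
  "disc_op p (Some i) (Some j) k
    = (\<lambda>\<psi>. creation (toy_letter p (k, j)) (annihilation (toy_letter p (k, i)) (toy_proj p \<psi>)))"
proof (rule disc_op_eqI)
  fix \<sigma> :: "(nat \<times> 'a) list" and l assume "adapted \<sigma>" "not_start k \<sigma>"
  thus "creation (toy_letter p (k, j)) (annihilation (toy_letter p (k, i)) (toy_proj p (toy_word p (put k l \<sigma>))))
      = (if l = Some i then toy_word p (put k (Some j) \<sigma>) else 0)"
    by (cases l) (auto simp: orth_proj_toy_word adapted_put annihilation_toy_word adapted_Cons
        not_start_def creation_toy_word bounded_clinear_zero[OF bounded_clinear_creation])
qed (rule bounded_clinear_disc_forms, simp add: orth_proj_toy_orthogonal
    bounded_clinear_zero[OF bounded_clinear_annihilation]
    bounded_clinear_zero[OF bounded_clinear_creation])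

lemma disc_op_None_None:
  "disc_op p None None k = (\<lambda>\<psi>. toy_proj p \<psi> - site_proj p k (toy_proj p \<psi>))"
proof (rule disc_op_eqI)
  fix \<sigma> :: "(nat \<times> 'a) list" and l assume "adapted \<sigma>" "not_start k \<sigma>"
  thus "toy_proj p (toy_word p (put k l \<sigma>)) - site_proj p k (toy_proj p (toy_word p (put k l \<sigma>)))
      = (if l = None then toy_word p (put k None \<sigma>) else 0)"
    by (cases l) (auto simp: orth_proj_toy_word adapted_put site_proj_toy_word adapted_Cons not_start_def)
qed (rule bounded_clinear_disc_forms, simp add: orth_proj_toy_orthogonal
    bounded_clinear_zero[OF bounded_clinear_site_proj])

lemma bounded_clinear_disc_op: "bounded_clinear (disc_op p i j k)"
  by (cases i; cases j)
     (simp_all add: disc_op_None_None disc_op_None_Some disc_op_Some_None disc_op_Some_Some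
       bounded_clinear_disc_forms)

lemma gauge_comp_shift_eq_sum:
  "gauge (comp_shift i j (p (Suc K))) (toy_proj p \<psi>)
    = (\<Sum>k\<le>K. creation (toy_letter p (k, j)) (annihilation (toy_letter p (k, i)) (toy_proj p \<psi>)))"
proof -
  let ?A = "gauge (comp_shift i j (p (Suc K)))"
  let ?B = "\<lambda>\<psi>. \<Sum>k\<le>K. creation (toy_letter p (k, j)) (annihilation (toy_letter p (k, i)) \<psi>)"
  have le: "norm (comp_shift i j (p (Suc K)) e) \<le> 1 * norm e" for e
    by (simp add: norm_comp_shift_le)
  note gauge = bounded_clinear_gauge[OF bounded_clinear_comp_shift le]
    gauge_vacuum[OF bounded_clinear_comp_shift le] gauge_tensor_Cons[OF bounded_clinear_comp_shift le]
  have B: "bounded_clinear ?B"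
    by (intro bounded_clinear_sum_fun bounded_clinear_compose[OF bounded_clinear_creation]
        bounded_clinear_annihilation)
  have "?A (toy_proj p \<psi>) - ?B (toy_proj p \<psi>) \<in> {0}"
  proof (rule toy_fock_induct[OF bounded_clinear_minus[OF gauge(1) B]])
    fix \<sigma> :: "(nat \<times> 'a) list"
    show "?A (toy_word p \<sigma>) - ?B (toy_word p \<sigma>) \<in> {0}"
    proof (cases \<sigma>)
      case Nil
      thus ?thesis
        by (simp add: gauge toy_word_def annihilation_vacuum bounded_clinear_zero[OF bounded_clinear_creation])
    next
      case (Cons x \<tau>)
      obtain k l where x: "x = (k, l)" by (cases x)
      have shift: "comp_shift i j (p (Suc K)) (toy_letter p (k, l))
          = (if l = i \<and> k \<le> K then toy_letter p (k, j) else 0)"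
      proof (cases "k \<le> K")
        case True
        hence "min (p (Suc K)) (p (Suc k)) = p (Suc k)" by (simp add: min_def partition_le_iff)
        thus ?thesis
          using True by (simp add: toy_letter_def bounded_clinear_scaleR[OF bounded_clinear_comp_shift]
              comp_shift_step_vec partition_nonneg)
      next
        case False
        hence "p (Suc K) \<le> p k" by (simp add: partition_le_iff)
        moreover have "p k \<le> p (Suc k)" by (simp add: partition_le_iff)
        ultimately have "step_vec j (p k) (min (p (Suc K)) (p (Suc k))) = 0"
          by (simp add: step_vec_eq_ind_vec ind_vec_def[abs_def] zero_L2.abs_eq[symmetric])
        thus ?thesis
          using False by (simp add: toy_letter_def bounded_clinear_scaleR[OF bounded_clinear_comp_shift]
              comp_shift_step_vec partition_nonneg)
      qed
      have zero: "tensor (0 # w) = 0" for w :: "'a L2 list"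
        using tensor_Cons_scaleC[of 0 0 w] by simp
      have "?A (toy_word p \<sigma>) = (if l = i \<and> k \<le> K then toy_word p ((k, j) # \<tau>) else 0)"
        by (simp add: Cons x toy_word_def gauge shift zero)
      moreover have "?B (toy_word p \<sigma>)
          = (\<Sum>k'\<le>K. if k' = k then (if l = i then toy_word p ((k, j) # \<tau>) else 0) else 0)"
        by (intro sum.cong refl) (auto simp: Cons x annihilation_toy_word creation_toy_word
            bounded_clinear_zero[OF bounded_clinear_creation])
      ultimately show ?thesis by simp
    qed
  qed (auto simp: orth_proj_in[OF toy_fock_subspace])
  thus ?thesis by simp
qed

end

lemma mesh_bound:
  fixes S :: "nat \<Rightarrow> nat \<Rightarrow> real"
  assumes "(\<lambda>n. mesh (S n)) \<longlonglongrightarrow> 0"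
  obtains m where "m \<longlonglongrightarrow> 0" "\<forall>\<^sub>F n in sequentially. \<forall>k. S n (Suc k) - S n k \<le> m n"
proof
  show "(\<lambda>n. enn2real (mesh (S n))) \<longlonglongrightarrow> 0"
    using assms by (intro tendsto_enn2real) simp_all
  have "\<forall>\<^sub>F n in sequentially. mesh (S n) < top"
    using order_tendstoD(2)[OF assms, of top] by simp
  thus "\<forall>\<^sub>F n in sequentially. \<forall>k. S n (Suc k) - S n k \<le> enn2real (mesh (S n))"
  proof eventually_elim
    case (elim n)
    have "ennreal \<bar>S n (Suc k) - S n k\<bar> \<le> mesh (S n)" for k
      unfolding mesh_def by (rule SUP_upper) simp
    hence "\<bar>S n (Suc k) - S n k\<bar> \<le> enn2real (mesh (S n))" for k
      using enn2real_mono[OF _ elim, of "ennreal \<bar>S n (Suc k) - S n k\<bar>"] by simp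
    thus ?case by (meson abs_ge_self order.trans)
  qed
qed

section \<open>Convergence\<close>

lemma step_vec_tendsto:
  assumes "s \<longlonglongrightarrow> t" "0 \<le> t" "\<And>n. t \<le> s n"
  shows "(\<lambda>n. step_vec j 0 (s n)) \<longlonglongrightarrow> step_vec j 0 t"
proof -
  have "(\<lambda>n. sqrt (s n - t)) \<longlonglongrightarrow> sqrt (t - t)" by (intro tendsto_intros assms)
  hence "(\<lambda>n. norm (step_vec j 0 (s n) - step_vec j 0 t)) \<longlonglongrightarrow> 0"
    by (simp add: norm_step_vec_diff assms)
  from tendsto_norm_zero_cancel[OF this] show ?thesis by (simp add: LIM_zero_iff)
qed

lemma comp_shift_tendsto:
  assumes s: "s \<longlonglongrightarrow> t" "0 \<le> t" "\<And>n. t \<le> s n"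
  shows "(\<lambda>n. comp_shift i j (s n) g) \<longlonglongrightarrow> comp_shift i j t g"
proof -
  have bound: "norm (comp_shift i j r e) \<le> 1 * norm e" for r e
    by (simp add: norm_comp_shift_le)
  note converging = bounded_clinear_comp_shift bounded_clinear_comp_shift bound
  have "{g. (\<lambda>n. comp_shift i j (s n) g) \<longlonglongrightarrow> comp_shift i j t g} = UNIV"
  proof (rule closed_subspace_eq_UNIV[OF subspace_converging[OF converging] closed_converging[OF converging]])
    fix l :: 'a and r :: real assume r: "r \<ge> 0"
    have "(\<lambda>n. step_vec j 0 (min (s n) r)) \<longlonglongrightarrow> step_vec j 0 (min t r)"
    proof (rule step_vec_tendsto)
      show "min t r \<le> min (s n) r" for n using s(3)[of n] by (simp add: min_le_iff_disj)
    qed (use s r in \<open>auto intro: tendsto_min\<close>)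
    thus "step_vec l 0 r \<in> {g. (\<lambda>n. comp_shift i j (s n) g) \<longlonglongrightarrow> comp_shift i j t g}"
      by (simp add: comp_shift_step_vec)
  qed
  thus ?thesis by blast
qed

lemma norm_gauge_comp_shift_le: "norm (gauge (comp_shift i j t) \<psi>) \<le> 1 * norm \<psi>"
  by (rule norm_gauge_le[OF bounded_clinear_comp_shift]) (simp_all add: norm_comp_shift_le)

lemma
  shows bounded_clinear_gauge_comp_shift: "bounded_clinear (gauge (comp_shift i j t))"
    and gauge_comp_shift_vacuum: "gauge (comp_shift i j t) (tensor []) = 0"
    and gauge_comp_shift_tensor: "gauge (comp_shift i j t) (tensor (e # w)) = tensor (comp_shift i j t e # w)"
  by (rule bounded_clinear_gauge[OF bounded_clinear_comp_shift, where C = 1]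
      gauge_vacuum[OF bounded_clinear_comp_shift, where C = 1]
      gauge_tensor_Cons[OF bounded_clinear_comp_shift, where C = 1], simp_all add: norm_comp_shift_le)+

lemma gauge_comp_shift_tendsto:
  assumes s: "s \<longlonglongrightarrow> t" "0 \<le> t" "\<And>n. t \<le> s n" and \<phi>: "\<phi> \<longlonglongrightarrow> \<psi>"
  shows "(\<lambda>n. gauge (comp_shift i j (s n)) (\<phi> n)) \<longlonglongrightarrow> gauge (comp_shift i j t) \<psi>"
proof -
  let ?N = "{\<psi>. (\<lambda>n. gauge (comp_shift i j (s n)) \<psi>) \<longlonglongrightarrow> gauge (comp_shift i j t) \<psi>}"
  note converging = bounded_clinear_gauge_comp_shift bounded_clinear_gauge_comp_shift
    norm_gauge_comp_shift_le
  have "tensor w \<in> ?N" for w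
  proof (cases w)
    case (Cons e v)
    have "(\<lambda>n. creation (comp_shift i j (s n) e) (tensor v)) \<longlonglongrightarrow> creation (comp_shift i j t e) (tensor v)"
      by (intro creation_tendsto comp_shift_tendsto s tendsto_const)
    thus ?thesis by (simp add: Cons gauge_comp_shift_tensor creation_tensor)
  qed (simp add: gauge_comp_shift_vacuum)
  hence "closure (cspan (range tensor)) \<subseteq> ?N"
    by (intro closure_cspan_subset subspace_converging[OF converging] closed_converging[OF converging]) auto
  hence 1: "(\<lambda>n. gauge (comp_shift i j (s n)) \<psi>) \<longlonglongrightarrow> gauge (comp_shift i j t) \<psi>"
    using closure_cspan_tensor by blast
  have "(\<lambda>n. gauge (comp_shift i j (s n)) (\<phi> n - \<psi>)) \<longlonglongrightarrow> 0"
  proof (rule Lim_null_comparison)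
    show "\<forall>\<^sub>F n in sequentially. norm (gauge (comp_shift i j (s n)) (\<phi> n - \<psi>)) \<le> 1 * norm (\<phi> n - \<psi>)"
      by (intro always_eventually allI norm_gauge_comp_shift_le)
    show "(\<lambda>n. 1 * norm (\<phi> n - \<psi>)) \<longlonglongrightarrow> 0"
      using \<phi> by (simp add: LIM_zero tendsto_norm_zero)
  qed
  from tendsto_add[OF this 1] show ?thesis
    by (simp add: bounded_clinear_diff[OF bounded_clinear_gauge_comp_shift])
qed

lemma bounded_clinear_cont_op: "bounded_clinear (cont_op i j t)"
  by (cases i; cases j)
     (simp_all add: bounded_clinear_creation bounded_clinear_annihilation
       bounded_clinear_gauge_comp_shift bounded_clinear_scaleR_right[OF bounded_clinear_ident])

context
  fixes S :: "nat \<Rightarrow> nat \<Rightarrow> real"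
  assumes part: "\<And>n. is_partition (S n)"
    and mesh: "(\<lambda>n. mesh (S n)) \<longlonglongrightarrow> 0"
begin

lemma partition_times:
  assumes t: "t \<ge> 0"
  obtains K where "\<And>n. {k. S n k \<le> t} = {..K n}" "\<And>n. t \<le> S n (Suc (K n))"
    "(\<lambda>n. S n (Suc (K n))) \<longlonglongrightarrow> t"
proof -
  have "\<exists>K. {k. S n k \<le> t} = {..K} \<and> S n K \<le> t \<and> t < S n (Suc K)" for n
    using partition_index[OF part t] by metis
  then obtain K where K: "\<And>n. {k. S n k \<le> t} = {..K n}" "\<And>n. S n (K n) \<le> t"
    "\<And>n. t < S n (Suc (K n))" by metis
  obtain m where m: "m \<longlonglongrightarrow> 0" "\<forall>\<^sub>F n in sequentially. \<forall>k. S n (Suc k) - S n k \<le> m n"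
    using mesh_bound[OF mesh] by blast
  have "(\<lambda>n. S n (Suc (K n)) - t) \<longlonglongrightarrow> 0"
  proof (rule Lim_null_comparison[OF _ m(1)])
    show "\<forall>\<^sub>F n in sequentially. norm (S n (Suc (K n)) - t) \<le> m n"
      using m(2)
    proof eventually_elim
      case (elim n)
      hence "S n (Suc (K n)) - S n (K n) \<le> m n" by blast
      thus ?case using K(2,3)[of n] by simp
    qed
  qed
  hence "(\<lambda>n. S n (Suc (K n))) \<longlonglongrightarrow> t" by (simp add: LIM_zero_iff)
  with K(1,3) that show ?thesis by (simp add: less_imp_le)
qed

lemma toy_proj_creation_tendsto:
  assumes t: "t \<ge> 0" and \<psi>: "(\<lambda>n. toy_proj (S n) \<psi>) \<longlonglongrightarrow> \<psi>"
  shows "(\<lambda>n. toy_proj (S n) (creation (step_vec j 0 t) \<psi>)) \<longlonglongrightarrow> creation (step_vec j 0 t) \<psi>"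
proof -
  obtain K where K: "\<And>n. t \<le> S n (Suc (K n))" "(\<lambda>n. S n (Suc (K n))) \<longlonglongrightarrow> t"
    using partition_times[OF t] by metis
  obtain m where m: "m \<longlonglongrightarrow> 0" "\<forall>\<^sub>F n in sequentially. \<forall>k. S n (Suc k) - S n k \<le> m n"
    using mesh_bound[OF mesh] by blast
  define f where "f = creation (step_vec j 0 t) \<psi>"
  define g where "g n = creation (step_vec j 0 (S n (Suc (K n)))) (toy_proj (S n) \<psi>)" for n
  define d where "d n = diagonal_part (S n) j (K n) (toy_proj (S n) \<psi>)" for n
  have g: "g \<longlonglongrightarrow> f"
    unfolding f_def g_def by (intro creation_tendsto step_vec_tendsto K t \<psi>)
  have "(\<lambda>n. f - toy_proj (S n) f) \<longlonglongrightarrow> 0"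
  proof (rule Lim_null_comparison)
    show "\<forall>\<^sub>F n in sequentially. norm (f - toy_proj (S n) f)
        \<le> norm (f - g n) + sqrt (m n) * norm (toy_proj (S n) \<psi>)"
      using m(2)
    proof eventually_elim
      case (elim n)
      have "g n - d n \<in> toy_fock (S n)"
        unfolding g_def d_def
        by (intro creation_minus_diagonal_part part orth_proj_in toy_fock_subspace)
      hence "norm (f - toy_proj (S n) f) \<le> norm (f - (g n - d n))"
        by (rule norm_orth_proj_diff_le[OF toy_fock_subspace])
      also have "\<dots> \<le> norm (f - g n) + norm (d n)"
        using norm_triangle_ineq[of "f - g n" "d n"] by (simp add: algebra_simps)
      also have "norm (d n) \<le> sqrt (m n) * norm (toy_proj (S n) \<psi>)"
        unfolding d_def using elim by (intro norm_diagonal_part_le part) blast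
      finally show ?case by simp
    qed
    have "(\<lambda>n. norm (f - g n) + sqrt (m n) * norm (toy_proj (S n) \<psi>))
        \<longlonglongrightarrow> norm (f - f) + sqrt 0 * norm \<psi>"
      by (intro tendsto_intros g m \<psi>)
    thus "(\<lambda>n. norm (f - g n) + sqrt (m n) * norm (toy_proj (S n) \<psi>)) \<longlonglongrightarrow> 0" by simp
  qed
  from tendsto_diff[OF tendsto_const[of f] this] show ?thesis by (simp add: f_def)
qed

lemma toy_proj_tendsto: "(\<lambda>n. toy_proj (S n) \<psi>) \<longlonglongrightarrow> (\<psi> :: 'n::finite L2 fock)"
proof -
  let ?C = "{\<psi> :: 'n L2 fock. (\<lambda>n. toy_proj (S n) \<psi>) \<longlonglongrightarrow> \<psi>}"
  have bound: "norm (toy_proj (S n) \<psi>) \<le> 1 * norm \<psi>" for n and \<psi> :: "'n L2 fock"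
    by (simp add: norm_orth_proj_le[OF toy_fock_subspace])
  note converging = bounded_clinear_toy_proj bounded_clinear_ident bound
  note C = subspace_converging[OF converging] closed_converging[OF converging]
  have "tensor w \<in> ?C" for w
  proof (induction w)
    case Nil
    have "(tensor [] :: 'n L2 fock) \<in> toy_fock (S n)" for n
      using toy_word_in_toy_fock[OF adapted_Nil, of "S n"] by (simp add: toy_word_def)
    thus ?case by (simp add: orth_proj_ident[OF toy_fock_subspace])
  next
    case (Cons g w)
    have "{g. creation g (tensor w) \<in> ?C} = UNIV"
    proof (rule closed_subspace_eq_UNIV)
      show "complex_vector.subspace {g. creation g (tensor w) \<in> ?C}"
        by (rule csubspace_vimage[OF bounded_clinear_creation_left C(1)])
      show "closed {g. creation g (tensor w) \<in> ?C}"
        by (rule closed_vimage_bounded_clinear[OF bounded_clinear_creation_left C(2)])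
      show "step_vec j 0 t \<in> {g. creation g (tensor w) \<in> ?C}" if "t \<ge> 0" for j t
        using toy_proj_creation_tendsto[OF that, of "tensor w"] Cons.IH by simp
    qed
    thus ?case by (simp add: set_eq_iff creation_tensor)
  qed
  hence "closure (cspan (range tensor)) \<subseteq> ?C" by (intro closure_cspan_subset C) auto
  thus ?thesis using closure_cspan_tensor by blast
qed

lemma toy_proj_tendsto_diagonal:
  assumes "\<phi> \<longlonglongrightarrow> (\<psi> :: 'n::finite L2 fock)"
  shows "(\<lambda>n. toy_proj (S n) (\<phi> n)) \<longlonglongrightarrow> \<psi>"
proof -
  have "(\<lambda>n. toy_proj (S n) (\<phi> n - \<psi>)) \<longlonglongrightarrow> 0"
  proof (rule Lim_null_comparison)
    show "\<forall>\<^sub>F n in sequentially. norm (toy_proj (S n) (\<phi> n - \<psi>)) \<le> norm (\<phi> n - \<psi>)"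
      by (intro always_eventually allI norm_orth_proj_le[OF toy_fock_subspace])
    show "(\<lambda>n. norm (\<phi> n - \<psi>)) \<longlonglongrightarrow> 0" using assms by (simp add: LIM_zero tendsto_norm_zero)
  qed
  from tendsto_add[OF this toy_proj_tendsto[of \<psi>]] show ?thesis
    by (simp add: bounded_clinear_diff[OF bounded_clinear_toy_proj])
qed

lemma disc_op_sum_tendsto:
  fixes i j :: "'n::finite option"
  assumes t: "t \<ge> 0"
  shows "(\<lambda>n. \<Sum>k | S n k \<le> t. ((S n (Suc k) - S n k) powr weight_exp i j) *\<^sub>R disc_op (S n) i j k \<psi>)
    \<longlonglongrightarrow> cont_op i j t \<psi>"
proof -
  obtain K where K: "\<And>n. {k. S n k \<le> t} = {..K n}" "\<And>n. t \<le> S n (Suc (K n))"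
    "(\<lambda>n. S n (Suc (K n))) \<longlonglongrightarrow> t"
    using partition_times[OF t] by metis
  note proj = toy_proj_tendsto[of \<psi>]
  note step = step_vec_tendsto[OF K(3) t K(2)]
  have pos: "S n (Suc k) - S n k > 0" for n k
    using partition_less_iff[OF part, of n k "Suc k"] by simp
  have half: "(S n (Suc k) - S n k) powr (1 / 2) = sqrt (S n (Suc k) - S n k)" for n k
    using pos[of n k] by (simp add: powr_half_sqrt)
  show ?thesis
  proof (cases i; cases j)
    fix j' assume ij: "i = None" "j = Some j'"
    have "(\<Sum>k\<le>K n. sqrt (S n (Suc k) - S n k) *\<^sub>R
          toy_proj (S n) (creation (toy_letter (S n) (k, j')) (toy_proj (S n) \<psi>)))
        = toy_proj (S n) (creation (step_vec j' 0 (S n (Suc (K n)))) (toy_proj (S n) \<psi>))" for n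
      by (simp add: creation_step_vec[OF part] bounded_clinear_sum[OF bounded_clinear_toy_proj]
          bounded_clinear_scaleR[OF bounded_clinear_toy_proj])
    moreover have "(\<lambda>n. toy_proj (S n) (creation (step_vec j' 0 (S n (Suc (K n)))) (toy_proj (S n) \<psi>)))
        \<longlonglongrightarrow> creation (step_vec j' 0 t) \<psi>"
      by (intro toy_proj_tendsto_diagonal creation_tendsto step proj)
    ultimately show ?thesis
      by (simp add: ij K(1) weight_exp_def half disc_op_None_Some[OF part])
  next
    fix i' assume ij: "i = Some i'" "j = None"
    have "(\<lambda>n. annihilation (step_vec i' 0 (S n (Suc (K n)))) (toy_proj (S n) \<psi>))
        \<longlonglongrightarrow> annihilation (step_vec i' 0 t) \<psi>"
      by (intro annihilation_tendsto step proj)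
    thus ?thesis
      by (simp add: ij K(1) weight_exp_def half disc_op_Some_None[OF part] annihilation_step_vec[OF part])
  next
    fix i' j' assume ij: "i = Some i'" "j = Some j'"
    have "(\<lambda>n. gauge (comp_shift i' j' (S n (Suc (K n)))) (toy_proj (S n) \<psi>))
        \<longlonglongrightarrow> gauge (comp_shift i' j' t) \<psi>"
      by (intro gauge_comp_shift_tendsto K t proj)
    moreover have "S n (Suc k) \<noteq> S n k" for n k using pos[of n k] by simp
    ultimately show ?thesis
      by (simp add: ij K(1) weight_exp_def disc_op_Some_Some[OF part] gauge_comp_shift_eq_sum[OF part])
  next
    assume ij: "i = None" "j = None"
    obtain m where m: "m \<longlonglongrightarrow> 0" "\<forall>\<^sub>F n in sequentially. \<forall>k. S n (Suc k) - S n k \<le> m n"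
      using mesh_bound[OF mesh] by blast
    define r where "r n = (\<Sum>k\<le>K n. (S n (Suc k) - S n k) *\<^sub>R site_proj (S n) k (toy_proj (S n) \<psi>))" for n
    have "r \<longlonglongrightarrow> 0"
    proof (rule Lim_null_comparison)
      show "\<forall>\<^sub>F n in sequentially. norm (r n) \<le> m n * norm (toy_proj (S n) \<psi>)"
        using m(2)
      proof eventually_elim
        case (elim n)
        hence "\<bar>S n (Suc k) - S n k\<bar> \<le> m n" for k using pos[of n k] by simp
        moreover from this have "0 \<le> m n" by (meson abs_ge_zero order.trans)
        ultimately show ?case
          unfolding r_def by (intro norm_weighted_site_proj_le part) auto
      qed
      have "(\<lambda>n. m n * norm (toy_proj (S n) \<psi>)) \<longlonglongrightarrow> 0 * norm \<psi>" by (intro tendsto_intros m proj)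
      thus "(\<lambda>n. m n * norm (toy_proj (S n) \<psi>)) \<longlonglongrightarrow> 0" by simp
    qed
    hence lim: "(\<lambda>n. S n (Suc (K n)) *\<^sub>R toy_proj (S n) \<psi> - r n) \<longlonglongrightarrow> t *\<^sub>R \<psi> - 0"
      by (intro tendsto_intros K proj)
    have telescope: "(\<Sum>k\<le>K n. S n (Suc k) - S n k) = S n (Suc (K n))" for n
      using sum_lessThan_telescope[of "S n" "Suc (K n)"]
      by (simp add: lessThan_Suc_atMost partition_0[OF part])
    have "(\<Sum>k\<le>K n. (S n (Suc k) - S n k) *\<^sub>R
          (toy_proj (S n) \<psi> - site_proj (S n) k (toy_proj (S n) \<psi>)))
        = S n (Suc (K n)) *\<^sub>R toy_proj (S n) \<psi> - r n" for n
      unfolding r_def scaleR_diff_right sum_subtractf[of "\<lambda>k. (S n (Suc k) - S n k) *\<^sub>R toy_proj (S n) \<psi>"] scaleR_left.sum[symmetric]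
        telescope ..
    moreover have "(S n (Suc k) - S n k) powr 1 = S n (Suc k) - S n k" for n k
      using pos[of n k] by simp
    ultimately show ?thesis
      using lim by (simp add: ij K(1) weight_exp_def disc_op_None_None[OF part])
  qed
qed

end

theorem theorem2:
  fixes S :: "nat \<Rightarrow> nat \<Rightarrow> real"
  assumes "\<And>n. is_partition (S n)"
    and "\<And>n. partition_refines (S (Suc n)) (S n)"
    and "(\<lambda>n. mesh (S n)) \<longlonglongrightarrow> 0"
  shows "(\<forall>f :: 'n::finite L2 fock. (\<lambda>n. orth_proj (toy_fock (S n)) f) \<longlonglongrightarrow> f) \<and>
         (\<forall>t\<ge>0. \<forall>i j :: 'n option.
            strongly_converges
              (\<lambda>n \<psi>. \<Sum>k | S n k \<le> t.
                 ((S n (Suc k) - S n k) powr weight_exp i j) *\<^sub>R disc_op (S n) i j k \<psi>)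
              (cont_op i j t))"
  unfolding strongly_converges_def
  by (intro conjI allI impI toy_proj_tendsto disc_op_sum_tendsto bounded_clinear_cont_op
      bounded_clinear_sum_fun bounded_clinear_scaleR_right bounded_clinear_disc_op assms)

end
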